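(* Let $V$ be a finite-dimensional real vector space with a lattice $V_{\mathbb Z}$ and dual lattice $V_{\mathbb Z}^*\subset V^*$. Let $\Delta\subset V$ be a simple rational polytope with $d$ facets, let $u_1,\dots,u_d\in V_{\mathbb Z}^*$ be the primitive inward normals to the facets of $\Delta$, and let $\lambda_1,\dots,\lambda_d$ be the real numbers such that $$\Delta=\bigcap_{i=1}^d\{x\in V\mid \langle u_i,x\rangle+\lambda_i\ge 0\}.$$ Suppose that $\lambda_1,\dots,\lambda_d$ are integers. For $h=(h_1,\dots,h_d)\in\mathbb R^d$ let $$\Delta(h)=\bigcap_{i=1}^d\{x\in V\mid \langle u_i,x\rangle+\lambda_i+h_i\ge 0\}.$$ Let $$\mathrm{Td}_\Delta(S_1,\dots,S_d)=\sum_F\ \sum_{\gamma\in\Gamma_F^\flat} e^{2\pi i\langle\gamma,F\rangle}\prod_{j\notin I_F}\frac{S_j}{1-e^{-S_j}}\ \prod_{j\in I_F}\frac{S_j}{1-e^{2\pi i\langle\gamma,\alpha_{j,F}\rangle}e^{-S_j}},$$ where $F$ runs over all faces of $\Delta$ and $I_F$, $\alpha_{j,F}$, $\Gamma_F^\flat$, $e^{2\pi i\langle\gamma,F\rangle}$ are as defined in the context. Let $f\colon V\to\mathbb C$ be a quasi-polynomial function, that is, a linear combination of functions of the form $f(x)=p(x)e^{\langle\xi,x\rangle}$, where $p\colon V\to\mathbb C$ are polynomial functions and where the exponents $\xi\in V^*_{\mathbb C}=V^*\otimes\mathbb C$ satisfy $$|\langle\xi,\alpha_{j,v}\rangle|<2\pi\,|\langle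 y,\alpha_{j,v}\rangle|$$ for each vertex $v$ of $\Delta$, each $j\in I_v$, and each $y\in V_{\mathbb Z}^*$ such that $\langle y,\alpha_{j,v}\rangle\ne 0$. Then $$\sum_{x\in\Delta\cap V_{\mathbb Z}}f(x)=\left.\mathrm{Td}_\Delta\!\left(\frac{\partial}{\partial h_1},\dots,\frac{\partial}{\partial h_d}\right)\right|_{h=0}\int_{\Delta(h)}f(x)\,dx,$$ in the sense that the infinite series on the right hand side converges and its sum is the left hand side.
   Context: A polytope is the convex hull of a finite set of points; polytopes are assumed to have nonempty interior. A facet is a codimension one face; faces are nonempty and include $\Delta$ itself. $\Delta$ is simple if exactly $n=\dim V$ facets meet at each vertex, and rational if the normals to its facets can be chosen in $V_{\mathbb Z}^*=\{u\in V^*\mid\langle u,\alpha\rangle\in\mathbb Z\ \forall\alpha\in V_{\mathbb Z}\}$. A nonzero element of $V_{\mathbb Z}^*$ is primitive if it is not the product of an element of $V_{\mathbb Z}^*$ with an integer greater than one. For a face $F$ of $\Delta$, $I_F\subset\{1,\dots,d\}$ is the subset such that $F=\{x\in\Delta\mid\langle u_i,x\rangle+\lambda_i=0\text{ for all }i\in I_F\}$ (so $I_F$ indexes the facets containing $F$; $|I_F|=\operatorname{codim}F$; $I_\Delta=\emptyset$). Let $T_F=\{r(x-y)\mid x,y\in F,\ r\in\mathbb R\}$ and $V_F=V/T_F$; its dual is $V_F^*=T_F^0=\operatorname{span}_{\mathbb R}\{u_j\mid j\in I_F\}\subset V^*$. The vectors $u_j$, $j\in I_F$, form a basis of $V_F^*$,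 and $\alpha_{j,F}$, $j\in I_F$, denotes the dual basis of $V_F$. In particular, for a vertex $v$, $\alpha_{j,v}$, $j\in I_v$, is the basis of $V$ dual to $u_j$, $j\in I_v$ (edge vectors at $v$). The finite abelian group of the face $F$ is $\Gamma_F=(V_F^*\cap V_{\mathbb Z}^* )/\operatorname{span}_{\mathbb Z}\{u_i\mid i\in I_F\}$. If $F\subseteq E$ are faces then the inclusion $V_E^*\subseteq V_F^*$ induces an injection $\Gamma_E\hookrightarrow\Gamma_F$, by which $\Gamma_E$ is regarded as a subgroup of $\Gamma_F$. Put $\Gamma_F^\flat=\Gamma_F\smallsetminus\bigcup_{E\supsetneq F}\Gamma_E$, the union over all faces $E$ with $E\supsetneq F$. For $\gamma\in\Gamma_F$ represented by $y\in V_F^*\cap V_{\mathbb Z}^*$, $e^{2\pi i\langle\gamma,\alpha_{j,F}\rangle}:=e^{2\pi i\langle y,\alpha_{j,F}\rangle}$ for $j\in I_F$, and $e^{2\pi i\langle\gamma,F\rangle}:=e^{2\pi i\langle y,x\rangle}$ for any $x\in F$; these are independent of the choices of $y$ and of $x\in F$. $dx$ is Lebesgue measure on $V$ normalized so that a fundamental domain of $V_{\mathbb Z}$ has measure one. $\langle\xi,x\rangle$ is extended complex-linearly to $\xi\in V^*_{\mathbb C}$. For $h$ near $0$ the integral $\int_{\Delta(h)}f(x)\,dx$ is a smooth function of $h$. For a function $P(S_1,\dots,S_d)$ analytic near the origin, $P(\partial/\partial h_1,\dots,\partial/\partial h_d)|_{h=0}$ applied to a smooth function of $h$ means: expand $P$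 in its Taylor series about the origin, apply the resulting constant coefficient differential operators term by term, evaluate at $h=0$, and sum the resulting series (the partial sums being obtained from the Taylor polynomials of $P$). *)

theory Defs
  imports "HOL-Analysis.Analysis"
begin

text \<open>
  The vector space V is a Euclidean space, and the dual space is identified with V by means of
  the inner product, so that the pairing of a covector u with a vector x is \<open>u \<bullet> x\<close>. The lattice
  is arbitrary and need not be compatible with the inner product. An element of the
  complexified dual is given as a real-linear function from V to the complex numbers.
\<close>

definition int_span :: "'a::real_vector set \<Rightarrow> 'a set" where
  "int_span S = {\<Sum>b\<in>T. of_int (c b) *\<^sub>R b | T (c :: 'a \<Rightarrow> int). finite T \<and> T \<subseteq> S}"

definition lattice_basis :: "'a::real_vector set \<Rightarrow> 'a set \<Rightarrow> bool" where
  "lattice_basis L B \<longleftrightarrow> independent B \<and> span B = UNIV \<and> L = int_span B"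

definition is_lattice :: "'a::real_vector set \<Rightarrow> bool" where
  "is_lattice L \<longleftrightarrow> (\<exists>B. lattice_basis L B)"

definition dual_lattice :: "'a::real_inner set \<Rightarrow> 'a set" where
  "dual_lattice L = {u. \<forall>\<alpha>\<in>L. u \<bullet> \<alpha> \<in> \<int>}"

definition primitive_covector :: "'a::real_inner set \<Rightarrow> 'a \<Rightarrow> bool" where
  "primitive_covector L y \<longleftrightarrow> y \<in> dual_lattice L \<and> y \<noteq> 0 \<and>
     \<not> (\<exists>w\<in>dual_lattice L. \<exists>k::int. k > 1 \<and> y = of_int k *\<^sub>R w)"

text \<open>The volume of a fundamental domain does not depend on the chosen lattice basis.\<close>

definition covolume :: "'a::euclidean_space set \<Rightarrow> real" where
  "covolume L = (let B = (SOME B. lattice_basis L B) in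
     measure lborel {\<Sum>b\<in>B. t b *\<^sub>R b | t. \<forall>b\<in>B. 0 \<le> t b \<and> t b < 1})"

definition lattice_lborel :: "'a::euclidean_space set \<Rightarrow> 'a measure" where
  "lattice_lborel L = density lborel (\<lambda>_. ennreal (1 / covolume L))"

definition simple_polytope :: "'a::euclidean_space set \<Rightarrow> bool" where
  "simple_polytope P \<longleftrightarrow> polytope P \<and>
     (\<forall>v. v extreme_point_of P \<longrightarrow> card {F. F facet_of P \<and> v \<in> F} = DIM('a))"

definition inward_normal :: "'a::real_inner set \<Rightarrow> 'a set \<Rightarrow> 'a \<Rightarrow> bool" where
  "inward_normal P F u \<longleftrightarrow> u \<noteq> 0 \<and> (\<forall>x\<in>F. \<forall>y\<in>P. u \<bullet> x \<le> u \<bullet> y)"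

definition rational_polytope :: "'a::euclidean_space set \<Rightarrow> 'a set \<Rightarrow> bool" where
  "rational_polytope L P \<longleftrightarrow> polytope P \<and>
     (\<forall>F. F facet_of P \<longrightarrow> (\<exists>u\<in>dual_lattice L. inward_normal P F u))"

text \<open>Faces in the sense of the library include the empty set, which is excluded here.\<close>

definition faces :: "'a::real_vector set \<Rightarrow> 'a set set" where
  "faces P = {F. F face_of P \<and> F \<noteq> {}}"

definition halfspaces :: "nat \<Rightarrow> (nat \<Rightarrow> 'a::real_inner) \<Rightarrow> (nat \<Rightarrow> real) \<Rightarrow> 'a set" where
  "halfspaces d u c = (\<Inter>i\<in>{1..d}. {x. u i \<bullet> x + c i \<ge> 0})"

definition face_index ::
  "nat \<Rightarrow> (nat \<Rightarrow> 'a::real_inner) \<Rightarrow> (nat \<Rightarrow> real) \<Rightarrow> 'a set \<Rightarrow> nat set" where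
  "face_index d u c F = {i\<in>{1..d}. \<forall>x\<in>F. u i \<bullet> x + c i = 0}"

definition face_tangent :: "'a::real_vector set \<Rightarrow> 'a set" where
  "face_tangent F = {r *\<^sub>R (x - y) | r x y. x \<in> F \<and> y \<in> F}"

text \<open>The dual of the quotient of V by the tangent space of F, as the annihilator of the latter.\<close>

definition face_conormal :: "'a::real_inner set \<Rightarrow> 'a set" where
  "face_conormal F = {y. \<forall>t\<in>face_tangent F. y \<bullet> t = 0}"

text \<open>
  For \<open>I = face_index d u c F\<close>, the vectors \<open>\<alpha>\<close> with the property below form a coset of
  \<open>face_tangent F\<close>, which is the member with index j of the basis of the quotient
  dual to \<open>u k\<close>, \<open>k \<in> I\<close>. The definition picks a representative; its pairing with elements of
  \<open>face_conormal F\<close> does not depend on the choice. If F is a vertex, the representative is unique.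
\<close>

definition dual_vec :: "(nat \<Rightarrow> 'a::real_inner) \<Rightarrow> nat set \<Rightarrow> nat \<Rightarrow> 'a" where
  "dual_vec u I j = (SOME \<alpha>. \<forall>k\<in>I. u k \<bullet> \<alpha> = (if k = j then 1 else 0))"

text \<open>
  The group of a face is the set of cosets of the integer span of the normals indexed by
  \<open>face_index d u c F\<close>.
\<close>

definition normal_coset :: "(nat \<Rightarrow> 'a::real_vector) \<Rightarrow> nat set \<Rightarrow> 'a \<Rightarrow> 'a set" where
  "normal_coset u I y = {y + z | z. z \<in> int_span (u ` I)}"

definition face_group ::
  "'a::real_inner set \<Rightarrow> nat \<Rightarrow> (nat \<Rightarrow> 'a) \<Rightarrow> (nat \<Rightarrow> real) \<Rightarrow> 'a set \<Rightarrow> 'a set set" where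
  "face_group L d u c F =
     normal_coset u (face_index d u c F) ` (face_conormal F \<inter> dual_lattice L)"

text \<open>The map from the group of a face containing F to the group of F, induced by inclusion.\<close>

definition group_embed ::
  "nat \<Rightarrow> (nat \<Rightarrow> 'a::real_inner) \<Rightarrow> (nat \<Rightarrow> real) \<Rightarrow> 'a set \<Rightarrow> 'a set \<Rightarrow> 'a set" where
  "group_embed d u c F \<gamma> = (\<Union>y\<in>\<gamma>. normal_coset u (face_index d u c F) y)"

definition face_group_flat ::
  "'a::real_inner set \<Rightarrow> 'a set \<Rightarrow> nat \<Rightarrow> (nat \<Rightarrow> 'a) \<Rightarrow> (nat \<Rightarrow> real) \<Rightarrow> 'a set \<Rightarrow> 'a set set" where
  "face_group_flat L P d u c F = face_group L d u c F -
     (\<Union>E\<in>{E \<in> faces P. F \<subset> E}. group_embed d u c F ` face_group L d u c E)"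

text \<open>
  The two characters below are well defined, the second one since the \<open>c i\<close> are integers in the
  intended use.
\<close>

definition group_char :: "(nat \<Rightarrow> 'a::real_inner) \<Rightarrow> nat set \<Rightarrow> 'a set \<Rightarrow> nat \<Rightarrow> complex" where
  "group_char u I \<gamma> j =
     exp (2 * of_real pi * \<i> * of_real ((SOME y. y \<in> \<gamma>) \<bullet> dual_vec u I j))"

definition face_char :: "'a::real_inner set \<Rightarrow> 'a set \<Rightarrow> complex" where
  "face_char F \<gamma> =
     exp (2 * of_real pi * \<i> * of_real ((SOME y. y \<in> \<gamma>) \<bullet> (SOME x. x \<in> F)))"

text \<open>The function \<open>s / (1 - a * exp (- s))\<close>, with its removable singularity at 0 filled in.\<close>

definition todd_factor :: "complex \<Rightarrow> complex \<Rightarrow> complex" where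
  "todd_factor a s = (if a = 1 \<and> s = 0 then 1 else s / (1 - a * exp (- s)))"

definition Todd ::
  "'a::real_inner set \<Rightarrow> 'a set \<Rightarrow> nat \<Rightarrow> (nat \<Rightarrow> 'a) \<Rightarrow> (nat \<Rightarrow> real) \<Rightarrow> (nat \<Rightarrow> complex) \<Rightarrow> complex"
  where
  "Todd L P d u c S =
     (\<Sum>F\<in>faces P. \<Sum>\<gamma>\<in>face_group_flat L P d u c F.
        face_char F \<gamma> *
        (\<Prod>j\<in>{1..d} - face_index d u c F. todd_factor 1 (S j)) *
        (\<Prod>j\<in>face_index d u c F. todd_factor (group_char u (face_index d u c F) \<gamma> j) (S j)))"

text \<open>
  Partial derivatives of functions of the variables with indices 1, ..., d. The operator D is
  differentiation in one variable, over the complex or over the real numbers. The exponent m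
  is a multi-index; variables are differentiated in increasing order of their index, which is
  immaterial for smooth functions.
\<close>

definition partial_deriv ::
  "(('s \<Rightarrow> complex) \<Rightarrow> 's \<Rightarrow> complex) \<Rightarrow> nat \<Rightarrow> ((nat \<Rightarrow> 's) \<Rightarrow> complex) \<Rightarrow> (nat \<Rightarrow> 's) \<Rightarrow> complex"
  where
  "partial_deriv D i g h = D (\<lambda>t. g (h(i := t))) (h i)"

definition multi_deriv ::
  "(('s \<Rightarrow> complex) \<Rightarrow> 's \<Rightarrow> complex) \<Rightarrow> nat \<Rightarrow> (nat \<Rightarrow> nat) \<Rightarrow> ((nat \<Rightarrow> 's) \<Rightarrow> complex)
     \<Rightarrow> (nat \<Rightarrow> 's) \<Rightarrow> complex" where
  "multi_deriv D d m g = fold (\<lambda>i. partial_deriv D i ^^ m i) [1..<Suc d] g"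

definition multi_indices :: "nat \<Rightarrow> nat \<Rightarrow> (nat \<Rightarrow> nat) set" where
  "multi_indices d k = {m. (\<forall>i. i \<notin> {1..d} \<longrightarrow> m i = 0) \<and> (\<Sum>i=1..d. m i) = k}"

definition taylor_coeff :: "nat \<Rightarrow> ((nat \<Rightarrow> complex) \<Rightarrow> complex) \<Rightarrow> (nat \<Rightarrow> nat) \<Rightarrow> complex" where
  "taylor_coeff d P m = multi_deriv deriv d m P (\<lambda>_. 0) / of_nat (\<Prod>i=1..d. fact (m i))"

text \<open>
  The part of degree k of the Taylor series of P at the origin, with partial derivatives
  substituted for the variables, applied to g and evaluated at 0.
\<close>

definition diff_op_term ::
  "nat \<Rightarrow> ((nat \<Rightarrow> complex) \<Rightarrow> complex) \<Rightarrow> ((nat \<Rightarrow> real) \<Rightarrow> complex) \<Rightarrow> nat \<Rightarrow> complex" where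
  "diff_op_term d P g k =
     (\<Sum>m\<in>multi_indices d k. taylor_coeff d P m *
        multi_deriv (\<lambda>q t. vector_derivative q (at t)) d m g (\<lambda>_. 0))"

definition quasi_polynomial :: "(('a::euclidean_space \<Rightarrow> complex) \<Rightarrow> bool) \<Rightarrow> ('a \<Rightarrow> complex) \<Rightarrow> bool"
  where
  "quasi_polynomial A f \<longleftrightarrow>
     (\<exists>(N::nat) a p \<xi>.
        (\<forall>k<N. polynomial_function (p k) \<and> linear (\<xi> k) \<and> A (\<xi> k)) \<and>
        f = (\<lambda>x. \<Sum>k<N. a k * (p k x * exp (\<xi> k x))))"

definition admissible_exponent ::
  "'a::euclidean_space set \<Rightarrow> 'a set \<Rightarrow> nat \<Rightarrow> (nat \<Rightarrow> 'a) \<Rightarrow> (nat \<Rightarrow> real) \<Rightarrow> ('a \<Rightarrow> complex) \<Rightarrow> bool"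
  where
  "admissible_exponent L P d u c \<xi> \<longleftrightarrow>
     (\<forall>v j y. v extreme_point_of P \<longrightarrow> j \<in> face_index d u c {v} \<longrightarrow> y \<in> dual_lattice L \<longrightarrow>
        y \<bullet> dual_vec u (face_index d u c {v}) j \<noteq> 0 \<longrightarrow>
        norm (\<xi> (dual_vec u (face_index d u c {v}) j))
          < 2 * pi * \<bar>y \<bullet> dual_vec u (face_index d u c {v}) j\<bar>)"

end

(*
Brion's formulas express the integral of exp xi over Delta(h) and its sum over the lattice points
of Delta as sums over the vertices v; for the integral the h-dependence of the v-term is the
factor exp (- sum_j h_j xi(alpha_{j,v})). Hence the operator Td(d/dh) multiplies the v-term by the
Todd function at the point with coordinates - xi(alpha_{j,v}), j in I_v, and 0 elsewhere. There the
faces not containing v contribute nothing, the groups Gamma_F^flat of the others partition Gamma_v,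
and the result is the v-term of the lattice sum; the bound on xi places the point inside the
polydisc of convergence.

Both formulas follow from the Lawrence-Varchenko decomposition of the indicator function of
Delta(h) into cones at the vertices whose edges are turned so that exp xi decays along them. The
lattice sum over a cone is reduced to geometric series by writing the indicator function of the
lattice as an average of the characters in Gamma_v.

A polynomial is a combination of powers of generic linear forms eta, and
<eta,x>^m exp <xi,x> is a contour integral of exp <xi + z eta,x> over a small circle in z, on which
the vertex terms are nonsingular and the series of the operator converges uniformly.
*)
theory Submission
  imports Defs "HOL-Complex_Analysis.Complex_Analysis"
begin

section \<open>Dual bases and lattices\<close>

text \<open>The cones are half-open: closed along the edges on which exp \<xi> decays, open along
  the turned ones. So the decomposition holds at every point and serves the lattice sum, where
  boundary points count, as well as the integral. Turning an edge costs one sign, because the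
  geometric series over k < 0 and over k >= 0 have opposite rational functions as sums; the signs of
  the decomposition cancel these, and the vertex terms do not remember which edges were turned.

  Integrality of the \<open>c j\<close> gives lattice points integer coordinates along the edges at
  v, although v need not lie in L. The lattice spanned by these edges contains L with index
  |\<Gamma>_v|; hence the cell volume divided by the covolume, which normalises the integral, equals
  the factor 1 / |\<Gamma>_v| of the average over characters.

  The bound on \<xi> at \<open>u j\<close>, y and y - \<open>u j\<close> keeps \<xi> closer to 0
  along the edge than every pole of the Todd factors. It allows \<xi> to vanish on an edge, where
  single vertex terms of the integral are singular though their sum is not; this is the obstacle
  that the contour integral removes.\<close>

locale dual_bases =
  fixes I :: "'i set" and \<alpha> u :: "'i \<Rightarrow> 'a::euclidean_space"
  assumes finI: "finite I"
    and dual: "\<And>i j. i \<in> I \<Longrightarrow> j \<in> I \<Longrightarrow> u i \<bullet> \<alpha> j = (if i = j then 1 else 0)"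
    and expand: "\<And>x. (\<Sum>i\<in>I. (u i \<bullet> x) *\<^sub>R \<alpha> i) = x"
begin

lemma inner_expand: "y \<bullet> x = (\<Sum>i\<in>I. (u i \<bullet> x) * (y \<bullet> \<alpha> i))"
proof -
  have "y \<bullet> x = y \<bullet> (\<Sum>i\<in>I. (u i \<bullet> x) *\<^sub>R \<alpha> i)" by (simp only: expand)
  then show ?thesis by (simp add: inner_sum_right)
qed

text \<open>Nondegeneracy of the inner product: both sides of the new expansion pair equally with
  every x. The swapped instance turns \<open>lat\<close> into the dual lattice and
  \<open>cell\<close> into the cell spanned by the \<open>u i\<close>.\<close>

lemma swap: "dual_bases I u \<alpha>"
proof
  fix y
  have "(\<Sum>i\<in>I. (\<alpha> i \<bullet> y) *\<^sub>R u i) \<bullet> x = y \<bullet> x" for x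
  proof -
    have "y \<bullet> x = (\<Sum>i\<in>I. (\<alpha> i \<bullet> y) * (u i \<bullet> x))"
      by (subst inner_expand) (simp add: inner_commute mult.commute)
    then show ?thesis by (simp add: inner_sum_left)
  qed
  then show "(\<Sum>i\<in>I. (\<alpha> i \<bullet> y) *\<^sub>R u i) = y"
    by (metis vector_eq_rdot)
qed (use finI dual in \<open>auto simp: inner_commute\<close>)

lemma coord_eqI:
  assumes "\<And>i. i \<in> I \<Longrightarrow> u i \<bullet> x = u i \<bullet> y"
  shows "x = y"
  using expand[of x] expand[of y] assms by (metis (no_types, lifting) sum.cong)

lemma inner_comb: "j \<in> I \<Longrightarrow> u j \<bullet> (\<Sum>i\<in>I. t i *\<^sub>R \<alpha> i) = t j"
  by (simp add: inner_sum_right dual finI if_distrib cong: if_cong)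

lemma inj_vec: "inj_on \<alpha> I"
  by (rule inj_onI) (metis dual zero_neq_one)

definition cell :: "'a set" where
  "cell = {x. \<forall>i\<in>I. 0 \<le> u i \<bullet> x \<and> u i \<bullet> x < 1}"

definition lat :: "'a set" where
  "lat = {x. \<forall>i\<in>I. u i \<bullet> x \<in> \<int>}"

text \<open>Reduction modulo \<open>lat\<close> to the representative in
  \<open>cell\<close>.\<close>

definition red :: "'a \<Rightarrow> 'a" where
  "red x = x - (\<Sum>i\<in>I. of_int \<lfloor>u i \<bullet> x\<rfloor> *\<^sub>R \<alpha> i)"

lemma inner_red: "i \<in> I \<Longrightarrow> u i \<bullet> red x = frac (u i \<bullet> x)"
  by (simp add: red_def inner_diff_right inner_comb frac_def)

lemma red_in_cell: "red x \<in> cell"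
  by (auto simp: cell_def inner_red frac_ge_0 frac_lt_1)

lemma red_diff: "x - red x \<in> lat"
  by (simp add: lat_def inner_diff_right inner_red) (simp add: frac_def)

lemma lat_diff: "x \<in> lat \<Longrightarrow> y \<in> lat \<Longrightarrow> x - y \<in> lat"
  by (auto simp: lat_def inner_diff_right)

lemma lat_add: "x \<in> lat \<Longrightarrow> y \<in> lat \<Longrightarrow> x + y \<in> lat"
  by (auto simp: lat_def inner_add_right)

lemma zero_in_lat: "0 \<in> lat" by (auto simp: lat_def)

lemma zero_in_cell: "0 \<in> cell" by (auto simp: cell_def)

text \<open>The coordinates of the difference are integers of absolute value below 1.\<close>

lemma cell_eqI: "x \<in> cell \<Longrightarrow> y \<in> cell \<Longrightarrow> x - y \<in> lat \<Longrightarrow> x = y"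
proof (rule coord_eqI)
  fix i assume *: "x \<in> cell" "y \<in> cell" "x - y \<in> lat" "i \<in> I"
  then obtain k :: int where k: "u i \<bullet> x - u i \<bullet> y = of_int k"
    by (auto simp: lat_def inner_diff_right Ints_def)
  moreover have "\<bar>u i \<bullet> x - u i \<bullet> y\<bar> < 1" using * by (auto simp: cell_def abs_if dest!: bspec[of _ _ i])
  ultimately have "k = 0" by linarith
  then show "u i \<bullet> x = u i \<bullet> y" using k by simp
qed

lemma lat_Int_cell: "lat \<inter> cell = {0}"
  using cell_eqI[OF _ zero_in_cell] zero_in_lat zero_in_cell by auto

lemma vec_in_lat: "i \<in> I \<Longrightarrow> \<alpha> i \<in> lat"
  by (auto simp: lat_def dual)

text \<open>Describes the span by coordinates, which later makes the groups of the faces computable.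
  Coefficients in \<open>int_span\<close> are attached to vectors, not to indices, so the reverse
  inclusion goes through the injectivity of \<open>\<alpha>\<close>.\<close>

lemma int_span_subset_eq:
  assumes A: "A \<subseteq> I"
  shows "int_span (\<alpha> ` A) = {x \<in> lat. \<forall>i\<in>I - A. u i \<bullet> x = 0}"
proof
  show "int_span (\<alpha> ` A) \<subseteq> {x \<in> lat. \<forall>i\<in>I - A. u i \<bullet> x = 0}"
  proof
    fix x assume "x \<in> int_span (\<alpha> ` A)"
    then obtain T c where x: "x = (\<Sum>b\<in>T. of_int (c b) *\<^sub>R b)" and T: "T \<subseteq> \<alpha> ` A"
      unfolding int_span_def by blast
    have val: "u i \<bullet> b \<in> \<int> \<and> (i \<notin> A \<longrightarrow> u i \<bullet> b = 0)" if ib: "i \<in> I" "b \<in> T" for i b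
    proof -
      obtain a where "a \<in> A" "b = \<alpha> a" using ib T by blast
      then show ?thesis using dual[of i a] ib A by auto
    qed
    have "u i \<bullet> b \<in> \<int>" if "i \<in> I" "b \<in> T" for i b using val[OF that] by simp
    moreover have "u i \<bullet> b = 0" if "i \<in> I - A" "b \<in> T" for i b using val[of i b] that by simp
    ultimately show "x \<in> {x \<in> lat. \<forall>i\<in>I - A. u i \<bullet> x = 0}"
      by (auto simp: x lat_def inner_sum_right intro!: Ints_sum Ints_mult)
  qed
  show "{x \<in> lat. \<forall>i\<in>I - A. u i \<bullet> x = 0} \<subseteq> int_span (\<alpha> ` A)"
  proof
    fix x assume x: "x \<in> {x \<in> lat. \<forall>i\<in>I - A. u i \<bullet> x = 0}"
    let ?c = "\<lambda>b. \<lfloor>u (inv_into A \<alpha> b) \<bullet> x\<rfloor>"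
    have inj: "inj_on \<alpha> A" using inj_vec A by (rule inj_on_subset)
    have "(\<Sum>b\<in>\<alpha> ` A. of_int (?c b) *\<^sub>R b) = (\<Sum>i\<in>A. of_int (?c (\<alpha> i)) *\<^sub>R \<alpha> i)"
      by (rule sum.reindex_cong[OF inj]) auto
    also have "\<dots> = (\<Sum>i\<in>A. (u i \<bullet> x) *\<^sub>R \<alpha> i)"
    proof (intro sum.cong refl)
      fix i assume i: "i \<in> A"
      then have "u i \<bullet> x \<in> \<int>" using x A by (auto simp: lat_def)
      then show "of_int (?c (\<alpha> i)) *\<^sub>R \<alpha> i = (u i \<bullet> x) *\<^sub>R \<alpha> i" using i inj by simp
    qed
    also have "\<dots> = (\<Sum>i\<in>I. (u i \<bullet> x) *\<^sub>R \<alpha> i)"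
      using x A finI by (intro sum.mono_neutral_left) auto
    finally have "x = (\<Sum>b\<in>\<alpha> ` A. of_int (?c b) *\<^sub>R b)" by (simp add: expand)
    moreover have "finite A" using A finI finite_subset by blast
    ultimately show "x \<in> int_span (\<alpha> ` A)" unfolding int_span_def
      by (intro CollectI exI[of _ "\<alpha> ` A"] exI[of _ ?c]) simp
  qed
qed

lemma lat_eq_int_span: "lat = int_span (\<alpha> ` I)"
  using int_span_subset_eq[OF order_refl] by simp

text \<open>Needed for countable additivity over the translates of the cell.\<close>

lemma countable_lat: "countable lat"
proof -
  have "lat \<subseteq> (\<lambda>k. \<Sum>i\<in>I. of_int (k i) *\<^sub>R \<alpha> i) ` (PiE I (\<lambda>_. UNIV :: int set))"
  proof
    fix x assume "x \<in> lat"
    then have "x = (\<Sum>i\<in>I. of_int (restrict (\<lambda>i. \<lfloor>u i \<bullet> x\<rfloor>) I i) *\<^sub>R \<alpha> i)"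
      by (subst expand[symmetric]) (auto simp: lat_def intro!: sum.cong)
    then show "x \<in> (\<lambda>k. \<Sum>i\<in>I. of_int (k i) *\<^sub>R \<alpha> i) ` (PiE I (\<lambda>_. UNIV :: int set))"
      by (intro image_eqI[where x = "restrict (\<lambda>i. \<lfloor>u i \<bullet> x\<rfloor>) I"]) auto
  qed
  moreover have "countable (PiE I (\<lambda>_. UNIV :: int set))"
    by (rule countable_PiE) (use finI in auto)
  ultimately show ?thesis by (rule countable_subset[OF _ countable_image])
qed

lemma finite_lat_bounded:
  assumes "\<And>x i. x \<in> S \<Longrightarrow> i \<in> I \<Longrightarrow> \<bar>u i \<bullet> x\<bar> \<le> K" "S \<subseteq> lat"
  shows "finite S"
proof -
  let ?f = "\<lambda>x. restrict (\<lambda>i. \<lfloor>u i \<bullet> x\<rfloor>) I"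
  have "inj_on ?f S"
  proof (rule inj_onI)
    fix x y assume *: "x \<in> S" "y \<in> S" "?f x = ?f y"
    show "x = y"
    proof (rule coord_eqI)
      fix i assume "i \<in> I"
      moreover from this have "\<lfloor>u i \<bullet> x\<rfloor> = \<lfloor>u i \<bullet> y\<rfloor>" using *(3) by (metis restrict_apply')
      moreover have "u i \<bullet> x \<in> \<int>" "u i \<bullet> y \<in> \<int>" using * assms(2) \<open>i \<in> I\<close> by (auto simp: lat_def)
      ultimately show "u i \<bullet> x = u i \<bullet> y" by (auto elim!: Ints_cases)
    qed
  qed
  moreover have "?f ` S \<subseteq> PiE I (\<lambda>_. {- \<lceil>K\<rceil> .. \<lceil>K\<rceil>})"
  proof -
    have "- \<lceil>K\<rceil> \<le> \<lfloor>u i \<bullet> x\<rfloor>" "\<lfloor>u i \<bullet> x\<rfloor> \<le> \<lceil>K\<rceil>" if "x \<in> S" "i \<in> I" for x i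
      using assms(1)[OF that] by linarith+
    then show ?thesis by (auto simp: PiE_iff)
  qed
  moreover have "finite (PiE I (\<lambda>_. {- \<lceil>K\<rceil> .. \<lceil>K\<rceil>}))" using finI by (intro finite_PiE) auto
  ultimately show ?thesis by (meson finite_imageD finite_subset)
qed

lemma finite_lat_Int_bounded: "bounded S \<Longrightarrow> finite (S \<inter> lat)"
proof -
  assume "bounded S"
  then obtain b where b: "\<And>x. x \<in> S \<Longrightarrow> norm x \<le> b" by (auto simp: bounded_iff)
  show ?thesis
  proof (rule finite_lat_bounded[where K = "(\<Sum>i\<in>I. norm (u i)) * \<bar>b\<bar>"])
    fix x i assume "x \<in> S \<inter> lat" and i: "i \<in> I"
    then have "norm x \<le> \<bar>b\<bar>" using b[of x] by auto
    have "\<bar>u i \<bullet> x\<bar> \<le> norm (u i) * norm x" by (rule Cauchy_Schwarz_ineq2)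
    also have "\<dots> \<le> (\<Sum>i\<in>I. norm (u i)) * \<bar>b\<bar>"
      using i finI \<open>norm x \<le> \<bar>b\<bar>\<close>
      by (intro mult_mono member_le_sum) (auto intro: sum_nonneg)
    finally show "\<bar>u i \<bullet> x\<bar> \<le> \<dots>" .
  qed auto
qed

lemma bounded_coords:
  assumes "\<And>x i. x \<in> S \<Longrightarrow> i \<in> I \<Longrightarrow> \<bar>u i \<bullet> x\<bar> \<le> K"
  shows "bounded S"
proof (rule boundedI)
  fix x assume "x \<in> S"
  have "norm x \<le> (\<Sum>i\<in>I. norm ((u i \<bullet> x) *\<^sub>R \<alpha> i))"
    by (subst expand[symmetric]) (rule norm_sum)
  also have "\<dots> \<le> (\<Sum>i\<in>I. K * norm (\<alpha> i))"
    using assms[OF \<open>x \<in> S\<close>] by (intro sum_mono) (auto intro: mult_right_mono)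
  finally show "norm x \<le> (\<Sum>i\<in>I. K * norm (\<alpha> i))" .
qed

lemma bounded_cell: "bounded cell"
  by (rule bounded_coords[where K = 1]) (auto simp: cell_def abs_if dest: bspec)

lemma cell_measurable [measurable]: "cell \<in> sets borel"
proof -
  have "cell = (\<Inter>i\<in>I. {x. 0 \<le> u i \<bullet> x} \<inter> {x. u i \<bullet> x < 1}) \<inter> UNIV"
    by (auto simp: cell_def)
  also have "\<dots> \<in> sets borel"
  proof (cases "I = {}")
    case False
    have "{x. 0 \<le> u i \<bullet> x} \<inter> {x. u i \<bullet> x < 1} \<in> sets borel" for i
      by (intro sets.Int borel_closed[OF closed_halfspace_ge] borel_open[OF open_halfspace_lt])
    then have "(\<Inter>i\<in>I. {x. 0 \<le> u i \<bullet> x} \<inter> {x. u i \<bullet> x < 1}) \<in> sets borel"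
      using finI False by (intro sets.finite_INT) auto
    then show ?thesis by simp
  qed simp
  finally show ?thesis .
qed

end

lemma dual_bases_exists:
  fixes u :: "'i \<Rightarrow> 'a::euclidean_space"
  assumes "finite I" "inj_on u I" "independent (u ` I)" "span (u ` I) = UNIV"
  shows "\<exists>\<alpha>. dual_bases I \<alpha> u"
proof -
  let ?r = "\<lambda>i x. representation (u ` I) x (u i)"
  \<comment> \<open>The Riesz vector of the i-th coordinate functional.\<close>
  define \<alpha> where "\<alpha> i = (\<Sum>b\<in>Basis. ?r i b *\<^sub>R b)" for i
  have lin: "linear (?r i)" for i
    by (rule linearI) (use assms in \<open>auto simp: representation_add representation_scale\<close>)
  have \<alpha>: "\<alpha> i \<bullet> x = ?r i x" for i x
  proof -
    have "?r i x = ?r i (\<Sum>b\<in>Basis. (x \<bullet> b) *\<^sub>R b)" by (simp add: euclidean_representation)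
    also have "\<dots> = (\<Sum>b\<in>Basis. (x \<bullet> b) *\<^sub>R ?r i b)"
      by (simp add: linear_sum[OF lin] linear_cmul[OF lin])
    moreover have "\<alpha> i \<bullet> x = (\<Sum>b\<in>Basis. ?r i b * (b \<bullet> x))" by (simp add: \<alpha>_def inner_sum_left)
    ultimately show ?thesis by (simp add: inner_commute mult.commute)
  qed
  have "dual_bases I u \<alpha>"
  proof
    fix i j assume "i \<in> I" "j \<in> I"
    then show "\<alpha> i \<bullet> u j = (if i = j then 1 else 0)"
      using assms representation_basis[of "u ` I" "u j"] by (auto simp: \<alpha> inj_on_eq_iff)
  next
    fix x
    have "(\<Sum>b\<in>u ` I. representation (u ` I) x b *\<^sub>R b) = x"
      using assms by (intro sum_representation_eq) auto
    then show "(\<Sum>i\<in>I. (\<alpha> i \<bullet> x) *\<^sub>R u i) = x"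
      by (simp add: \<alpha> sum.reindex[OF assms(2)])
  qed (rule assms(1))
  then show ?thesis using dual_bases.swap by blast
qed

section \<open>Characters of finite quotients of lattices\<close>

definition e1 :: "real \<Rightarrow> complex" where "e1 x = exp (2 * of_real pi * \<i> * of_real x)"

lemma e1_add: "e1 (x + y) = e1 x * e1 y"
  by (simp add: e1_def exp_add[symmetric] algebra_simps)

lemma e1_0 [simp]: "e1 0 = 1" by (simp add: e1_def)

lemma e1_sum: "e1 (\<Sum>i\<in>A. f i) = (\<Prod>i\<in>A. e1 (f i))"
  by (induction A rule: infinite_finite_induct) (auto simp: e1_add)

lemma e1_of_int_mult: "e1 (of_int k * x) = e1 x powi k"
  by (simp add: e1_def exp_power_int mult_ac)

lemma norm_e1 [simp]: "norm (e1 x) = 1"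
  by (simp add: e1_def norm_exp_eq_Re)

lemma e1_eq_1_iff: "e1 x = 1 \<longleftrightarrow> x \<in> \<int>"
proof -
  have "e1 x = 1 \<longleftrightarrow> (\<exists>n::int. 2 * pi * x = of_int (2 * n) * pi)"
    by (simp add: e1_def exp_eq_1)
  also have "\<dots> \<longleftrightarrow> (\<exists>n::int. x = of_int n)" by (auto simp: field_simps)
  finally show ?thesis by (auto simp: Ints_def)
qed

lemma e1_cong: "x - y \<in> \<int> \<Longrightarrow> e1 x = e1 y"
  using e1_add[of "x - y" y] e1_eq_1_iff[of "x - y"] by simp

context dual_bases
begin

text \<open>Translation by z permutes the classes of \<Lambda> modulo \<open>lat\<close> and
  multiplies the sum by \<open>e1 (y \<bullet> z)\<close>, which is not 1.\<close>

lemma character_sum_eq_0: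
  assumes \<Lambda>: "lat \<subseteq> \<Lambda>" "\<And>x y. x \<in> \<Lambda> \<Longrightarrow> y \<in> \<Lambda> \<Longrightarrow> x + y \<in> \<Lambda>" "\<And>x y. x \<in> \<Lambda> \<Longrightarrow> y \<in> \<Lambda> \<Longrightarrow> x - y \<in> \<Lambda>"
    and y: "\<And>i. i \<in> I \<Longrightarrow> y \<bullet> \<alpha> i \<in> \<int>"
    and z: "z \<in> \<Lambda>" "y \<bullet> z \<notin> \<int>"
  shows "(\<Sum>r\<in>\<Lambda> \<inter> cell. e1 (y \<bullet> r)) = 0"
proof -
  let ?S = "\<Sum>r\<in>\<Lambda> \<inter> cell. e1 (y \<bullet> r)"
  have redL: "x - red x \<in> \<Lambda>" for x using red_diff \<Lambda>(1) by blast
  have red': "red x \<in> \<Lambda>" if "x \<in> \<Lambda>" for x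
    using \<Lambda>(3)[OF that redL[of x]] by simp
  have yl: "y \<bullet> x \<in> \<int>" if "x \<in> lat" for x
    using that y by (subst inner_expand) (auto simp: lat_def intro!: Ints_sum Ints_mult)
  have e: "e1 (y \<bullet> red x) = e1 (y \<bullet> x)" for x
    using yl[OF red_diff[of x]] by (intro e1_cong[symmetric]) (simp add: inner_diff_right)
  \<comment> \<open>Only the class of the argument modulo \<open>lat\<close> matters, so a
    translation can be undone across reductions; this yields the inverse of the permutation
    below.\<close>
  have redred: "red (red (x + a) + b) = red x" if "a + b = 0" for x a b
  proof (rule coord_eqI)
    fix i assume i: "i \<in> I"
    have [simp]: "u i \<bullet> b = - (u i \<bullet> a)" using that by (simp add: add_eq_0_iff)
    have "frac (frac (u i \<bullet> x + u i \<bullet> a) - u i \<bullet> a) = frac (u i \<bullet> x)"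
    proof -
      have "frac (u i \<bullet> x + u i \<bullet> a) - u i \<bullet> a - frac (u i \<bullet> x) =
          of_int (\<lfloor>u i \<bullet> x\<rfloor> - \<lfloor>u i \<bullet> x + u i \<bullet> a\<rfloor>)"
        by (simp add: frac_def)
      then have "frac (u i \<bullet> x + u i \<bullet> a) - u i \<bullet> a - frac (u i \<bullet> x) \<in> \<int>" by (metis Ints_of_int)
      then show ?thesis by (simp only: frac_unique_iff frac_ge_0 frac_lt_1)
    qed
    then show "u i \<bullet> red (red (x + a) + b) = u i \<bullet> red x"
      using i by (simp add: inner_red inner_add_right)
  qed
  have red_id: "red r = r" if "r \<in> cell" for r
    by (rule cell_eqI[OF red_in_cell that]) (use lat_diff[OF zero_in_lat red_diff[of r]] in simp)
  have "bij_betw (\<lambda>r. red (r + z)) (\<Lambda> \<inter> cell) (\<Lambda> \<inter> cell)"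
  proof (rule bij_betwI[where g = "\<lambda>r. red (r - z)"])
    show "(\<lambda>r. red (r + z)) \<in> \<Lambda> \<inter> cell \<rightarrow> \<Lambda> \<inter> cell" "(\<lambda>r. red (r - z)) \<in> \<Lambda> \<inter> cell \<rightarrow> \<Lambda> \<inter> cell"
      using \<Lambda> z by (auto simp: red_in_cell red')
  next
    fix r assume "r \<in> \<Lambda> \<inter> cell"
    then show "red (red (r + z) - z) = r" "red (red (r - z) + z) = r"
      using redred[of z "- z" r] redred[of "- z" z r] red_id[of r] by simp_all
  qed
  then have "?S = (\<Sum>r\<in>\<Lambda> \<inter> cell. e1 (y \<bullet> red (r + z)))"
    by (rule sum.reindex_bij_betw[symmetric])
  also have "\<dots> = ?S * e1 (y \<bullet> z)"
    by (simp add: e inner_add_right e1_add sum_distrib_right)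
  finally show ?thesis using z e1_eq_1_iff[of "y \<bullet> z"] by auto
qed

end

section \<open>Volumes and integrals over cones\<close>

lemma disjoint_family_onI:
  "(\<And>i j. i \<in> I \<Longrightarrow> j \<in> I \<Longrightarrow> i \<noteq> j \<Longrightarrow> A i \<inter> A j = {}) \<Longrightarrow> disjoint_family_on A I"
  by (auto simp: disjoint_family_on_def)

lemma emeasure_translate:
  fixes c :: "'a::euclidean_space"
  assumes [measurable]: "A \<in> sets borel"
  shows "emeasure lborel {x. x + c \<in> A} = emeasure lborel A"
proof -
  have "emeasure lborel A = emeasure (distr lborel borel ((+) c)) A" by (simp add: lborel_distr_plus)
  also have "\<dots> = emeasure lborel ((+) c -` A \<inter> space lborel)" by (rule emeasure_distr) auto
  also have "(+) c -` A \<inter> space lborel = {x. x + c \<in> A}" by (auto simp: add.commute)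
  finally show ?thesis by simp
qed

context dual_bases
begin

text \<open>\<open>x - red x\<close> is the only lattice vector whose translated cell contains
  x.\<close>

lemma emeasure_tiling:
  assumes [measurable]: "S \<in> sets borel"
  shows "emeasure lborel S = (\<integral>\<^sup>+z. emeasure lborel (S \<inter> {x. x - z \<in> cell}) \<partial>count_space lat)"
proof -
  have "S = (\<Union>z\<in>lat. S \<inter> {x. x - z \<in> cell})"
  proof (intro equalityI subsetI)
    fix x assume "x \<in> S"
    then show "x \<in> (\<Union>z\<in>lat. S \<inter> {x. x - z \<in> cell})"
      using red_diff[of x] red_in_cell[of x] by (intro UN_I[of "x - red x"]) auto
  qed auto
  then have "emeasure lborel S = emeasure lborel (\<Union>z\<in>lat. S \<inter> {x. x - z \<in> cell})" by simp
  also have "\<dots> = (\<integral>\<^sup>+z. emeasure lborel (S \<inter> {x. x - z \<in> cell}) \<partial>count_space lat)"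
  proof (rule emeasure_UN_countable[OF _ countable_lat])
    show "disjoint_family_on (\<lambda>z. S \<inter> {x. x - z \<in> cell}) lat"
    proof (rule disjoint_family_onI, rule ccontr)
      fix z w assume zw: "z \<in> lat" "w \<in> lat" "z \<noteq> w"
        "(S \<inter> {x. x - z \<in> cell}) \<inter> (S \<inter> {x. x - w \<in> cell}) \<noteq> {}"
      then obtain x where "x - z \<in> cell" "x - w \<in> cell" by auto
      then have "x - z = x - w" by (rule cell_eqI) (use lat_diff[OF zw(2,1)] in simp)
      with zw show False by simp
    qed
  qed measurable
  finally show ?thesis .
qed

text \<open>Otherwise countably many null translates would cover the whole space.\<close>

lemma emeasure_cell_nonzero: "emeasure lborel cell \<noteq> 0"
proof
  assume 0: "emeasure lborel cell = 0"
  have "emeasure lborel (UNIV \<inter> {x. x - z \<in> cell}) \<le> emeasure lborel cell" for z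
    using emeasure_translate[of cell "- z"] by simp
  then have "emeasure lborel (UNIV :: 'a set) = 0"
    using 0 by (subst emeasure_tiling) (auto simp: nn_integral_0_iff_AE AE_count_space)
  then show False by (simp add: emeasure_lborel_UNIV)
qed

lemma emeasure_cell_finite: "emeasure lborel cell < \<infinity>"
  using bounded_cell emeasure_bounded_finite by blast

definition vol :: real where "vol = measure lborel cell"

lemma vol_pos: "vol > 0"
  using emeasure_cell_nonzero emeasure_cell_finite
  by (simp add: vol_def measure_def enn2real_positive_iff less_top zero_less_iff_neq_zero)

lemma emeasure_cell: "emeasure lborel cell = ennreal vol"
  using emeasure_cell_finite by (simp add: vol_def emeasure_eq_ennreal_measure)

end

text \<open>\<open>K.lat\<close> is the coarse lattice, spanned by the \<open>b j\<close>, and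
  \<open>A.lat\<close> the fine one, spanned by the \<open>\<alpha> i\<close>; the primed instances
  live on the dual side, where the inclusion is reversed. At a vertex these are L and the lattice of
  the edge vectors.\<close>

locale dual_bases_pair = K: dual_bases B b \<beta> + A: dual_bases I \<alpha> u
  for B :: "'j set" and b \<beta> :: "'j \<Rightarrow> 'a::euclidean_space"
  and I :: "'i set" and \<alpha> u :: "'i \<Rightarrow> 'a" +
  assumes sub: "K.lat \<subseteq> A.lat"
begin

sublocale K': dual_bases B \<beta> b by (rule K.swap)
sublocale A': dual_bases I u \<alpha> by (rule A.swap)

text \<open>Representatives of the dual of \<open>K.lat\<close> modulo the dual of
  \<open>A.lat\<close>; at a vertex v this quotient is \<Gamma>_v.\<close>

definition R :: "'a set" where "R = K'.lat \<inter> A'.cell"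

lemma finite_R: "finite R"
  unfolding R_def by (metis Int_commute A'.bounded_cell K'.finite_lat_Int_bounded)

lemma zero_in_R: "0 \<in> R"
  by (simp add: R_def K'.zero_in_lat A'.zero_in_cell)

lemma card_R_pos: "card R > 0"
  using finite_R zero_in_R by (auto simp: card_gt_0_iff)

lemma dual_sub: "A'.lat \<subseteq> K'.lat"
proof
  fix y assume y: "y \<in> A'.lat"
  show "y \<in> K'.lat"
  proof (unfold K'.lat_def, safe)
    fix j assume "j \<in> B"
    then have "b j \<in> A.lat" using K.vec_in_lat sub by auto
    moreover have "b j \<bullet> y = (\<Sum>i\<in>I. (u i \<bullet> b j) * (\<alpha> i \<bullet> y))"
      by (subst inner_commute, subst A.inner_expand) (simp add: inner_commute)
    ultimately show "b j \<bullet> y \<in> \<int>" using y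
      by (auto simp: A.lat_def A'.lat_def intro!: Ints_sum Ints_mult)
  qed
qed

text \<open>Biduality of lattices; membership is tested on the dual basis.\<close>

lemma K_lat_iff: "x \<in> K.lat \<longleftrightarrow> (\<forall>y\<in>K'.lat. y \<bullet> x \<in> \<int>)"
proof
  assume x: "x \<in> K.lat"
  show "\<forall>y\<in>K'.lat. y \<bullet> x \<in> \<int>"
  proof
    fix y assume "y \<in> K'.lat"
    then show "y \<bullet> x \<in> \<int>" using x
      by (subst K.inner_expand) (auto simp: K.lat_def K'.lat_def inner_commute intro!: Ints_sum Ints_mult)
  qed
next
  assume "\<forall>y\<in>K'.lat. y \<bullet> x \<in> \<int>"
  then show "x \<in> K.lat" using K'.vec_in_lat by (auto simp: K.lat_def)
qed

text \<open>Orthogonality of characters: R represents the character group of \<open>A.lat\<close>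
  modulo \<open>K.lat\<close>. Outside \<open>K.lat\<close> the roles are exchanged, and x is a
  nontrivial character of the quotient represented by R.\<close>

lemma lattice_indicator:
  assumes x: "x \<in> A.lat"
  shows "(\<Sum>y\<in>R. e1 (y \<bullet> x)) = (if x \<in> K.lat then of_nat (card R) else 0)"
proof (cases "x \<in> K.lat")
  case True
  then have "e1 (y \<bullet> x) = 1" if "y \<in> R" for y
    using that K_lat_iff by (auto simp: e1_eq_1_iff R_def)
  then show ?thesis using True by simp
next
  case False
  then obtain y where "y \<in> K'.lat" "y \<bullet> x \<notin> \<int>" using K_lat_iff by auto
  then have "(\<Sum>r\<in>K'.lat \<inter> A'.cell. e1 (x \<bullet> r)) = 0"
    using x by (intro A'.character_sum_eq_0[of _ _ y])
      (use dual_sub in \<open>auto simp: K'.lat_add K'.lat_diff A.lat_def inner_commute\<close>)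
  then show ?thesis using False by (simp add: R_def inner_commute)
qed

text \<open>A finite abelian group and its character group have the same order: in the double sum
  over both, either order of summation leaves only the trivial element.\<close>

lemma card_A_lat_cell: "card (A.lat \<inter> K.cell) = card R"
proof -
  let ?G = "A.lat \<inter> K.cell"
  have finG: "finite ?G" by (metis Int_commute K.bounded_cell A.finite_lat_Int_bounded)
  have "0 \<in> ?G" by (simp add: A.zero_in_lat K.zero_in_cell)
  have "r = 0" if "r \<in> ?G" "r \<in> K.lat" for r
    using K.lat_Int_cell that by auto
  then have "(\<Sum>r\<in>?G. \<Sum>y\<in>R. e1 (y \<bullet> r)) = (\<Sum>r\<in>?G. if r = 0 then of_nat (card R) else 0)"
    by (intro sum.cong refl) (auto simp: lattice_indicator K.zero_in_lat)
  also have "\<dots> = of_nat (card R)" using finG \<open>0 \<in> ?G\<close> by simp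
  finally have 1: "(\<Sum>r\<in>?G. \<Sum>y\<in>R. e1 (y \<bullet> r)) = of_nat (card R)" .
  have "(\<Sum>r\<in>?G. e1 (y \<bullet> r)) = 0" if y: "y \<in> R" "y \<noteq> 0" for y
  proof -
    have "\<exists>i\<in>I. y \<bullet> \<alpha> i \<notin> \<int>"
    proof (rule ccontr)
      assume "\<not> ?thesis"
      then have "y \<in> A'.lat" by (auto simp: A'.lat_def inner_commute)
      then show False using y A'.lat_Int_cell by (auto simp: R_def)
    qed
    then obtain i where i: "i \<in> I" "y \<bullet> \<alpha> i \<notin> \<int>" by auto
    show ?thesis
      by (rule K.character_sum_eq_0[of _ _ "\<alpha> i"])
        (use sub i y in \<open>auto simp: A.lat_add A.lat_diff A.vec_in_lat R_def K'.lat_def inner_commute\<close>)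
  qed
  then have "(\<Sum>y\<in>R. \<Sum>r\<in>?G. e1 (y \<bullet> r)) = (\<Sum>y\<in>R. if y = 0 then of_nat (card ?G) else 0)"
    by (intro sum.cong refl) auto
  also have "\<dots> = of_nat (card ?G)" using finite_R zero_in_R by simp
  finally have "(of_nat (card ?G) :: complex) = of_nat (card R)" using 1 by (simp add: sum.swap[of _ R])
  then show ?thesis by simp
qed

text \<open>
  The cell of the coarse lattice is cut into the pieces lying in the cells of the fine lattice;
  regrouped by cosets, the pieces of one coset tile a single cell of the fine lattice.
\<close>

lemma vol_index: "K.vol = real (card R) * A.vol"
proof -
  let ?G = "A.lat \<inter> K.cell"
  have finG: "finite ?G" by (metis Int_commute K.bounded_cell A.finite_lat_Int_bounded)
  \<comment> \<open>Translating back by x moves all pieces into the fine cell at r, and the coarse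
    cells at the points -x cut up this cell completely.\<close>
  have sum_r: "(\<integral>\<^sup>+x. emeasure lborel (K.cell \<inter> {v. v - (r + x) \<in> A.cell}) \<partial>count_space K.lat)
      = emeasure lborel A.cell" (is "?lhs = _") for r
  proof -
    have "?lhs = (\<integral>\<^sup>+x. emeasure lborel ({v. v - r \<in> A.cell} \<inter> {v. v - (- x) \<in> K.cell}) \<partial>count_space K.lat)"
    proof (rule nn_integral_cong)
      fix x
      have "emeasure lborel ({v. v - r \<in> A.cell} \<inter> {v. v - (- x) \<in> K.cell})
         = emeasure lborel {w. w + x \<in> K.cell \<inter> {v. v - (r + x) \<in> A.cell}}"
        by (rule arg_cong[where f = "emeasure lborel"]) auto
      also have "\<dots> = emeasure lborel (K.cell \<inter> {v. v - (r + x) \<in> A.cell})"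
        by (rule emeasure_translate) measurable
      finally show "emeasure lborel (K.cell \<inter> {v. v - (r + x) \<in> A.cell}) =
          emeasure lborel ({v. v - r \<in> A.cell} \<inter> {v. v - (- x) \<in> K.cell})" by simp
    qed
    also have "\<dots> = (\<integral>\<^sup>+x. emeasure lborel ({v. v - r \<in> A.cell} \<inter> {v. v - x \<in> K.cell}) \<partial>count_space K.lat)"
    proof (rule nn_integral_bij_count_space)
      show "bij_betw uminus K.lat K.lat"
        by (rule bij_betwI[where g = uminus]) (use K.lat_diff[OF K.zero_in_lat] in auto)
    qed
    also have "\<dots> = emeasure lborel {v. v - r \<in> A.cell}"
      by (rule K.emeasure_tiling[symmetric]) measurable
    also have "\<dots> = emeasure lborel A.cell" using emeasure_translate[of A.cell "- r"] by simp
    finally show ?thesis .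
  qed
  let ?X = "\<lambda>r. \<Union>x\<in>K.lat. K.cell \<inter> {v. v - (r + x) \<in> A.cell}"
  have meas: "?X r \<in> sets borel" for r
  proof -
    have "K.cell \<inter> {v. v - (r + x) \<in> A.cell} \<in> sets borel" for x by measurable
    then show ?thesis by (intro sets.countable_UN' K.countable_lat) auto
  qed
  have "K.cell = (\<Union>r\<in>?G. ?X r)"
  proof (safe)
    fix v assume v: "v \<in> K.cell"
    let ?z = "v - A.red v"
    have z: "?z \<in> A.lat" by (rule A.red_diff)
    \<comment> \<open>The fine cell containing v sits at \<open>?z\<close>, which is split into a
      representative in the coarse cell and a vector of the coarse lattice.\<close>
    have "K.red ?z \<in> A.lat" using A.lat_diff[OF z, of "?z - K.red ?z"] K.red_diff sub by auto
    then have "K.red ?z \<in> ?G" using K.red_in_cell by auto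
    moreover have "v \<in> ?X (K.red ?z)"
      using v K.red_diff[of ?z] A.red_in_cell by (auto intro!: bexI[of _ "?z - K.red ?z"])
    ultimately show "v \<in> (\<Union>r\<in>?G. ?X r)" by blast
  qed
  then have "emeasure lborel K.cell = emeasure lborel (\<Union>r\<in>?G. ?X r)" by simp
  also have "\<dots> = (\<Sum>r\<in>?G. emeasure lborel (?X r))"
  proof (rule sum_emeasure[symmetric])
    show "disjoint_family_on ?X ?G"
    proof (rule disjoint_family_onI, rule ccontr)
      fix r s assume rs: "r \<in> ?G" "s \<in> ?G" "r \<noteq> s" "?X r \<inter> ?X s \<noteq> {}"
      then obtain v x y where *: "x \<in> K.lat" "y \<in> K.lat" "v - (r + x) \<in> A.cell" "v - (s + y) \<in> A.cell" by auto
      have "r + x \<in> A.lat" "s + y \<in> A.lat" using rs * sub by (auto intro!: A.lat_add)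
      then have "(s + y) - (r + x) \<in> A.lat" using A.lat_diff by blast
      moreover have "(v - (r + x)) - (v - (s + y)) = (s + y) - (r + x)" by simp
      ultimately have "(v - (r + x)) - (v - (s + y)) \<in> A.lat" by (simp only:)
      with *(3,4) have "v - (r + x) = v - (s + y)" by (rule A.cell_eqI)
      then have "r - s = y - x" by (simp add: algebra_simps)
      then have "r = s" using rs * K.lat_diff by (intro K.cell_eqI) auto
      with rs show False by simp
    qed
  qed (use meas finG in auto)
  also have "\<dots> = (\<Sum>r\<in>?G. emeasure lborel A.cell)"
  proof (rule sum.cong[OF refl])
    fix r
    have "emeasure lborel (?X r) = (\<integral>\<^sup>+x. emeasure lborel (K.cell \<inter> {v. v - (r + x) \<in> A.cell}) \<partial>count_space K.lat)"
    proof (rule emeasure_UN_countable[OF _ K.countable_lat])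
      show "disjoint_family_on (\<lambda>x. K.cell \<inter> {v. v - (r + x) \<in> A.cell}) K.lat"
      proof (rule disjoint_family_onI, rule ccontr)
        fix z w assume zw: "z \<in> K.lat" "w \<in> K.lat" "z \<noteq> w"
          "(K.cell \<inter> {x. x - (r + z) \<in> A.cell}) \<inter> (K.cell \<inter> {x. x - (r + w) \<in> A.cell}) \<noteq> {}"
        then obtain x where "x - (r + z) \<in> A.cell" "x - (r + w) \<in> A.cell" by auto
        then have "x - (r + z) = x - (r + w)"
          by (rule A.cell_eqI) (use K.lat_diff[OF zw(2,1)] sub in auto)
        with zw show False by simp
      qed
    qed measurable
    then show "emeasure lborel (?X r) = emeasure lborel A.cell" using sum_r by simp
  qed
  also have "\<dots> = of_nat (card R) * emeasure lborel A.cell" by (simp add: card_A_lat_cell)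
  finally have "ennreal K.vol = ennreal (real (card R) * A.vol)"
    by (simp add: K.emeasure_cell A.emeasure_cell ennreal_mult ennreal_of_nat_eq_real_of_nat A.vol_pos less_imp_le)
  then show ?thesis using K.vol_pos A.vol_pos by simp
qed

end

text \<open>Each factor is translation invariant, and the product measure is determined by
  boxes.\<close>

lemma emeasure_PiM_translate:
  fixes a :: "'i \<Rightarrow> real"
  assumes "finite I" and A: "A \<in> sets (PiM I (\<lambda>_. lborel :: real measure))"
  shows "emeasure (PiM I (\<lambda>_. lborel)) {t \<in> space (PiM I (\<lambda>_. lborel :: real measure)). (\<lambda>i\<in>I. t i + a i) \<in> A}
    = emeasure (PiM I (\<lambda>_. lborel)) A"
proof -
  let ?P = "PiM I (\<lambda>_. lborel :: real measure)"
  interpret product_sigma_finite "\<lambda>_ :: 'i. lborel :: real measure" ..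
  have m: "(\<lambda>t. \<lambda>i\<in>I. t i + a i) \<in> measurable ?P ?P"
    by (rule measurable_restrict) measurable
  have "distr ?P ?P (\<lambda>t. \<lambda>i\<in>I. t i + a i) = ?P"
  proof (rule PiM_eqI[OF assms(1)])
    fix S :: "'i \<Rightarrow> real set" assume S: "\<And>i. i \<in> I \<Longrightarrow> S i \<in> sets lborel"
    have "emeasure (distr ?P ?P (\<lambda>t. \<lambda>i\<in>I. t i + a i)) (PiE I S) =
       emeasure ?P ((\<lambda>t. \<lambda>i\<in>I. t i + a i) -` PiE I S \<inter> space ?P)"
      using S by (intro emeasure_distr m sets_PiM_I_finite assms(1)) auto
    also have "(\<lambda>t. \<lambda>i\<in>I. t i + a i) -` PiE I S \<inter> space ?P = PiE I (\<lambda>i. {x. x + a i \<in> S i})"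
      by (auto simp: space_PiM PiE_iff)
    also have "emeasure ?P \<dots> = (\<Prod>i\<in>I. emeasure lborel {x. x + a i \<in> S i})"
    proof (rule emeasure_PiM[OF assms(1)])
      fix i assume "i \<in> I"
      then have [measurable]: "S i \<in> sets borel" using S by auto
      show "{x. x + a i \<in> S i} \<in> sets lborel" by measurable
    qed
    also have "\<dots> = (\<Prod>i\<in>I. emeasure lborel (S i))"
      using S by (intro prod.cong emeasure_translate) auto
    finally show "emeasure (distr ?P ?P (\<lambda>t. \<lambda>i\<in>I. t i + a i)) (PiE I S) = (\<Prod>i\<in>I. emeasure lborel (S i))" .
  qed simp
  then have "emeasure ?P A = emeasure (distr ?P ?P (\<lambda>t. \<lambda>i\<in>I. t i + a i)) A" by simp
  also have "\<dots> = emeasure ?P ((\<lambda>t. \<lambda>i\<in>I. t i + a i) -` A \<inter> space ?P)"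
    by (rule emeasure_distr[OF m A])
  finally show ?thesis by (simp add: vimage_def Int_def conj_commute)
qed

context dual_bases
begin

definition comb :: "('i \<Rightarrow> real) \<Rightarrow> 'a" where "comb t = (\<Sum>i\<in>I. t i *\<^sub>R \<alpha> i)"

abbreviation "PI \<equiv> PiM I (\<lambda>_. lborel :: real measure)"

lemma comb_measurable [measurable]: "comb \<in> borel_measurable PI"
  unfolding comb_def by measurable

lemma emeasure_comb_cell: "emeasure PI {t \<in> space PI. comb t \<in> cell} = 1"
proof -
  interpret product_sigma_finite "\<lambda>_ :: 'i. lborel :: real measure" ..
  have "{t \<in> space PI. comb t \<in> cell} = PiE I (\<lambda>_. {0..<1})"
    by (auto simp: space_PiM PiE_iff cell_def comb_def inner_comb extensional_def)
  then show ?thesis using finI by (simp add: emeasure_PiM)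
qed

text \<open>
  Both sides are translation invariant. Integrating the indicator of \<open>A \<times> N\<close> and moving
  translations across by Fubini's theorem shows that such measures are proportional.
\<close>

lemma lborel_eq_distr_comb: "lborel = density (distr PI borel comb) (\<lambda>_. ennreal vol)"
proof (rule measure_eqI)
  fix A :: "'a set" assume "A \<in> sets lborel"
  then have A[measurable]: "A \<in> sets borel" by simp
  interpret P: sigma_finite_measure PI
    by (intro product_sigma_finite.sigma_finite) (auto intro!: product_sigma_finite.intro finI lborel.sigma_finite_measure_axioms)
  interpret PS: pair_sigma_finite PI "lborel :: 'a measure" ..
  let ?\<nu> = "\<lambda>A. emeasure PI {t \<in> space PI. comb t \<in> A}"
  \<comment> \<open>The reflected cell: \<open>z - comb t \<in> N\<close> says
    \<open>comb t - z \<in> cell\<close>, and by invariance the set of such t has measure 1 for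
    every z.\<close>
  define N :: "'a set" where "N = {y. - y \<in> cell}"
  have [measurable]: "N \<in> sets borel" unfolding N_def by measurable
  have shift: "?\<nu> {x. x + y \<in> A} = ?\<nu> A" if [measurable]: "A \<in> sets borel" for y A
  proof -
    have "?\<nu> {x. x + y \<in> A} = emeasure PI {t \<in> space PI. (\<lambda>i\<in>I. t i + u i \<bullet> y) \<in> {t \<in> space PI. comb t \<in> A}}"
    proof (rule arg_cong[where f = "emeasure PI"], intro Collect_cong conj_cong refl)
      fix t assume "t \<in> space PI"
      have "comb (\<lambda>i\<in>I. t i + u i \<bullet> y) = comb t + y"
        using expand[of y] by (simp add: comb_def scaleR_add_left sum.distrib)
      then show "comb t \<in> {x. x + y \<in> A} \<longleftrightarrow> (\<lambda>i\<in>I. t i + u i \<bullet> y) \<in> {t \<in> space PI. comb t \<in> A}"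
        by (auto simp: space_PiM)
    qed
    also have "\<dots> = ?\<nu> A"
      by (rule emeasure_PiM_translate[OF finI]) measurable
    finally show ?thesis .
  qed
  have "?\<nu> A * emeasure lborel N = (\<integral>\<^sup>+y. indicator N y * ?\<nu> {x. x + y \<in> A} \<partial>lborel)"
    by (simp add: shift[simplified] nn_integral_multc mult.commute)
  also have "\<dots> = (\<integral>\<^sup>+y. (\<integral>\<^sup>+t. indicator N y * indicator A (comb t + y) \<partial>PI) \<partial>lborel)"
  proof (rule nn_integral_cong)
    fix y
    have "?\<nu> {x. x + y \<in> A} = (\<integral>\<^sup>+t. indicator {t \<in> space PI. comb t \<in> {x. x + y \<in> A}} t \<partial>PI)"
      by (rule nn_integral_indicator[symmetric]) measurable
    also have "\<dots> = (\<integral>\<^sup>+t. indicator A (comb t + y) \<partial>PI)"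
      by (rule nn_integral_cong) (auto split: split_indicator)
    finally show "indicator N y * ?\<nu> {x. x + y \<in> A} = (\<integral>\<^sup>+t. indicator N y * indicator A (comb t + y) \<partial>PI)"
      by (simp add: nn_integral_cmult)
  qed
  also have "\<dots> = (\<integral>\<^sup>+t. (\<integral>\<^sup>+y. indicator N y * indicator A (comb t + y) \<partial>lborel) \<partial>PI)"
    by (rule PS.Fubini') measurable
  also have "\<dots> = (\<integral>\<^sup>+t. (\<integral>\<^sup>+z. indicator N (z - comb t) * indicator A z \<partial>lborel) \<partial>PI)"
  proof (rule nn_integral_cong)
    fix t
    have "(\<integral>\<^sup>+z. indicator N (z - comb t) * indicator A z \<partial>lborel) =
      (\<integral>\<^sup>+z. indicator N (z - comb t) * indicator A z \<partial>distr lborel borel ((+) (comb t)))"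
      by (simp add: lborel_distr_plus)
    also have "\<dots> = (\<integral>\<^sup>+y. indicator N (comb t + y - comb t) * indicator A (comb t + y) \<partial>lborel)"
      by (rule nn_integral_distr) measurable
    finally show "(\<integral>\<^sup>+y. indicator N y * indicator A (comb t + y) \<partial>lborel) =
      (\<integral>\<^sup>+z. indicator N (z - comb t) * indicator A z \<partial>lborel)" by simp
  qed
  also have "\<dots> = (\<integral>\<^sup>+z. (\<integral>\<^sup>+t. indicator N (z - comb t) * indicator A z \<partial>PI) \<partial>lborel)"
    by (rule PS.Fubini'[symmetric]) measurable
  also have "\<dots> = (\<integral>\<^sup>+z. indicator A z \<partial>lborel)"
  proof (rule nn_integral_cong)
    fix z
    have "(\<integral>\<^sup>+t. indicator N (z - comb t) \<partial>PI) = (\<integral>\<^sup>+t. indicator {t \<in> space PI. comb t \<in> {x. x + (- z) \<in> cell}} t \<partial>PI)"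
      by (rule nn_integral_cong) (auto simp: N_def split: split_indicator)
    also have "\<dots> = ?\<nu> {x. x + (- z) \<in> cell}"
      by (rule nn_integral_indicator) measurable
    also have "\<dots> = 1" by (simp only: shift[OF cell_measurable] emeasure_comb_cell)
    finally show "(\<integral>\<^sup>+t. indicator N (z - comb t) * indicator A z \<partial>PI) = indicator A z"
      by (simp add: nn_integral_multc)
  qed
  also have "\<dots> = emeasure lborel A" by simp
  finally have eq: "?\<nu> A * emeasure lborel N = emeasure lborel A" .
  \<comment> \<open>Reflection invariance gives \<open>N\<close> the volume of the cell, so
    \<open>vol\<close> is the factor of proportionality.\<close>
  have "emeasure lborel cell = emeasure (distr lborel borel (\<lambda>x. 0 + (- 1) *\<^sub>R x)) (cell :: 'a set)"
    by (subst (1) lborel_affine[of "- 1" 0]) (simp_all add: density_1)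
  also have "\<dots> = emeasure lborel N"
    by (subst emeasure_distr) (auto simp: N_def intro!: arg_cong[where f = "emeasure lborel"])
  finally have "emeasure lborel N = emeasure lborel cell" ..
  then have N: "emeasure lborel N = ennreal vol" by (simp add: emeasure_cell)
  have "emeasure (density (distr PI borel comb) (\<lambda>_. ennreal vol)) A = ennreal vol * emeasure (distr PI borel comb) A"
    by (rule emeasure_density_const) simp
  also have "emeasure (distr PI borel comb) A = ?\<nu> A"
    by (subst emeasure_distr) (auto intro!: arg_cong[where f = "emeasure PI"])
  finally show "emeasure lborel A = emeasure (density (distr PI borel comb) (\<lambda>_. ennreal vol)) A"
    using eq N by (simp add: mult.commute)
qed simp

lemma has_bochner_integral_comb:
  fixes f :: "'a \<Rightarrow> 'b::{banach,second_countable_topology}"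
  assumes [measurable]: "f \<in> borel_measurable borel"
    and "has_bochner_integral PI (\<lambda>t. f (comb t)) x"
  shows "has_bochner_integral lborel f (vol *\<^sub>R x)"
proof -
  have "has_bochner_integral (distr PI borel comb) f x"
    using assms(2) by (intro has_bochner_integral_distr) auto
  then have "has_bochner_integral (distr PI borel comb) (\<lambda>y. vol *\<^sub>R f y) (vol *\<^sub>R x)" by auto
  then have "has_bochner_integral (density (distr PI borel comb) (\<lambda>_. ennreal vol)) f (vol *\<^sub>R x)"
    using vol_pos by (intro has_bochner_integral_density) auto
  then show ?thesis by (simp flip: lborel_eq_distr_comb)
qed

end

text \<open>On \<open>{0..n}\<close> the fundamental theorem of calculus applies; the passage to the
  half-line is dominated by the real exponential with rate \<open>Re a\<close>.\<close>

lemma has_bochner_integral_exp_neg: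
  assumes a: "Re a < 0"
  shows "has_bochner_integral lborel (\<lambda>t. indicator {0..} t *\<^sub>R exp (of_real t * a)) (- 1 / a)"
proof -
  have a0: "a \<noteq> 0" using a by auto
  let ?f = "\<lambda>t::real. indicator {0..} t *\<^sub>R exp (of_real t * a)"
  let ?w = "\<lambda>t::real. indicator {0..} t *\<^sub>R exp (t * Re a)"
  have "((\<lambda>x::real. exp (- (- Re a) * x)) has_integral exp (- (- Re a) * 0) / (- Re a)) {0..}"
    by (rule has_integral_exp_minus_to_infinity) (use a in auto)
  then have "(\<lambda>x::real. exp (x * Re a)) absolutely_integrable_on {0..}"
    by (intro nonnegative_absolutely_integrable_1) (auto simp: mult.commute has_integral_integrable_integral)
  then have "integrable lebesgue ?w" by (simp add: set_integrable_def)
  then have w: "integrable lborel ?w" by (subst (asm) integrable_completion) auto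
  let ?s = "\<lambda>n t. indicator {0..real n} t *\<^sub>R exp (of_real t * a)"
  have s: "has_bochner_integral lborel (?s n) (exp (of_real (real n) * a) / a - exp (of_real 0 * a) / a)" for n
  proof (rule has_bochner_integral_FTC_Icc)
    show "((\<lambda>x. exp (of_real x * a) / a) has_vector_derivative exp (of_real x * a)) (at x within {0..real n})" for x :: real
      by (rule has_vector_derivative_real_field) (use a0 in \<open>auto intro!: derivative_eq_intros\<close>)
  qed (auto intro!: continuous_intros)
  have dom: "integrable lborel ?f" "(\<lambda>n. integral\<^sup>L lborel (?s n)) \<longlonglongrightarrow> integral\<^sup>L lborel ?f"
  proof -
    have "AE x in lborel. (\<lambda>n. ?s n x) \<longlonglongrightarrow> ?f x"
    proof (rule AE_I2)
      fix x :: real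
      have "eventually (\<lambda>n. ?s n x = ?f x) sequentially"
        using eventually_ge_at_top[of "nat \<lceil>x\<rceil>"]
      proof eventually_elim
        case (elim n)
        then have "x \<le> real n" by linarith
        then show ?case by (auto split: split_indicator)
      qed
      then show "(\<lambda>n. ?s n x) \<longlonglongrightarrow> ?f x" by (rule tendsto_eventually)
    qed
    moreover have "AE x in lborel. norm (?s n x) \<le> ?w x" for n
      by (auto split: split_indicator simp: norm_exp_eq_Re)
    moreover have "?f \<in> borel_measurable lborel" "\<And>n. ?s n \<in> borel_measurable lborel" by measurable
    ultimately show "integrable lborel ?f" "(\<lambda>n. integral\<^sup>L lborel (?s n)) \<longlonglongrightarrow> integral\<^sup>L lborel ?f"
      using integrable_dominated_convergence[of ?f lborel ?s ?w] integral_dominated_convergence[of ?f lborel ?s ?w] w by blast+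
  qed
  have "(\<lambda>n. exp (of_real (real n) * a)) \<longlonglongrightarrow> 0"
  proof -
    have "(\<lambda>n. exp a ^ n) \<longlonglongrightarrow> 0" by (rule LIMSEQ_power_zero) (use a in \<open>auto simp: norm_exp_eq_Re\<close>)
    then show ?thesis by (simp add: exp_of_nat_mult)
  qed
  then have "(\<lambda>n. exp (of_real (real n) * a) / a - exp (of_real 0 * a) / a) \<longlonglongrightarrow> 0 / a - exp (of_real 0 * a) / a"
    by (intro tendsto_intros) (use a0 in auto)
  moreover have "integral\<^sup>L lborel (?s n) = exp (of_real (real n) * a) / a - exp (of_real 0 * a) / a" for n
    using s by (rule has_bochner_integral_integral_eq)
  ultimately have "integral\<^sup>L lborel ?f = - 1 / a" using dom(2) LIMSEQ_unique by fastforce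
  then show ?thesis using dom(1) by (simp add: has_bochner_integral_iff)
qed

lemma has_bochner_integral_exp_pos:
  assumes a: "Re a > 0"
  shows "has_bochner_integral lborel (\<lambda>t. indicator {..<0} t *\<^sub>R exp (of_real t * a)) (1 / a)"
proof -
  have "has_bochner_integral lborel (\<lambda>t. indicator {0..} t *\<^sub>R exp (of_real t * (- a))) (1 / a)"
    using has_bochner_integral_exp_neg[of "- a"] a by simp
  then have "has_bochner_integral lborel (\<lambda>t. indicator {0..} (0 + (-1) * t) *\<^sub>R exp (of_real (0 + (-1) * t) * (- a))) (1 / a /\<^sub>R \<bar>-1\<bar>)"
    by (subst (asm) lborel_has_bochner_integral_real_affine_iff[of "-1" _ _ 0]) auto
  then have "has_bochner_integral lborel (\<lambda>t. indicator {..0} t *\<^sub>R exp (of_real t * a)) (1 / a)"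
    by (rule has_bochner_integral_cong[THEN iffD1, rotated -1]) (auto split: split_indicator)
  \<comment> \<open>Reflection produces the closed half-line; the open one differs from it by a null
    set.\<close>
  moreover have "AE t in lborel. t \<noteq> (0::real)" by (rule AE_lborel_singleton)
  then have "AE t in lborel. indicator {..0} t *\<^sub>R exp (of_real t * a) = indicator {..<0} t *\<^sub>R exp (of_real t * a)"
    by eventually_elim (auto split: split_indicator)
  ultimately show ?thesis by (subst has_bochner_integral_cong_AE[symmetric]) auto
qed

context dual_bases
begin

text \<open>
  The cone spanned by the \<open>\<alpha> i\<close>, with those generators reversed along which \<open>exp \<xi>\<close> grows.
\<close>

definition polar_cone :: "('a \<Rightarrow> complex) \<Rightarrow> 'a set" where
  "polar_cone \<xi> = {x. \<forall>i\<in>I. if Re (\<xi> (\<alpha> i)) < 0 then 0 \<le> u i \<bullet> x else u i \<bullet> x < 0}"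

text \<open>In coordinates along the \<open>\<alpha> i\<close> the integral is a product of
  half-line integrals, -1/a for a decaying generator and 1/a for a reversed one; \<open>vol\<close>
  is the Jacobian.\<close>

lemma has_bochner_integral_polar_cone:
  assumes lin: "linear \<xi>" and ne: "\<And>i. i \<in> I \<Longrightarrow> Re (\<xi> (\<alpha> i)) \<noteq> 0"
  shows "has_bochner_integral lborel (\<lambda>x. indicator (polar_cone \<xi>) x *\<^sub>R exp (\<xi> x))
    (vol *\<^sub>R (\<Prod>i\<in>I. (if Re (\<xi> (\<alpha> i)) < 0 then - 1 else 1) / \<xi> (\<alpha> i)))"
proof (rule has_bochner_integral_comb)
  have [measurable]: "\<xi> \<in> borel_measurable borel"
    using lin by (intro borel_measurable_continuous_onI linear_continuous_on) (simp add: linear_conv_bounded_linear)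
  have [measurable]: "polar_cone \<xi> \<in> sets borel"
  proof -
    have "polar_cone \<xi> = {x \<in> space borel. \<forall>i\<in>I. if Re (\<xi> (\<alpha> i)) < 0 then 0 \<le> u i \<bullet> x else u i \<bullet> x < 0}"
      by (auto simp: polar_cone_def)
    also have "\<dots> \<in> sets borel" using finI by measurable
    finally show ?thesis .
  qed
  show "(\<lambda>x. indicator (polar_cone \<xi>) x *\<^sub>R exp (\<xi> x)) \<in> borel_measurable borel" by measurable
  interpret product_sigma_finite "\<lambda>_ :: 'i. lborel :: real measure" ..
  let ?g = "\<lambda>i t. indicator (if Re (\<xi> (\<alpha> i)) < 0 then {0..} else {..<0}) t *\<^sub>R exp (of_real t * \<xi> (\<alpha> i))"
  have g: "has_bochner_integral lborel (?g i) ((if Re (\<xi> (\<alpha> i)) < 0 then - 1 else 1) / \<xi> (\<alpha> i))" if "i \<in> I" for i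
    using ne[OF that] has_bochner_integral_exp_neg[of "\<xi> (\<alpha> i)"] has_bochner_integral_exp_pos[of "\<xi> (\<alpha> i)"]
    by (cases "Re (\<xi> (\<alpha> i)) < 0") auto
  have "has_bochner_integral PI (\<lambda>t. \<Prod>i\<in>I. ?g i (t i)) (\<Prod>i\<in>I. (if Re (\<xi> (\<alpha> i)) < 0 then - 1 else 1) / \<xi> (\<alpha> i))"
    using g product_integrable_prod[OF finI, of ?g] product_integral_prod[OF finI, of ?g]
    by (simp add: has_bochner_integral_iff)
  moreover have "indicator (polar_cone \<xi>) (comb t) *\<^sub>R exp (\<xi> (comb t)) = (\<Prod>i\<in>I. ?g i (t i))" for t
  proof -
    have 1: "indicator (polar_cone \<xi>) (comb t) = (\<Prod>i\<in>I. indicator (if Re (\<xi> (\<alpha> i)) < 0 then {0..} else {..<0}) (t i) :: real)"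
    proof -
      have "(\<Prod>i\<in>I. indicator (if Re (\<xi> (\<alpha> i)) < 0 then {0..} else {..<0}) (t i) :: real) = 
        (if \<forall>i\<in>I. t i \<in> (if Re (\<xi> (\<alpha> i)) < 0 then {0..} else {..<0}) then 1 else 0)"
        using finI by (induction I rule: finite_induct) (auto split: split_indicator)
      moreover have "comb t \<in> polar_cone \<xi> \<longleftrightarrow> (\<forall>i\<in>I. t i \<in> (if Re (\<xi> (\<alpha> i)) < 0 then {0..} else {..<0}))"
        by (auto simp: polar_cone_def comb_def inner_comb)
      ultimately show ?thesis by (auto split: split_indicator)
    qed
    have "\<xi> (comb t) = (\<Sum>i\<in>I. of_real (t i) * \<xi> (\<alpha> i))"
      by (simp add: comb_def linear_sum[OF lin] linear_cmul[OF lin] scaleR_conv_of_real)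
    then show ?thesis by (simp add: 1 exp_sum finI prod.distrib scaleR_conv_of_real)
  qed
  ultimately show "has_bochner_integral PI (\<lambda>t. indicator (polar_cone \<xi>) (comb t) *\<^sub>R exp (\<xi> (comb t)))
     (\<Prod>i\<in>I. (if Re (\<xi> (\<alpha> i)) < 0 then - 1 else 1) / \<xi> (\<alpha> i))" by simp
qed

end

section \<open>Polar decomposition of simple polytopes\<close>

locale simple_rational_polytope =
  fixes L \<Delta> :: "'a::euclidean_space set"
    and d :: nat
    and facet :: "nat \<Rightarrow> 'a set"
    and u :: "nat \<Rightarrow> 'a"
    and c :: "nat \<Rightarrow> real"
  assumes lattice: "is_lattice L"
    and polytope: "polytope \<Delta>" and interior: "interior \<Delta> \<noteq> {}"
    and simple: "simple_polytope \<Delta>"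
    and facet: "bij_betw facet {1..d} {F. F facet_of \<Delta>}"
    and normal: "\<And>i. i \<in> {1..d} \<Longrightarrow> primitive_covector L (u i) \<and> inward_normal \<Delta> (facet i) (u i)"
    and halfsp: "\<Delta> = halfspaces d u c"
    and c_int: "\<And>i. i \<in> {1..d} \<Longrightarrow> c i \<in> \<int>"
begin

definition sl :: "nat \<Rightarrow> 'a \<Rightarrow> real" where "sl i x = u i \<bullet> x + c i"

definition idx :: "'a \<Rightarrow> nat set" where "idx v = {i \<in> {1..d}. sl i v = 0}"

definition verts :: "'a set" where "verts = {v. v extreme_point_of \<Delta>}"

definition face_cut :: "nat set \<Rightarrow> 'a set" where "face_cut A = {x \<in> \<Delta>. \<forall>i\<in>A. sl i x = 0}"

lemma mem_\<Delta>: "x \<in> \<Delta> \<longleftrightarrow> (\<forall>i\<in>{1..d}. 0 \<le> sl i x)"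
  by (simp add: halfsp halfspaces_def sl_def)

lemma sl_add: "sl i (x + y) = sl i x + u i \<bullet> y"
  by (simp add: sl_def inner_add_right)

lemma sl_diff: "sl i x - sl i y = u i \<bullet> (x - y)"
  by (simp add: sl_def inner_diff_right)

lemma convex_\<Delta>: "convex \<Delta>" and compact_\<Delta>: "compact \<Delta>"
  using polytope polytope_imp_convex polytope_imp_compact by auto

lemma finite_idx: "finite (idx v)" by (simp add: idx_def)

text \<open>Active constraints do not decrease along t, and the finitely many inactive ones stay
  positive by continuity. The moves along edges and inside faces below come from this.\<close>

lemma local_step:
  assumes x: "x \<in> \<Delta>" and t: "\<And>i. i \<in> idx x \<Longrightarrow> 0 \<le> u i \<bullet> t"
  shows "eventually (\<lambda>r. x + r *\<^sub>R t \<in> \<Delta> \<and> (\<forall>i\<in>{1..d} - idx x. 0 < sl i (x + r *\<^sub>R t))) (at_right 0)"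
proof -
  have "eventually (\<lambda>r. 0 \<le> sl i (x + r *\<^sub>R t) \<and> (i \<notin> idx x \<longrightarrow> 0 < sl i (x + r *\<^sub>R t))) (at_right 0)"
    if i: "i \<in> {1..d}" for i
  proof (cases "i \<in> idx x")
    case True
    have "eventually (\<lambda>r. 0 < (r::real)) (at_right 0)" by (rule eventually_at_right_less)
    then show ?thesis
      by eventually_elim (use True t in \<open>auto simp: sl_add idx_def\<close>)
  next
    case False
    then have "0 < sl i x" using x i by (auto simp: idx_def mem_\<Delta> less_le)
    moreover have "((\<lambda>r. sl i (x + r *\<^sub>R t)) \<longlongrightarrow> sl i (x + 0 *\<^sub>R t)) (at_right 0)"
      unfolding sl_def by (intro tendsto_intros)
    ultimately have "eventually (\<lambda>r. 0 < sl i (x + r *\<^sub>R t)) (at_right 0)"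
      by (auto dest: order_tendstoD)
    then show ?thesis by eventually_elim auto
  qed
  then have "eventually (\<lambda>r. \<forall>i\<in>{1..d}. 0 \<le> sl i (x + r *\<^sub>R t) \<and> (i \<notin> idx x \<longrightarrow> 0 < sl i (x + r *\<^sub>R t))) (at_right 0)"
    by (intro eventually_ball_finite) auto
  then show ?thesis by eventually_elim (auto simp: mem_\<Delta>)
qed

lemma local_stepE:
  assumes x: "x \<in> \<Delta>" and t: "\<And>i. i \<in> idx x \<Longrightarrow> 0 \<le> u i \<bullet> t"
  obtains r where "0 < r" "r < 1" "x + r *\<^sub>R t \<in> \<Delta>" "\<And>i. i \<in> {1..d} - idx x \<Longrightarrow> 0 < sl i (x + r *\<^sub>R t)"
proof -
  have "eventually (\<lambda>r. (x + r *\<^sub>R t \<in> \<Delta> \<and> (\<forall>i\<in>{1..d} - idx x. 0 < sl i (x + r *\<^sub>R t))) \<and> 0 < r \<and> r < 1) (at_right (0::real))"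
    using local_step[OF assms] eventually_at_right_less[of 0] eventually_at_right_real[of 0 1]
    by (intro eventually_conj) (auto elim: eventually_mono)
  then obtain r where "(x + r *\<^sub>R t \<in> \<Delta> \<and> (\<forall>i\<in>{1..d} - idx x. 0 < sl i (x + r *\<^sub>R t))) \<and> 0 < r \<and> r < 1"
    using eventually_happens'[OF trivial_limit_at_right_real] by blast
  then show thesis using that by auto
qed

lemma face_cut_face_of: "A \<subseteq> {1..d} \<Longrightarrow> face_cut A face_of \<Delta>"
proof -
  assume A: "A \<subseteq> {1..d}"
  show ?thesis
    unfolding face_of_def
  proof (intro conjI ballI impI)
    show "face_cut A \<subseteq> \<Delta>" by (auto simp: face_cut_def)
    have "face_cut A = \<Delta> \<inter> (\<Inter>i\<in>A. {x. u i \<bullet> x = - c i})"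
      by (auto simp: face_cut_def sl_def)
    then show "convex (face_cut A)"
      by (simp add: convex_Int convex_\<Delta> convex_INT convex_hyperplane)
  next
    fix a b x assume *: "a \<in> \<Delta>" "b \<in> \<Delta>" "x \<in> face_cut A" "x \<in> open_segment a b"
    then obtain r where r: "0 < r" "r < 1" "x = (1 - r) *\<^sub>R a + r *\<^sub>R b" by (auto simp: in_segment)
    have "sl i a = 0 \<and> sl i b = 0" if i: "i \<in> A" for i
    proof -
      have "(1 - r) * sl i a + r * sl i b = sl i x"
        by (simp add: sl_def r(3) algebra_simps)
      also have "\<dots> = 0" using * i by (auto simp: face_cut_def)
      finally have "(1 - r) * sl i a + r * sl i b = 0" .
      moreover have "0 \<le> (1 - r) * sl i a" "0 \<le> r * sl i b"
        using * i A r by (auto simp: mem_\<Delta>)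
      ultimately have "(1 - r) * sl i a = 0" "r * sl i b = 0" by linarith+
      then show ?thesis using r by auto
    qed
    then show "a \<in> face_cut A" "b \<in> face_cut A" using * by (auto simp: face_cut_def)
  qed
qed

text \<open>From a point of the cut set, the segment to \<open>x0\<close> can be prolonged a little
  beyond \<open>x0\<close> inside \<Delta>, because the constraints active at \<open>x0\<close>
  vanish at both points; the definition of a face then puts the point into F.\<close>

lemma face_rel_interior:
  assumes F: "F face_of \<Delta>" and x0: "x0 \<in> rel_interior F"
  shows "F = face_cut (idx x0)"
proof
  have x0F: "x0 \<in> F" using x0 rel_interior_subset by auto
  have FD: "F \<subseteq> \<Delta>" using F by (rule face_of_imp_subset)
  show "F \<subseteq> face_cut (idx x0)"
  proof (rule subset_of_face_of[OF face_cut_face_of FD])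
    have "x0 \<in> face_cut (idx x0)" using x0F FD by (auto simp: face_cut_def idx_def)
    then show "face_cut (idx x0) \<inter> rel_interior F \<noteq> {}" using x0 by auto
  qed (auto simp: idx_def)
  show "face_cut (idx x0) \<subseteq> F"
  proof
    fix x assume x: "x \<in> face_cut (idx x0)"
    show "x \<in> F"
    proof (cases "x = x0")
      case False
      obtain r where r: "0 < r" "x0 + r *\<^sub>R (x0 - x) \<in> \<Delta>"
        by (rule local_stepE[of x0 "x0 - x"])
          (use x x0F FD in \<open>auto simp: face_cut_def idx_def inner_diff_right sl_def\<close>)
      have "x0 \<in> open_segment x (x0 + r *\<^sub>R (x0 - x))"
        unfolding in_segment
      \<comment> \<open>\<open>x0\<close> divides the prolonged segment in the ratio 1 : r.\<close>
      proof (intro conjI exI[of _ "1 / (1 + r)"])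
        let ?k = "1 / (1 + r)"
        have "(x0 + r *\<^sub>R (x0 - x)) - x = (1 + r) *\<^sub>R (x0 - x)" by (simp add: algebra_simps)
        moreover have "(1 + r) *\<^sub>R (x0 - x) \<noteq> 0" using False r by simp
        ultimately show "x \<noteq> x0 + r *\<^sub>R (x0 - x)" by auto
        have "(1 - ?k) *\<^sub>R x + ?k *\<^sub>R (x0 + r *\<^sub>R (x0 - x)) = ((1 - ?k) - ?k * r) *\<^sub>R x + (?k * (1 + r)) *\<^sub>R x0"
          by (simp only: scaleR_add_right scaleR_diff_right scaleR_add_left scaleR_diff_left scaleR_scaleR distrib_left mult_1_right) simp
        moreover have "(1 - ?k) - ?k * r = 0" "?k * (1 + r) = 1" using r by (auto simp: field_simps)
        ultimately show "x0 = (1 - ?k) *\<^sub>R x + ?k *\<^sub>R (x0 + r *\<^sub>R (x0 - x))" by simp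
      qed (use r in auto)
      moreover have "x \<in> \<Delta>" using x by (simp add: face_cut_def)
      ultimately show ?thesis using F x0F r unfolding face_of_def by blast
    qed (use x0F in auto)
  qed
qed

lemma facet_bij: "i \<in> {1..d} \<Longrightarrow> facet i facet_of \<Delta>"
  using facet by (auto simp: bij_betw_def)

lemma facet_inj: "i \<in> {1..d} \<Longrightarrow> j \<in> {1..d} \<Longrightarrow> facet i = facet j \<Longrightarrow> i = j"
  using facet unfolding bij_betw_def by (blast dest: inj_onD)

text \<open>There is no dimension left between a facet and \<Delta>.\<close>

lemma facet_maximal:
  assumes F: "F facet_of \<Delta>" and G: "G face_of \<Delta>" "G \<noteq> \<Delta>" "F \<subseteq> G"
  shows "F = G"
proof (rule ccontr)
  assume "F \<noteq> G"
  have "F face_of G" using F G face_of_subset[of F \<Delta> G] face_of_imp_subset by (auto simp: facet_of_def)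
  then have "aff_dim F < aff_dim G"
    using face_of_aff_dim_lt \<open>F \<noteq> G\<close> G(1) face_of_imp_convex by blast
  moreover have "aff_dim G < aff_dim \<Delta>" using face_of_aff_dim_lt[OF convex_\<Delta> G(1,2)] .
  ultimately show False using F by (auto simp: facet_of_def)
qed

text \<open>The minimizers of \<open>u i\<close> form a face that contains the facet, and this face
  is proper because \<Delta> has interior points; a facet is maximal among the proper faces.\<close>

lemma facet_argmin:
  assumes i: "i \<in> {1..d}"
  shows "facet i = {x \<in> \<Delta>. \<forall>y\<in>\<Delta>. u i \<bullet> x \<le> u i \<bullet> y}"
proof (rule facet_maximal[OF facet_bij[OF i]])
  let ?G = "{x \<in> \<Delta>. \<forall>y\<in>\<Delta>. u i \<bullet> x \<le> u i \<bullet> y}"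
  have nz: "u i \<noteq> 0" using normal[OF i] by (simp add: inward_normal_def)
  show sub: "facet i \<subseteq> ?G"
    using normal[OF i] facet_bij[OF i] face_of_imp_subset by (auto simp: facet_of_def inward_normal_def)
  obtain x where x: "x \<in> facet i" using facet_bij[OF i] by (auto simp: facet_of_def)
  have xG: "x \<in> \<Delta>" "\<forall>y\<in>\<Delta>. u i \<bullet> x \<le> u i \<bullet> y" using x sub by auto
  have "(\<forall>y\<in>\<Delta>. u i \<bullet> w \<le> u i \<bullet> y) \<longleftrightarrow> u i \<bullet> w = u i \<bullet> x" if "w \<in> \<Delta>" for w
    using xG that by (metis order_antisym)
  then have "?G = \<Delta> \<inter> {y. u i \<bullet> y = u i \<bullet> x}" by auto
  also have "\<dots> face_of \<Delta>"
    using x sub by (intro face_of_Int_supporting_hyperplane_ge[OF convex_\<Delta>]) auto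
  finally show "?G face_of \<Delta>" .
  show "?G \<noteq> \<Delta>"
  proof
    assume eq: "?G = \<Delta>"
    obtain z where "z \<in> interior \<Delta>" using interior by auto
    then obtain e where e: "e > 0" "cball z e \<subseteq> \<Delta>" by (auto simp: mem_interior_cball)
    have z: "z \<in> ?G" using e eq by auto
    define w where "w = z - (e / norm (u i)) *\<^sub>R u i"
    have "w \<in> cball z e" using nz e by (simp add: w_def dist_norm)
    then have "w \<in> \<Delta>" using e by auto
    then have "u i \<bullet> z \<le> u i \<bullet> w" using z by auto
    moreover have "u i \<bullet> w < u i \<bullet> z" using nz e by (simp add: w_def inner_diff_right)
    ultimately show False by simp
  qed
qed

text \<open>Ties the offset \<open>c i\<close> to the facet with number i, which the hypotheses
  relate only through the normal \<open>u i\<close> and the set \<Delta>. A relative interior point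
  of the facet lies on some hyperplane j of the description; by maximality the facets i and j agree,
  and the numbering is injective.\<close>

lemma facet_eq:
  assumes i: "i \<in> {1..d}"
  shows "facet i = face_cut {i}"
proof -
  have F: "facet i face_of \<Delta>" "facet i \<noteq> {}" using facet_bij[OF i] by (auto simp: facet_of_def)
  then obtain x0 where x0: "x0 \<in> rel_interior (facet i)"
    using rel_interior_eq_empty face_of_imp_convex by blast
  then have x0F: "x0 \<in> facet i" using rel_interior_subset by auto
  then have x0D: "x0 \<in> \<Delta>" using F face_of_imp_subset by auto
  have eq: "facet i = face_cut (idx x0)" using face_rel_interior[OF F(1) x0] .
  have "idx x0 \<noteq> {}"
  proof
    assume "idx x0 = {}"
    then have "facet i = \<Delta>" using eq by (simp add: face_cut_def)
    then show False using facet_bij[OF i] by (simp add: facet_of_def)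
  qed
  then obtain j where j: "j \<in> {1..d}" "sl j x0 = 0" by (auto simp: idx_def)
  have "x0 \<in> facet j"
    unfolding facet_argmin[OF j(1)] using x0D j mem_\<Delta> by (force simp: sl_def)
  then have "facet i \<subseteq> facet j"
    using subset_of_face_of[of "facet j" \<Delta> "facet i"] facet_bij[OF j(1)] face_of_imp_subset[OF F(1)] x0
    by (auto simp: facet_of_def)
  moreover have "facet j \<noteq> \<Delta>" using facet_bij[OF j(1)] by (auto simp: facet_of_def)
  ultimately have "facet i = facet j"
    using facet_maximal[OF facet_bij[OF i]] facet_bij[OF j(1)] by (auto simp: facet_of_def)
  then have "i = j" using facet_inj i j by auto
  then have s0: "sl i x0 = 0" using j by simp
  show ?thesis
  proof
    show "facet i \<subseteq> face_cut {i}"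
      using eq s0 i by (auto simp: face_cut_def idx_def)
    show "face_cut {i} \<subseteq> facet i"
      unfolding facet_argmin[OF i] using mem_\<Delta> i by (force simp: face_cut_def sl_def)
  qed
qed

lemma card_idx:
  assumes v: "v \<in> verts"
  shows "card (idx v) = DIM('a)"
proof -
  have vD: "v \<in> \<Delta>" using v by (simp add: verts_def extreme_point_of_def)
  have "{F. F facet_of \<Delta> \<and> v \<in> F} = facet ` idx v"
  proof -
    have "{F. F facet_of \<Delta>} = facet ` {1..d}" using facet by (simp add: bij_betw_def)
    then have "{F. F facet_of \<Delta> \<and> v \<in> F} = {F \<in> facet ` {1..d}. v \<in> F}" by auto
    also have "\<dots> = facet ` {i \<in> {1..d}. v \<in> facet i}" by auto
    also have "{i \<in> {1..d}. v \<in> facet i} = idx v"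
      unfolding idx_def by (rule Collect_cong) (use facet_eq vD in \<open>auto simp: face_cut_def\<close>)
    finally show ?thesis .
  qed
  moreover have "inj_on facet (idx v)" using facet_inj by (auto simp: inj_on_def idx_def)
  ultimately have "card {F. F facet_of \<Delta> \<and> v \<in> F} = card (idx v)" by (simp add: card_image)
  then show ?thesis using simple v by (simp add: simple_polytope_def verts_def)
qed

text \<open>A direction orthogonal to all active normals could be followed both ways, and v would
  not be extreme.\<close>

lemma span_idx:
  assumes v: "v \<in> verts"
  shows "span (u ` idx v) = UNIV"
proof (rule ccontr)
  assume "\<not> ?thesis"
  then obtain t where t: "t \<noteq> 0" "\<forall>x\<in>span (u ` idx v). t \<bullet> x = 0"
    using span_not_UNIV_orthogonal by blast
  then have t0: "u i \<bullet> t = 0" if "i \<in> idx v" for i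
    using that by (metis image_eqI inner_commute span_base)
  have vD: "v \<in> \<Delta>" using v by (simp add: verts_def extreme_point_of_def)
  obtain r where r: "0 < r" "v + r *\<^sub>R t \<in> \<Delta>" by (rule local_stepE[OF vD, of t]) (auto simp: t0)
  obtain r' where r': "0 < r'" "v + r' *\<^sub>R (- t) \<in> \<Delta>" by (rule local_stepE[OF vD, of "- t"]) (auto simp: t0)
  have "v \<in> open_segment (v + r *\<^sub>R t) (v + r' *\<^sub>R (- t))"
    unfolding in_segment
  proof (intro conjI exI[of _ "r / (r + r')"])
    have "v + r *\<^sub>R t - (v + r' *\<^sub>R (- t)) = (r + r') *\<^sub>R t" by (simp add: algebra_simps)
    then show "v + r *\<^sub>R t \<noteq> v + r' *\<^sub>R (- t)" using r r' t by auto
    have "(1 - k) *\<^sub>R (v + r *\<^sub>R t) + k *\<^sub>R (v + r' *\<^sub>R - t) = v + ((1 - k) * r - k * r') *\<^sub>R t" for k :: real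
      by (simp add: algebra_simps)
    moreover have "(1 - r / (r + r')) * r - r / (r + r') * r' = 0" using r r' by (simp add: field_simps)
    ultimately show "v = (1 - r / (r + r')) *\<^sub>R (v + r *\<^sub>R t) + (r / (r + r')) *\<^sub>R (v + r' *\<^sub>R - t)" by simp
  qed (use r r' in auto)
  then show False using v r r' by (auto simp: verts_def extreme_point_of_def)
qed

definition \<alpha> :: "'a \<Rightarrow> nat \<Rightarrow> 'a" where "\<alpha> v = dual_vec u (idx v)"

text \<open>Simplicity: n spanning normals form a basis, and then the n equations in
  \<open>dual_vec\<close> have a unique solution, so the choice made there is forced.\<close>

lemma dual_bases_vert:
  assumes v: "v \<in> verts"
  shows "dual_bases (idx v) (\<alpha> v) u"
proof -
  have ci: "card (u ` idx v) \<le> DIM('a)" using card_image_le[OF finite_idx, of u v] card_idx[OF v] by simp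
  have ind: "independent (u ` idx v)"
    using ci span_idx[OF v] finite_idx
    by (intro card_le_dim_spanning[of _ UNIV]) auto
  have "DIM('a) = card (u ` idx v)"
    using ind span_idx[OF v] by (metis dim_UNIV dim_span dim_eq_card_independent)
  then have inj: "inj_on u (idx v)" using card_idx[OF v] finite_idx by (intro eq_card_imp_inj_on) auto
  obtain \<beta> where "dual_bases (idx v) \<beta> u"
    using dual_bases_exists[OF finite_idx inj ind span_idx[OF v]] by blast
  then interpret D: dual_bases "idx v" \<beta> u .
  have eq: "\<alpha> v j = \<beta> j" if j: "j \<in> idx v" for j
  proof -
    have "\<forall>k\<in>idx v. u k \<bullet> \<alpha> v j = (if k = j then 1 else 0)"
      unfolding \<alpha>_def dual_vec_def by (rule someI[of _ "\<beta> j"]) (use j D.dual in auto)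
    then show ?thesis by (intro D.coord_eqI) (use j D.dual in auto)
  qed
  show ?thesis
    by standard (use D.finI D.dual D.expand in \<open>auto simp: eq cong: sum.cong\<close>)
qed

text \<open>The normals active at v span the space, so their values determine the point.\<close>

lemma vert_eqI: "v \<in> verts \<Longrightarrow> w \<in> verts \<Longrightarrow> idx v \<subseteq> idx w \<Longrightarrow> v = w"
proof -
  assume v: "v \<in> verts" and "w \<in> verts" and sub: "idx v \<subseteq> idx w"
  then have "u i \<bullet> v = u i \<bullet> w" if "i \<in> idx v" for i
  proof -
    have "sl i v = 0" "sl i w = 0" using that sub by (auto simp: idx_def)
    then show ?thesis by (simp add: sl_def)
  qed
  then show ?thesis using dual_bases.coord_eqI[OF dual_bases_vert[OF v]] by blast
qed

lemma finite_verts: "finite verts"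
proof (rule finite_imageD)
  show "finite (idx ` verts)" by (rule finite_subset[of _ "Pow {1..d}"]) (auto simp: idx_def)
  show "inj_on idx verts" using vert_eqI by (auto simp: inj_on_def)
qed

lemma vert_in_\<Delta>: "v \<in> verts \<Longrightarrow> v \<in> \<Delta>"
  by (simp add: verts_def extreme_point_of_def)

lemma vert_on_face:
  assumes "F face_of \<Delta>" "F \<noteq> {}"
  obtains v where "v \<in> verts" "v \<in> F"
proof -
  have "compact F" using assms(1) compact_\<Delta> convex_\<Delta> face_of_imp_compact by blast
  then obtain v where "v extreme_point_of F"
    using extreme_point_exists_convex assms face_of_imp_convex by blast
  then show thesis using that extreme_point_of_face[OF assms(1)] by (auto simp: verts_def)
qed

lemma \<Delta>_nonempty: "\<Delta> \<noteq> {}" using interior interior_subset by blast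

lemma verts_nonempty: "verts \<noteq> {}"
  using vert_on_face[of \<Delta>] face_of_refl[OF convex_\<Delta>] \<Delta>_nonempty by blast

lemma expand_vert:
  assumes v: "v \<in> verts"
  shows "(\<Sum>j\<in>idx v. sl j x *\<^sub>R \<alpha> v j) = x - v"
proof -
  have "sl j x = u j \<bullet> (x - v)" if "j \<in> idx v" for j
    using that sl_diff[of j x v] by (auto simp: idx_def)
  then have "(\<Sum>j\<in>idx v. sl j x *\<^sub>R \<alpha> v j) = (\<Sum>j\<in>idx v. (u j \<bullet> (x - v)) *\<^sub>R \<alpha> v j)" by simp
  also have "\<dots> = x - v" by (rule dual_bases.expand[OF dual_bases_vert[OF v]])
  finally show ?thesis .
qed

lemma inner_expand_vert:
  assumes v: "v \<in> verts"
  shows "\<eta> \<bullet> x = \<eta> \<bullet> v + (\<Sum>j\<in>idx v. sl j x * (\<eta> \<bullet> \<alpha> v j))"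
proof -
  have "\<eta> \<bullet> (\<Sum>j\<in>idx v. sl j x *\<^sub>R \<alpha> v j) = \<eta> \<bullet> (x - v)" using expand_vert[OF v] by simp
  then show ?thesis by (simp add: inner_sum_right inner_diff_right)
qed

section \<open>Generic functionals and signed sums over vertices\<close>

definition generic :: "'a \<Rightarrow> bool" where
  "generic \<eta> \<longleftrightarrow> (\<forall>v\<in>verts. \<forall>j\<in>idx v. \<eta> \<bullet> \<alpha> v j \<noteq> 0)"

definition pos :: "'a \<Rightarrow> 'a \<Rightarrow> nat set" where
  "pos \<eta> v = {j \<in> idx v. \<eta> \<bullet> \<alpha> v j > 0}"

text \<open>
  The condition \<open>pos \<eta> v \<subseteq> A\<close> says that \<open>\<eta>\<close> attains its maximum over \<open>face_cut A\<close> at \<open>v\<close>.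
\<close>

lemma top_vertex:
  assumes \<eta>: "generic \<eta>" and w: "w \<in> verts" "A \<subseteq> idx w"
  shows "\<exists>!v. v \<in> verts \<and> A \<subseteq> idx v \<and> pos \<eta> v \<subseteq> A"
proof -
  have A: "A \<subseteq> {1..d}" using w by (auto simp: idx_def)
  let ?F = "face_cut A"
  have F: "?F face_of \<Delta>" by (rule face_cut_face_of[OF A])
  have wF: "w \<in> ?F" using w vert_in_\<Delta> by (auto simp: face_cut_def idx_def)
  have "compact ?F" using F compact_\<Delta> convex_\<Delta> face_of_imp_compact by blast
  then have "\<exists>x0\<in>?F. \<forall>y\<in>?F. \<eta> \<bullet> y \<le> \<eta> \<bullet> x0"
    by (rule continuous_attains_sup) (use wF in \<open>auto intro: continuous_intros\<close>)
  then obtain x0 where x0: "x0 \<in> ?F" "\<And>y. y \<in> ?F \<Longrightarrow> \<eta> \<bullet> y \<le> \<eta> \<bullet> x0" by blast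
  have "?F \<inter> {y. \<eta> \<bullet> y = \<eta> \<bullet> x0} face_of ?F"
    using x0 by (intro face_of_Int_supporting_hyperplane_le face_of_imp_convex[OF F]) auto
  then have G: "?F \<inter> {y. \<eta> \<bullet> y = \<eta> \<bullet> x0} face_of \<Delta>" using F face_of_trans by blast
  obtain v where v: "v \<in> verts" "v \<in> ?F" "\<eta> \<bullet> v = \<eta> \<bullet> x0"
    by (rule vert_on_face[OF G]) (use x0 in auto)
  have Av: "A \<subseteq> idx v" using v A by (auto simp: face_cut_def idx_def)
  interpret D: dual_bases "idx v" "\<alpha> v" u by (rule dual_bases_vert[OF v(1)])
  have "pos \<eta> v \<subseteq> A"
  proof (rule ccontr)
    assume "\<not> pos \<eta> v \<subseteq> A"
    \<comment> \<open>Following such an edge stays in \<open>?F\<close> and increases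
      \<eta>.\<close>
    then obtain j where j: "j \<in> idx v" "\<eta> \<bullet> \<alpha> v j > 0" "j \<notin> A" by (auto simp: pos_def)
    obtain r where r: "0 < r" "v + r *\<^sub>R \<alpha> v j \<in> \<Delta>"
      by (rule local_stepE[OF vert_in_\<Delta>[OF v(1)], of "\<alpha> v j"]) (use j D.dual in auto)
    have "v + r *\<^sub>R \<alpha> v j \<in> ?F"
      using r v(2) Av j by (auto simp: face_cut_def sl_add) (use D.dual in auto)
    then have "\<eta> \<bullet> (v + r *\<^sub>R \<alpha> v j) \<le> \<eta> \<bullet> v" using x0 v by auto
    then show False using r j by (simp add: inner_add_right mult_le_0_iff)
  qed
  moreover have "v' = v" if v': "v' \<in> verts" "A \<subseteq> idx v'" "pos \<eta> v' \<subseteq> A" for v'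
  proof -
    have v'F: "v' \<in> ?F" using v' vert_in_\<Delta> by (auto simp: face_cut_def idx_def)
    have terms: "sl j v * (\<eta> \<bullet> \<alpha> v' j) \<le> 0" if j: "j \<in> idx v'" for j
    proof (cases "j \<in> A")
      case True
      then show ?thesis using v(2) by (auto simp: face_cut_def)
    next
      case False
      then have "\<eta> \<bullet> \<alpha> v' j \<le> 0" using v' j by (auto simp: pos_def not_less)
      moreover have "0 \<le> sl j v" using vert_in_\<Delta>[OF v(1)] j by (auto simp: mem_\<Delta> idx_def)
      ultimately show ?thesis by (simp add: mult_nonneg_nonpos)
    qed
    have "\<eta> \<bullet> v' \<le> \<eta> \<bullet> v" using x0(2)[OF v'F] v(3) by simp
    then have "0 \<le> (\<Sum>j\<in>idx v'. sl j v * (\<eta> \<bullet> \<alpha> v' j))"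
      using inner_expand_vert[OF v'(1), of \<eta> v] by simp
    moreover have "(\<Sum>j\<in>idx v'. sl j v * (\<eta> \<bullet> \<alpha> v' j)) \<le> 0" by (rule sum_nonpos) (rule terms)
    \<comment> \<open>A nonnegative sum of nonpositive terms: all terms vanish, so by genericity v
      lies on every hyperplane active at v'.\<close>
    ultimately have "(\<Sum>j\<in>idx v'. - (sl j v * (\<eta> \<bullet> \<alpha> v' j))) = 0" by (simp add: sum_negf)
    then have "\<forall>j\<in>idx v'. - (sl j v * (\<eta> \<bullet> \<alpha> v' j)) = 0"
      by (subst (asm) sum_nonneg_eq_0_iff) (use terms finite_idx in auto)
    then have "sl j v * (\<eta> \<bullet> \<alpha> v' j) = 0" if "j \<in> idx v'" for j using that by simp
    then have "idx v' \<subseteq> idx v"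
      using \<eta> v'(1) by (auto simp: generic_def idx_def)
    then show ?thesis using vert_eqI v' v by blast
  qed
  ultimately show ?thesis using v Av by blast
qed

text \<open>Adding or removing a fixed element of \<open>Y - X\<close> is a sign-reversing
  involution.\<close>

lemma sum_interval_alternating:
  assumes "finite Y"
  shows "(\<Sum>A | X \<subseteq> A \<and> A \<subseteq> Y. (-1) ^ card A) = (if X = Y then (-1) ^ card X else (0::real))"
proof (cases "X \<subset> Y")
  case True
  then obtain a where a: "a \<in> Y" "a \<notin> X" by auto
  let ?S = "{A. X \<subseteq> A \<and> A \<subseteq> Y - {a}}"
  have fin: "finite ?S" by (rule finite_subset[of _ "Pow Y"]) (use assms in auto)
  have eq: "{A. X \<subseteq> A \<and> A \<subseteq> Y} = ?S \<union> insert a ` ?S"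
  proof (intro equalityI subsetI)
    fix A assume A: "A \<in> {A. X \<subseteq> A \<and> A \<subseteq> Y}"
    show "A \<in> ?S \<union> insert a ` ?S"
    proof (cases "a \<in> A")
      case True
      then have "A = insert a (A - {a})" by auto
      then show ?thesis using A a by blast
    qed (use A in auto)
  qed (use a in auto)
  have "(\<Sum>A | X \<subseteq> A \<and> A \<subseteq> Y. (-1) ^ card A) = (\<Sum>A\<in>?S. (-1) ^ card A) + (\<Sum>A\<in>insert a ` ?S. (-1) ^ card A :: real)"
    unfolding eq by (rule sum.union_disjoint) (use fin in auto)
  also have "(\<Sum>A\<in>insert a ` ?S. (-1) ^ card A :: real) = (\<Sum>A\<in>?S. (-1) ^ card (insert a A))"
    by (rule sum.reindex_cong[of "insert a" _ _ _]) (auto simp: inj_on_def insert_ident)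
  also have "\<dots> = (\<Sum>A\<in>?S. - ((-1) ^ card A))"
  proof (rule sum.cong[OF refl])
    fix A assume "A \<in> ?S"
    then have "finite A" "a \<notin> A" using assms by (auto intro: finite_subset[of A Y])
    then show "(-1) ^ card (insert a A) = - ((-1) ^ card A :: real)" by simp
  qed
  finally show ?thesis using True by (auto simp: sum_negf)
next
  case False
  then have "{A. X \<subseteq> A \<and> A \<subseteq> Y} = (if X = Y then {X} else {})" by auto
  then show ?thesis by auto
qed

text \<open>Inclusion-exclusion writes each summand as an alternating sum over the sets A between
  \<open>pos \<eta> v\<close> and \<open>idx v \<inter> N\<close>. After exchanging the sums, each A
  is counted at exactly one vertex, the maximum of \<eta> over \<open>face_cut A\<close>. The right
  side no longer mentions \<eta>.\<close>

lemma sign_sum_independent: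
  assumes \<eta>: "generic \<eta>" and N: "N \<subseteq> {1..d}"
  shows "(\<Sum>v\<in>verts. if pos \<eta> v = idx v \<inter> N then (-1) ^ card (pos \<eta> v) else 0)
    = (\<Sum>A | A \<subseteq> N \<and> (\<exists>w\<in>verts. A \<subseteq> idx w). (-1) ^ card A :: real)"
proof -
  let ?\<A> = "{A. A \<subseteq> N \<and> (\<exists>w\<in>verts. A \<subseteq> idx w)}"
  have finA: "finite ?\<A>" by (rule finite_subset[of _ "Pow {1..d}"]) (use N in auto)
  have "(\<Sum>v\<in>verts. if pos \<eta> v = idx v \<inter> N then (-1) ^ card (pos \<eta> v) else (0::real))
    = (\<Sum>v\<in>verts. \<Sum>A | pos \<eta> v \<subseteq> A \<and> A \<subseteq> idx v \<inter> N. (-1) ^ card A)"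
    by (intro sum.cong refl sum_interval_alternating[symmetric]) (simp add: finite_idx)
  also have "\<dots> = (\<Sum>v\<in>verts. \<Sum>A\<in>?\<A>. if A \<subseteq> idx v \<and> pos \<eta> v \<subseteq> A then (-1) ^ card A else 0)"
    by (intro sum.cong refl sum.mono_neutral_cong_left finA) auto
  also have "\<dots> = (\<Sum>A\<in>?\<A>. \<Sum>v\<in>verts. if A \<subseteq> idx v \<and> pos \<eta> v \<subseteq> A then (-1) ^ card A else 0)"
    by (rule sum.swap)
  also have "\<dots> = (\<Sum>A\<in>?\<A>. (-1) ^ card A)"
  proof (rule sum.cong[OF refl])
    fix A assume "A \<in> ?\<A>"
    then obtain w where "w \<in> verts" "A \<subseteq> idx w" by auto
    then obtain v where v: "\<And>x. x \<in> verts \<and> A \<subseteq> idx x \<and> pos \<eta> x \<subseteq> A \<longleftrightarrow> x = v"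
      using top_vertex[OF \<eta>] by metis
    then have "v \<in> verts" by auto
    have "(\<Sum>x\<in>verts. if A \<subseteq> idx x \<and> pos \<eta> x \<subseteq> A then (-1) ^ card A else (0::real))
      = (\<Sum>x\<in>verts. if x = v then (-1) ^ card A else 0)"
      by (intro sum.cong refl) (use v in auto)
    also have "\<dots> = (-1) ^ card A" using \<open>v \<in> verts\<close> finite_verts by simp
    finally show "(\<Sum>x\<in>verts. if A \<subseteq> idx x \<and> pos \<eta> x \<subseteq> A then (-1) ^ card A else (0::real)) = (-1) ^ card A" .
  qed
  finally show ?thesis .
qed

end

text \<open>Where \<eta> does not vanish, continuity keeps it so; elsewhere the multiple of \<theta>
  decides.\<close>

lemma eventually_perturb_generic:
  fixes \<eta> \<theta> :: "'a::real_inner"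
  assumes "finite X" and "\<And>x. x \<in> X \<Longrightarrow> \<eta> \<bullet> x \<noteq> 0 \<or> \<theta> \<bullet> x \<noteq> 0"
  shows "eventually (\<lambda>r. \<forall>x\<in>X. (\<eta> + r *\<^sub>R \<theta>) \<bullet> x \<noteq> 0) (at_right 0)"
proof (rule eventually_ball_finite[OF assms(1)], rule ballI)
  fix x assume x: "x \<in> X"
  show "eventually (\<lambda>r. (\<eta> + r *\<^sub>R \<theta>) \<bullet> x \<noteq> 0) (at_right 0)"
  proof (cases "\<eta> \<bullet> x = 0")
    case True
    have "eventually (\<lambda>r. 0 < (r::real)) (at_right 0)" by (rule eventually_at_right_less)
    then show ?thesis
      by eventually_elim (use True assms(2)[OF x] in \<open>auto simp: inner_add_left\<close>)
  next
    case False
    have "((\<lambda>r. (\<eta> + r *\<^sub>R \<theta>) \<bullet> x) \<longlongrightarrow> (\<eta> + 0 *\<^sub>R \<theta>) \<bullet> x) (at_right 0)"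
      by (intro tendsto_intros)
    then show ?thesis using False by (intro tendsto_imp_eventually_ne) auto
  qed
qed

lemma generic_vector_exists:
  fixes X :: "'a::real_inner set"
  assumes "finite X" "0 \<notin> X"
  shows "\<exists>\<theta>. \<forall>x\<in>X. \<theta> \<bullet> x \<noteq> 0"
  using assms
proof (induction X rule: finite_induct)
  case (insert a X)
  then obtain \<theta> where \<theta>: "\<forall>x\<in>X. \<theta> \<bullet> x \<noteq> 0" by auto
  \<comment> \<open>Perturbing in the direction of a itself works, as
    \<open>a \<bullet> a \<noteq> 0\<close>.\<close>
  have "eventually (\<lambda>r. \<forall>x\<in>insert a X. (\<theta> + r *\<^sub>R a) \<bullet> x \<noteq> 0) (at_right 0)"
    by (rule eventually_perturb_generic) (use insert \<theta> in auto)
  then show ?case using eventually_happens'[OF trivial_limit_at_right_real] by blast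
qed auto

context simple_rational_polytope
begin

section \<open>Shifted polytopes and their decomposition into cones\<close>

definition edges :: "'a set" where "edges = (\<Union>v\<in>verts. \<alpha> v ` idx v)"

lemma finite_edges: "finite edges" by (simp add: edges_def finite_verts finite_idx)

lemma edge_nonzero: "0 \<notin> edges"
  using dual_bases.dual[OF dual_bases_vert] by (fastforce simp: edges_def)

lemma generic_iff: "generic \<eta> \<longleftrightarrow> (\<forall>x\<in>edges. \<eta> \<bullet> x \<noteq> 0)"
  by (auto simp: generic_def edges_def)

lemma generic_exists: "\<exists>\<theta>. generic \<theta>"
  unfolding generic_iff using generic_vector_exists[OF finite_edges edge_nonzero] .

lemma eventually_generic:
  "generic \<theta> \<Longrightarrow> eventually (\<lambda>r. generic (\<eta> + r *\<^sub>R \<theta>)) (at_right 0)"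
  using eventually_perturb_generic[OF finite_edges, of \<eta> \<theta>] by (auto simp: generic_iff)

text \<open>
  For small \<open>h\<close> these are the vertices of the shifted polytope, but only their membership in it
  is needed.
\<close>

definition vh :: "(nat \<Rightarrow> real) \<Rightarrow> 'a \<Rightarrow> 'a" where
  "vh h v = v - (\<Sum>j\<in>idx v. h j *\<^sub>R \<alpha> v j)"

definition \<Delta>h :: "(nat \<Rightarrow> real) \<Rightarrow> 'a set" where
  "\<Delta>h h = halfspaces d u (\<lambda>i. c i + h i)"

lemma mem_\<Delta>h: "x \<in> \<Delta>h h \<longleftrightarrow> (\<forall>i\<in>{1..d}. 0 \<le> sl i x + h i)"
  by (simp add: \<Delta>h_def halfspaces_def sl_def add.assoc)

lemma sl_vh:
  assumes "v \<in> verts" "i \<in> idx v"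
  shows "sl i (vh h v) = - h i"
proof -
  interpret D: dual_bases "idx v" "\<alpha> v" u by (rule dual_bases_vert[OF assms(1)])
  have "sl i v = 0" using assms by (simp add: idx_def)
  then show ?thesis
    using D.inner_comb[OF assms(2), of h] by (simp add: vh_def sl_def inner_diff_right)
qed

lemma expand_vh:
  assumes v: "v \<in> verts"
  shows "x - vh h v = (\<Sum>j\<in>idx v. (sl j x + h j) *\<^sub>R \<alpha> v j)"
  using expand_vert[OF v, of x] by (simp add: vh_def scaleR_add_left sum.distrib)

definition small :: "(nat \<Rightarrow> real) \<Rightarrow> bool" where
  "small h \<longleftrightarrow> (\<forall>v\<in>verts. vh h v \<in> \<Delta>h h)"

lemma small_0: "small (\<lambda>_. 0)"
  using vert_in_\<Delta> by (auto simp: small_def vh_def mem_\<Delta>h mem_\<Delta>)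

lemma small_exists: "\<exists>\<epsilon>>0. \<forall>h. (\<forall>i\<in>{1..d}. \<bar>h i\<bar> < \<epsilon>) \<longrightarrow> small h"
proof -
  let ?P = "{(v, i). v \<in> verts \<and> i \<in> {1..d} - idx v}"
  \<comment> \<open>If every \<open>h j\<close> is below m in absolute value, then
    \<open>sl i (vh h v) + h i\<close> is at least \<open>sl i v - m * ?M v i\<close>: the 1
    accounts for \<open>h i\<close>, the sum for the displacement of the vertex.\<close>
  let ?M = "\<lambda>v i. 1 + (\<Sum>j\<in>idx v. \<bar>u i \<bullet> \<alpha> v j\<bar>)"
  have M: "?M v i > 0" for v i by (simp add: add_pos_nonneg sum_nonneg)
  \<comment> \<open>The default 1 covers the case that no constraint is inactive at any
    vertex.\<close>
  let ?E = "insert 1 ((\<lambda>(v, i). sl i v / ?M v i) ` ?P)"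
  have fin: "finite ?E"
    by (intro finite.insertI finite_imageI finite_subset[of ?P "verts \<times> {1..d}"]) (auto simp: finite_verts)
  have pos: "0 < sl i v" if "v \<in> verts" "i \<in> {1..d} - idx v" for v i
    using that vert_in_\<Delta>[of v] by (auto simp: mem_\<Delta> idx_def less_le)
  define m where "m = Min ?E"
  have e: "0 < m" unfolding m_def using fin M pos by (subst Min_gr_iff) auto
  have "small h" if h: "\<forall>i\<in>{1..d}. \<bar>h i\<bar> < m" for h
    unfolding small_def mem_\<Delta>h
  proof safe
    fix v i assume v: "v \<in> verts" and i: "i \<in> {1..d}"
    show "0 \<le> sl i (vh h v) + h i"
    proof (cases "i \<in> idx v")
      case False
      have "m \<le> sl i v / ?M v i" unfolding m_def using fin v i False by (intro Min_le) auto
      then have *: "m * ?M v i \<le> sl i v" using M[where v = v and i = i] by (simp add: pos_le_divide_eq)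
      have "(\<Sum>j\<in>idx v. h j * (u i \<bullet> \<alpha> v j)) \<le> (\<Sum>j\<in>idx v. m * \<bar>u i \<bullet> \<alpha> v j\<bar>)"
      proof (rule sum_mono)
        fix j assume "j \<in> idx v"
        then have "\<bar>h j\<bar> \<le> m" using h by (auto simp: idx_def less_imp_le)
        then have "\<bar>h j\<bar> * \<bar>u i \<bullet> \<alpha> v j\<bar> \<le> m * \<bar>u i \<bullet> \<alpha> v j\<bar>" by (rule mult_right_mono) simp
        then show "h j * (u i \<bullet> \<alpha> v j) \<le> m * \<bar>u i \<bullet> \<alpha> v j\<bar>"
          using abs_ge_self[of "h j * (u i \<bullet> \<alpha> v j)"] by (simp add: abs_mult)
      qed
      moreover have "- h i \<le> m" using h i by (auto dest!: bspec[of _ _ i])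
      ultimately have "(\<Sum>j\<in>idx v. h j * (u i \<bullet> \<alpha> v j)) - h i \<le> m * ?M v i"
        by (simp add: algebra_simps sum_distrib_left)
      then show ?thesis using *
        by (simp add: vh_def sl_def inner_diff_right inner_sum_right)
    qed (use sl_vh v in auto)
  qed
  then show ?thesis using e by blast
qed

text \<open>At the vertex maximizing \<eta> over \<Delta> no edge is increasing, so the shifted
  vertex bounds \<eta> on the shifted polytope too. The sum over all vertices avoids naming this
  vertex.\<close>

lemma top_bound:
  assumes h: "small h" and \<eta>: "generic \<eta>" and x: "x \<in> \<Delta>h h"
  shows "\<eta> \<bullet> x \<le> (\<Sum>v\<in>verts. \<bar>\<eta> \<bullet> vh h v\<bar>)"
proof -
  obtain w where "w \<in> verts" using verts_nonempty by auto
  then obtain v where v: "v \<in> verts" "pos \<eta> v \<subseteq> {}" using top_vertex[OF \<eta>, of w "{}"] by auto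
  have "\<eta> \<bullet> (x - vh h v) = (\<Sum>j\<in>idx v. (sl j x + h j) * (\<eta> \<bullet> \<alpha> v j))"
    by (simp add: expand_vh[OF v(1)] inner_sum_right)
  also have "\<dots> \<le> 0"
  proof (rule sum_nonpos)
    fix j assume j: "j \<in> idx v"
    then have "\<eta> \<bullet> \<alpha> v j \<le> 0" using v by (auto simp: pos_def not_less)
    moreover have "0 \<le> sl j x + h j" using x j by (auto simp: mem_\<Delta>h idx_def)
    ultimately show "(sl j x + h j) * (\<eta> \<bullet> \<alpha> v j) \<le> 0" by (simp add: mult_nonneg_nonpos)
  qed
  finally have "\<eta> \<bullet> x \<le> \<bar>\<eta> \<bullet> vh h v\<bar>" by (simp add: inner_diff_right)
  also have "\<dots> \<le> (\<Sum>v\<in>verts. \<bar>\<eta> \<bullet> vh h v\<bar>)" by (rule member_le_sum[OF v(1)]) (auto simp: finite_verts)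
  finally show ?thesis .
qed

text \<open>An arbitrary w equals \<open>w + r *\<^sub>R \<theta>\<close> plus r times
  \<open>- \<theta>\<close>, both generic, so \<open>top_bound\<close> controls every linear
  functional from above.\<close>

lemma bounded_\<Delta>h:
  assumes h: "small h"
  shows "bounded (\<Delta>h h)"
proof -
  have K: "\<exists>K. \<forall>x\<in>\<Delta>h h. w \<bullet> x \<le> K" for w
  proof -
    obtain \<theta> where \<theta>: "generic \<theta>" using generic_exists by auto
    have "eventually (\<lambda>r. generic (w + r *\<^sub>R \<theta>) \<and> 0 < r) (at_right 0)"
      by (rule eventually_conj[OF eventually_generic[OF \<theta>] eventually_at_right_less])
    then obtain r where r: "generic (w + r *\<^sub>R \<theta>)" "0 < r"
      using eventually_happens'[OF trivial_limit_at_right_real] by blast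
    have m: "generic (- \<theta>)" using \<theta> by (auto simp: generic_def)
    have "w \<bullet> x \<le> (\<Sum>v\<in>verts. \<bar>(w + r *\<^sub>R \<theta>) \<bullet> vh h v\<bar>) + r * (\<Sum>v\<in>verts. \<bar>(- \<theta>) \<bullet> vh h v\<bar>)"
      if x: "x \<in> \<Delta>h h" for x
    proof -
      have "w \<bullet> x = (w + r *\<^sub>R \<theta>) \<bullet> x + r * ((- \<theta>) \<bullet> x)" by (simp add: inner_add_left)
      also have "\<dots> \<le> (\<Sum>v\<in>verts. \<bar>(w + r *\<^sub>R \<theta>) \<bullet> vh h v\<bar>) + r * (\<Sum>v\<in>verts. \<bar>(- \<theta>) \<bullet> vh h v\<bar>)"
        using top_bound[OF h r(1) x] top_bound[OF h m x] r(2) by (intro add_mono mult_left_mono) auto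
      finally show ?thesis .
    qed
    then show ?thesis by blast
  qed
  then obtain k where k: "\<And>w x. x \<in> \<Delta>h h \<Longrightarrow> w \<bullet> x \<le> k w" by metis
  show ?thesis
  proof (rule boundedI)
    fix x assume x: "x \<in> \<Delta>h h"
    have "norm x \<le> (\<Sum>b\<in>Basis. \<bar>x \<bullet> b\<bar>)" by (rule norm_le_l1)
    also have "\<dots> \<le> (\<Sum>b\<in>Basis. \<bar>k b\<bar> + \<bar>k (- b)\<bar>)"
    proof (rule sum_mono)
      fix b :: 'a
      show "\<bar>x \<bullet> b\<bar> \<le> \<bar>k b\<bar> + \<bar>k (- b)\<bar>"
        using k[OF x, of b] k[OF x, of "- b"] by (simp add: inner_commute)
    qed
    finally show "norm x \<le> (\<Sum>b\<in>Basis. \<bar>k b\<bar> + \<bar>k (- b)\<bar>)" .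
  qed
qed

lemma convex_\<Delta>h: "convex (\<Delta>h h)" and closed_\<Delta>h: "closed (\<Delta>h h)"
proof -
  have "\<Delta>h h = (\<Inter>i\<in>{1..d}. {x. u i \<bullet> x \<ge> - (c i + h i)})"
  proof -
    have "0 \<le> u i \<bullet> x + (c i + h i) \<longleftrightarrow> - (c i + h i) \<le> u i \<bullet> x" for i x by linarith
    then show ?thesis by (simp only: \<Delta>h_def halfspaces_def)
  qed
  then show "convex (\<Delta>h h)" "closed (\<Delta>h h)"
    by (simp_all only:) (intro convex_INT convex_halfspace_ge closed_INT ballI closed_halfspace_ge)+
qed

text \<open>
  By \<open>sign_sum_independent\<close> the functional may be replaced by one that separates a point outside
  the polytope from the vertices, and then every summand vanishes.
\<close>

lemma polar_decomposition:
  assumes h: "small h" and \<eta>: "generic \<eta>"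
  shows "(\<Sum>v\<in>verts. if \<forall>j\<in>idx v. (if \<eta> \<bullet> \<alpha> v j < 0 then 0 \<le> sl j x + h j else sl j x + h j < 0)
      then (-1) ^ card (pos \<eta> v) else 0) = (indicator (\<Delta>h h) x :: real)"
proof -
  let ?N = "{i \<in> {1..d}. sl i x + h i < 0}"
  have cond: "(\<forall>j\<in>idx v. (if \<eta> \<bullet> \<alpha> v j < 0 then 0 \<le> sl j x + h j else sl j x + h j < 0))
     \<longleftrightarrow> pos \<eta> v = idx v \<inter> ?N" if v: "v \<in> verts" and \<eta>: "generic \<eta>" for \<eta> v
  proof -
    have "\<eta> \<bullet> \<alpha> v j < 0 \<longleftrightarrow> \<not> 0 < \<eta> \<bullet> \<alpha> v j" if "j \<in> idx v" for j
      using \<eta> v that by (force simp: generic_def)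
    moreover have "pos \<eta> v = idx v \<inter> ?N \<longleftrightarrow> (\<forall>j\<in>idx v. 0 < \<eta> \<bullet> \<alpha> v j \<longleftrightarrow> sl j x + h j < 0)"
      by (auto simp: pos_def idx_def)
    ultimately show ?thesis by (auto simp: not_less) 
  qed
  have "(\<Sum>v\<in>verts. if \<forall>j\<in>idx v. (if \<eta> \<bullet> \<alpha> v j < 0 then 0 \<le> sl j x + h j else sl j x + h j < 0)
      then (-1) ^ card (pos \<eta> v) else (0::real)) = (\<Sum>v\<in>verts. if pos \<eta> v = idx v \<inter> ?N then (-1) ^ card (pos \<eta> v) else 0)"
    by (intro sum.cong refl if_cong cond \<eta>)
  also have "\<dots> = (\<Sum>A | A \<subseteq> ?N \<and> (\<exists>w\<in>verts. A \<subseteq> idx w). (-1) ^ card A)"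
    by (rule sign_sum_independent[OF \<eta>]) auto
  also have "\<dots> = indicator (\<Delta>h h) x"
  proof (cases "x \<in> \<Delta>h h")
    case True
    then have "?N = {}" by (force simp: mem_\<Delta>h)
    then have "{A. A \<subseteq> ?N \<and> (\<exists>w\<in>verts. A \<subseteq> idx w)} = {{}}" using verts_nonempty by auto
    then show ?thesis using True by simp
  next
    case False
    let ?C = "convex hull (vh h ` verts)"
    have "?C \<subseteq> \<Delta>h h" using h by (intro hull_minimal convex_\<Delta>h) (auto simp: small_def)
    then have "x \<notin> ?C" using False by auto
    moreover have "closed ?C"
      by (intro compact_imp_closed compact_convex_hull finite_imp_compact finite_imageI finite_verts)
    ultimately obtain a b where ab: "a \<bullet> x < b" "\<And>y. y \<in> ?C \<Longrightarrow> b < a \<bullet> y"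
      using separating_hyperplane_closed_point[of ?C x] by auto
    obtain \<theta> where \<theta>: "generic \<theta>" using generic_exists by auto
    have "eventually (\<lambda>r. (- a + r *\<^sub>R \<theta>) \<bullet> (x - vh h v) > 0) (at_right 0)" if "v \<in> verts" for v
    proof -
      have "vh h v \<in> ?C" using that by (intro hull_inc) auto
      then have "0 < (- a + 0 *\<^sub>R \<theta>) \<bullet> (x - vh h v)" using ab(1) ab(2)[of "vh h v"] by (simp add: inner_diff_right)
      moreover have "((\<lambda>r. (- a + r *\<^sub>R \<theta>) \<bullet> (x - vh h v)) \<longlongrightarrow> (- a + 0 *\<^sub>R \<theta>) \<bullet> (x - vh h v)) (at_right 0)"
        by (intro tendsto_intros)
      ultimately show ?thesis by (rule order_tendstoD(1)[rotated])
    qed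
    \<comment> \<open>The negative of the separating functional, perturbed to become generic, is
      larger at x than at every shifted vertex.\<close>
    then have "eventually (\<lambda>r. (\<forall>v\<in>verts. (- a + r *\<^sub>R \<theta>) \<bullet> (x - vh h v) > 0) \<and> generic (- a + r *\<^sub>R \<theta>)) (at_right 0)"
      using finite_verts \<theta> by (intro eventually_conj eventually_ball_finite eventually_generic) auto
    then obtain r where r: "\<forall>v\<in>verts. (- a + r *\<^sub>R \<theta>) \<bullet> (x - vh h v) > 0" "generic (- a + r *\<^sub>R \<theta>)"
      using eventually_happens'[OF trivial_limit_at_right_real] by blast
    let ?e = "- a + r *\<^sub>R \<theta>"
    have "pos ?e v \<noteq> idx v \<inter> ?N" if v: "v \<in> verts" for v
    proof
      \<comment> \<open>Matching signs would make every term in the expansion of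
        \<open>x - vh h v\<close> along the edges nonpositive.\<close>
      assume p: "pos ?e v = idx v \<inter> ?N"
      have "?e \<bullet> (x - vh h v) = (\<Sum>j\<in>idx v. (sl j x + h j) * (?e \<bullet> \<alpha> v j))"
        by (subst expand_vh[OF v]) (simp add: inner_sum_right)
      also have "\<dots> \<le> 0"
      proof (rule sum_nonpos)
        fix j assume j: "j \<in> idx v"
        show "(sl j x + h j) * (?e \<bullet> \<alpha> v j) \<le> 0"
        proof (cases "j \<in> pos ?e v")
          case True
          then have "j \<in> ?N" using p by blast
          then have "sl j x + h j \<le> 0" by simp
          moreover have "0 \<le> ?e \<bullet> \<alpha> v j" using True unfolding pos_def by simp
          ultimately show ?thesis by (rule mult_nonpos_nonneg)
        next
          case False
          then have "j \<notin> ?N" using p j by blast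
          then have "0 \<le> sl j x + h j" using j by (simp add: idx_def not_less)
          moreover have "?e \<bullet> \<alpha> v j \<le> 0" using False j unfolding pos_def by (simp only: mem_Collect_eq not_less simp_thms)
          ultimately show ?thesis by (rule mult_nonneg_nonpos)
        qed
      qed
      finally show False using r(1) v by (auto simp: not_less)
    qed
    then have zero: "(\<Sum>v\<in>verts. if pos ?e v = idx v \<inter> ?N then (-1) ^ card (pos ?e v) else (0::real)) = 0"
      by (intro sum.neutral) auto
    have NS: "?N \<subseteq> {1..d}" by auto
    have "(\<Sum>A | A \<subseteq> ?N \<and> (\<exists>w\<in>verts. A \<subseteq> idx w). (-1) ^ card A) = (0::real)"
      by (rule trans[OF sign_sum_independent[OF r(2) NS, symmetric] zero])
    then show ?thesis using False by simp
  qed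
  finally show ?thesis .
qed

end

section \<open>Brion's formulas\<close>

lemma has_sum_sum_finite:
  fixes f :: "'i \<Rightarrow> 'b \<Rightarrow> 'c::topological_comm_monoid_add"
  assumes "finite A" "\<And>i. i \<in> A \<Longrightarrow> (f i has_sum s i) B"
  shows "((\<lambda>x. \<Sum>i\<in>A. f i x) has_sum (\<Sum>i\<in>A. s i)) B"
  using assms by (induction A rule: finite_induct) (auto intro!: has_sum_add)

lemma has_sum_prod_PiE:
  fixes f :: "'i \<Rightarrow> 'b \<Rightarrow> complex"
  assumes fin: "finite A" and cnt: "\<And>i. i \<in> A \<Longrightarrow> countable (B i)"
    and s: "\<And>i. i \<in> A \<Longrightarrow> (f i has_sum s i) (B i)"
    and abs: "\<And>i. i \<in> A \<Longrightarrow> (\<lambda>y. norm (f i y)) summable_on B i"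
  shows "((\<lambda>g. \<Prod>i\<in>A. f i (g i)) has_sum (\<Prod>i\<in>A. s i)) (PiE A B)"
proof -
  have "Infinite_Set_Sum.abs_summable_on (\<lambda>g. \<Prod>i\<in>A. f i (g i)) (PiE A B)"
  proof (rule abs_summable_on_prod_PiE[OF fin cnt])
    fix i assume "i \<in> A"
    then show "Infinite_Set_Sum.abs_summable_on (f i) (B i)"
      by (intro abs_summable_equivalent[THEN iffD1] abs)
  qed
  then have "(\<lambda>g. \<Prod>i\<in>A. f i (g i)) summable_on PiE A B"
    by (rule abs_summable_summable[OF abs_summable_equivalent[THEN iffD2]])
  moreover have "infsum (\<lambda>g. \<Prod>i\<in>A. f i (g i)) (PiE A B) = (\<Prod>i\<in>A. infsum (f i) (B i))"
    by (rule infsum_prod_PiE_abs[OF fin abs])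
  moreover have "\<dots> = (\<Prod>i\<in>A. s i)" by (intro prod.cong refl infsumI s)
  ultimately show ?thesis using has_sum_infsum by metis
qed

lemma has_sum_powi_nonneg:
  fixes q :: complex
  assumes q: "norm q < 1"
  shows "((\<lambda>k. q powi k) has_sum 1 / (1 - q)) {0..}" "(\<lambda>k. norm (q powi k)) summable_on {0..}"
proof -
  have im: "{0..} = range (int :: nat \<Rightarrow> int)"
    by (auto intro: range_eqI[of _ _ "nat _"])
  have "((\<lambda>n. q ^ n) has_sum 1 / (1 - q)) UNIV"
    by (intro norm_summable_imp_has_sum geometric_sums q) (use q in \<open>auto simp: norm_power summable_geometric\<close>)
  then show "((\<lambda>k. q powi k) has_sum 1 / (1 - q)) {0..}"
    unfolding im by (subst has_sum_reindex) (auto simp: o_def inj_on_def)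
  have "((\<lambda>n. norm q ^ n) has_sum 1 / (1 - norm q)) UNIV"
    by (intro norm_summable_imp_has_sum geometric_sums) (use q in \<open>auto simp: norm_power summable_geometric\<close>)
  then have "(\<lambda>n. norm q ^ n) summable_on UNIV" by (auto simp: summable_on_def)
  then show "(\<lambda>k. norm (q powi k)) summable_on {0..}"
    unfolding im by (subst summable_on_reindex) (auto simp: o_def inj_on_def norm_power)
qed

text \<open>The substitution of -1 - k for k reduces this to nonnegative exponents. The sum is minus
  the rational function of the nonnegative series, which is why turning an edge costs only a
  sign.\<close>

lemma has_sum_powi_neg:
  fixes q :: complex
  assumes q: "norm q > 1"
  shows "((\<lambda>k. q powi k) has_sum - 1 / (1 - q)) {..<0}" "(\<lambda>k. norm (q powi k)) summable_on {..<0}"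
proof -
  let ?h = "\<lambda>k::int. - 1 - k"
  have bij: "bij_betw ?h {0..} {..<0}" by (rule bij_betwI[where g = ?h]) auto
  have q0: "q \<noteq> 0" using q by auto
  have qi: "norm (inverse q) < 1" using q q0 by (simp add: norm_inverse inverse_less_1_iff)
  have eq: "q powi (?h k) = inverse q * inverse q powi k" for k
    using q0 by (simp add: power_int_diff power_int_minus field_simps)
  have val: "inverse q * (1 / (1 - inverse q)) = - 1 / (1 - q)"
  proof -
    have "q \<noteq> 1" using q by auto
    then show ?thesis using q0 by (simp add: field_simps)
  qed
  have "((\<lambda>k. inverse q * inverse q powi k) has_sum inverse q * (1 / (1 - inverse q))) {0..}"
    by (intro has_sum_cmult_right has_sum_powi_nonneg qi)
  then have "((\<lambda>k. q powi (?h k)) has_sum - 1 / (1 - q)) {0..}" by (simp only: eq val)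
  then show "((\<lambda>k. q powi k) has_sum - 1 / (1 - q)) {..<0}"
    by (subst (asm) has_sum_reindex_bij_betw[OF bij])
  have "(\<lambda>k. norm (inverse q) * norm (inverse q powi k)) summable_on {0..}"
    by (intro summable_on_cmult_right has_sum_powi_nonneg qi)
  then have "(\<lambda>k. norm (q powi (?h k))) summable_on {0..}" by (simp only: eq norm_mult)
  then show "(\<lambda>k. norm (q powi k)) summable_on {..<0}"
    by (subst (asm) summable_on_reindex_bij_betw[OF bij])
qed

lemma has_bochner_integral_translate:
  fixes f :: "'a::euclidean_space \<Rightarrow> 'b::{banach,second_countable_topology}"
  assumes "has_bochner_integral lborel f x"
  shows "has_bochner_integral lborel (\<lambda>y. f (y - a)) x"
proof -
  have [measurable]: "f \<in> borel_measurable borel" using assms by (auto dest: borel_measurable_has_bochner_integral)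
  have "has_bochner_integral (distr lborel borel ((+) (- a))) f x"
    using assms by (simp add: lborel_distr_plus)
  then have "has_bochner_integral lborel (\<lambda>y. f ((+) (- a) y)) x"
    by (simp add: has_bochner_integral_iff integrable_distr_eq integral_distr)
  then show ?thesis by simp
qed

text \<open>The sequence r is bounded, so on the compact set S all integrands share one bound
  \<open>exp C\<close>.\<close>

lemma integral_exp_perturb_tendsto:
  fixes \<xi> \<theta> :: "'a::euclidean_space \<Rightarrow> complex"
  assumes S: "compact S" and lin: "linear \<xi>" "linear \<theta>" and r: "r \<longlonglongrightarrow> 0"
  shows "(\<lambda>n. LINT x|lborel. indicator S x *\<^sub>R exp (\<xi> x + of_real (r n) * \<theta> x)) \<longlonglongrightarrow>
    (LINT x|lborel. indicator S x *\<^sub>R exp (\<xi> x))"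
proof -
  have cont: "continuous_on A \<xi>" "continuous_on A \<theta>" for A
    using lin by (auto intro: linear_continuous_on simp: linear_conv_bounded_linear)
  have [measurable]: "\<xi> \<in> borel_measurable borel" "\<theta> \<in> borel_measurable borel"
    using cont by (auto intro: borel_measurable_continuous_onI)
  have [measurable]: "S \<in> sets borel" using S by (simp add: borel_compact)
  have "Bseq r" using r by (rule convergent_imp_Bseq[OF convergentI])
  then obtain R where R: "R > 0" "\<And>n. \<bar>r n\<bar> \<le> R" by (auto simp: Bseq_def)
  have "compact ((\<lambda>x. norm (\<xi> x) + R * norm (\<theta> x)) ` S)"
    by (intro compact_continuous_image continuous_intros cont S)
  then obtain C where C: "\<And>x. x \<in> S \<Longrightarrow> norm (\<xi> x) + R * norm (\<theta> x) \<le> C"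
    by (meson bounded_imp_bdd_above bdd_above.E compact_imp_bounded image_eqI)
  show ?thesis
  proof (rule integral_dominated_convergence[where w = "\<lambda>x. indicator S x *\<^sub>R exp C"])
    show "integrable lborel (\<lambda>x. indicat_real S x *\<^sub>R exp C)"
    proof -
      have "integrable lborel (indicat_real S)"
      proof (rule integrable_real_indicator)
        show "S \<in> sets lborel" using S by (simp add: borel_compact)
        show "emeasure lborel S < \<infinity>" by (rule emeasure_bounded_finite[OF compact_imp_bounded[OF S]])
      qed
      then show ?thesis by (rule integrable_scaleR_left)
    qed
    show "AE x in lborel. (\<lambda>n. indicat_real S x *\<^sub>R exp (\<xi> x + of_real (r n) * \<theta> x)) \<longlonglongrightarrow> indicat_real S x *\<^sub>R exp (\<xi> x)"
    proof (rule AE_I2)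
      fix x
      have "(\<lambda>n. indicat_real S x *\<^sub>R exp (\<xi> x + of_real (r n) * \<theta> x)) \<longlonglongrightarrow> indicat_real S x *\<^sub>R exp (\<xi> x + of_real 0 * \<theta> x)"
        by (intro tendsto_intros r)
      then show "(\<lambda>n. indicat_real S x *\<^sub>R exp (\<xi> x + of_real (r n) * \<theta> x)) \<longlonglongrightarrow> indicat_real S x *\<^sub>R exp (\<xi> x)" by simp
    qed
    show "AE x in lborel. norm (indicat_real S x *\<^sub>R exp (\<xi> x + of_real (r n) * \<theta> x)) \<le> indicat_real S x *\<^sub>R exp C" for n
    proof (rule AE_I2)
      fix x
      have "Re (\<xi> x + of_real (r n) * \<theta> x) \<le> C" if "x \<in> S"
      proof -
        have "Re (\<xi> x + of_real (r n) * \<theta> x) \<le> norm (\<xi> x + of_real (r n) * \<theta> x)" by (rule complex_Re_le_cmod)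
        also have "\<dots> \<le> norm (\<xi> x) + \<bar>r n\<bar> * norm (\<theta> x)"
          using norm_triangle_ineq[of "\<xi> x" "of_real (r n) * \<theta> x"] by (simp add: norm_mult)
        also have "\<dots> \<le> norm (\<xi> x) + R * norm (\<theta> x)" using R(2)[of n] by (intro add_left_mono mult_right_mono) auto
        also have "\<dots> \<le> C" using C that .
        finally show ?thesis .
      qed
      then show "norm (indicat_real S x *\<^sub>R exp (\<xi> x + of_real (r n) * \<theta> x)) \<le> indicat_real S x *\<^sub>R exp C"
        by (auto simp: indicator_def norm_exp_eq_Re)
    qed
  qed measurable
qed

section \<open>The lattice seen from a vertex, and Brion's formula for the integral\<close>

context simple_rational_polytope
begin

text \<open>The same choice of a basis as in \<open>covolume\<close>, so that the latter is the
  volume of \<open>LB.cell\<close>.\<close>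

definition LB :: "'a set" where "LB = (SOME B. lattice_basis L B)"

definition LBd :: "'a \<Rightarrow> 'a" where "LBd = (SOME \<beta>. dual_bases LB (\<lambda>x. x) \<beta>)"

lemma lattice_basis_LB: "lattice_basis L LB"
  using lattice unfolding LB_def is_lattice_def by (rule someI_ex)

lemma dual_bases_LB: "dual_bases LB (\<lambda>x. x) LBd"
proof -
  have "independent LB" "span LB = UNIV" using lattice_basis_LB by (auto simp: lattice_basis_def)
  then have "\<exists>\<beta>. dual_bases LB \<beta> (\<lambda>x. x)"
    by (intro dual_bases_exists) (auto simp: independent_imp_finite)
  then have "\<exists>\<beta>. dual_bases LB (\<lambda>x. x) \<beta>" using dual_bases.swap by blast
  then show ?thesis unfolding LBd_def by (rule someI_ex)
qed

sublocale LB: dual_bases LB "\<lambda>x. x" LBd by (rule dual_bases_LB)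
sublocale LB': dual_bases LB LBd "\<lambda>x. x" by (rule LB.swap)

lemma LB_lat: "LB.lat = L"
  using lattice_basis_LB by (simp add: LB.lat_eq_int_span lattice_basis_def)

lemma LB'_lat: "LB'.lat = dual_lattice L"
proof
  show "dual_lattice L \<subseteq> LB'.lat"
    using LB.vec_in_lat by (auto simp: LB'.lat_def dual_lattice_def LB_lat inner_commute)
  show "LB'.lat \<subseteq> dual_lattice L"
  proof
    fix y assume y: "y \<in> LB'.lat"
    have "y \<bullet> x \<in> \<int>" if "x \<in> L" for x
    proof -
      have "x \<in> LB.lat" using that by (simp add: LB_lat)
      then show ?thesis using y
        by (subst LB.inner_expand) (auto simp: LB.lat_def LB'.lat_def inner_commute intro!: Ints_sum Ints_mult)
    qed
    then show "y \<in> dual_lattice L" by (auto simp: dual_lattice_def)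
  qed
qed

lemma covolume_eq: "covolume L = LB.vol"
proof -
  have "{\<Sum>b\<in>LB. t b *\<^sub>R b | t. \<forall>b\<in>LB. 0 \<le> t b \<and> t b < 1} = LB.cell"
  proof (intro equalityI subsetI)
    fix x assume "x \<in> {\<Sum>b\<in>LB. t b *\<^sub>R b | t. \<forall>b\<in>LB. 0 \<le> t b \<and> t b < 1}"
    then show "x \<in> LB.cell" by (auto simp: LB.cell_def LB.inner_comb)
  next
    fix x assume "x \<in> LB.cell"
    then show "x \<in> {\<Sum>b\<in>LB. t b *\<^sub>R b | t. \<forall>b\<in>LB. 0 \<le> t b \<and> t b < 1}"
      by (intro CollectI exI[of _ "\<lambda>b. LBd b \<bullet> x"]) (simp add: LB.expand LB.cell_def)
  qed
  then show ?thesis by (simp add: covolume_def Let_def LB.vol_def flip: LB_def)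
qed

lemma u_dual: "i \<in> {1..d} \<Longrightarrow> u i \<in> dual_lattice L"
  using normal by (auto simp: primitive_covector_def)

text \<open>The normals are integral on L, so L lies in the lattice spanned by the edge vectors at
  v.\<close>

lemma dual_bases_pair_vert: "v \<in> verts \<Longrightarrow> dual_bases_pair LB (\<lambda>x. x) LBd (idx v) (\<alpha> v) u"
proof -
  assume v: "v \<in> verts"
  interpret D: dual_bases "idx v" "\<alpha> v" u by (rule dual_bases_vert[OF v])
  show ?thesis
  proof unfold_locales
    have "u j \<bullet> x \<in> \<int>" if "x \<in> L" "j \<in> idx v" for x j
      using u_dual[of j] that by (auto simp: dual_lattice_def idx_def)
    then show "LB.lat \<subseteq> D.lat" by (auto simp: LB_lat D.lat_def)
  qed
qed

text \<open>
  The half-open cell spanned by the normals at \<open>v\<close> contains exactly one representative of every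
  element of the group of \<open>v\<close>.
\<close>

definition reps :: "'a \<Rightarrow> 'a set" where
  "reps v = {y \<in> dual_lattice L. \<forall>j\<in>idx v. 0 \<le> y \<bullet> \<alpha> v j \<and> y \<bullet> \<alpha> v j < 1}"

definition cell_vol :: "'a \<Rightarrow> real" where "cell_vol v = dual_bases.vol (idx v) u"

text \<open>Read off from the pair of lattices at v, where \<open>R\<close> is
  \<open>reps v\<close>. The last claim turns the ratio of \<open>cell_vol v\<close> and the
  covolume into the factor of the average over characters.\<close>

lemma
  assumes v: "v \<in> verts"
  shows finite_reps: "finite (reps v)" and card_reps_pos: "card (reps v) > 0"
    and lattice_indicator_vert: "\<And>x. (\<And>j. j \<in> idx v \<Longrightarrow> u j \<bullet> x \<in> \<int>) \<Longrightarrow>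
        (\<Sum>y\<in>reps v. e1 (y \<bullet> x)) = (if x \<in> L then of_nat (card (reps v)) else 0)"
    and covolume_index: "covolume L = real (card (reps v)) * cell_vol v"
proof -
  interpret P: dual_bases_pair LB "\<lambda>x. x" LBd "idx v" "\<alpha> v" u by (rule dual_bases_pair_vert[OF v])
  have "P.R = reps v"
    by (auto simp: P.R_def LB'_lat P.A'.cell_def reps_def inner_commute)
  then show "finite (reps v)" "card (reps v) > 0" "covolume L = real (card (reps v)) * cell_vol v"
    "\<And>x. (\<And>j. j \<in> idx v \<Longrightarrow> u j \<bullet> x \<in> \<int>) \<Longrightarrow>
        (\<Sum>y\<in>reps v. e1 (y \<bullet> x)) = (if x \<in> L then of_nat (card (reps v)) else 0)"
    using P.finite_R P.card_R_pos P.lattice_indicator P.vol_index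
    by (auto simp: covolume_eq LB_lat P.A.lat_def cell_vol_def)
qed

lemma covolume_pos: "covolume L > 0" using LB.vol_pos by (simp add: covolume_eq)

text \<open>The sign of v in the decomposition counts the turned edges, and each of these
  contributes one sign to the sum or integral over the cone; the two cancel.\<close>

lemma prod_sign:
  fixes \<xi> :: "'a \<Rightarrow> complex"
  assumes "\<And>j. j \<in> idx v \<Longrightarrow> Re (\<xi> (\<alpha> v j)) = \<eta> \<bullet> \<alpha> v j" "\<And>j. j \<in> idx v \<Longrightarrow> \<eta> \<bullet> \<alpha> v j \<noteq> 0"
  shows "of_real ((-1) ^ card (pos \<eta> v)) * (\<Prod>j\<in>idx v. (if Re (\<xi> (\<alpha> v j)) < 0 then 1 else - 1) * g j) = (\<Prod>j\<in>idx v. g j :: complex)"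
proof -
  have "(\<Prod>j\<in>idx v. if j \<in> pos \<eta> v then - 1 else 1 :: complex) = (-1) ^ card (pos \<eta> v)"
    by (subst prod.inter_filter[symmetric]) (auto simp: finite_idx pos_def)
  moreover have "(if j \<in> pos \<eta> v then - 1 else 1 :: complex) * (if Re (\<xi> (\<alpha> v j)) < 0 then 1 else - 1) = 1"
    if "j \<in> idx v" for j using assms(1)[OF that] assms(2)[OF that] that by (auto simp: pos_def)
  then have "(\<Prod>j\<in>idx v. if j \<in> pos \<eta> v then - 1 else 1 :: complex) * (\<Prod>j\<in>idx v. (if Re (\<xi> (\<alpha> v j)) < 0 then 1 else - 1) * g j)
    = (\<Prod>j\<in>idx v. g j)"
    by (subst prod.distrib[symmetric], intro prod.cong refl) (simp add: mult.assoc[symmetric])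
  ultimately show ?thesis by simp
qed

definition re_vec :: "('a \<Rightarrow> complex) \<Rightarrow> 'a" where "re_vec \<xi> = (\<Sum>b\<in>Basis. Re (\<xi> b) *\<^sub>R b)"

lemma inner_re_vec:
  assumes "linear \<xi>"
  shows "re_vec \<xi> \<bullet> x = Re (\<xi> x)"
proof -
  have "\<xi> x = \<xi> (\<Sum>b\<in>Basis. (x \<bullet> b) *\<^sub>R b)" by (simp add: euclidean_representation)
  also have "\<dots> = (\<Sum>b\<in>Basis. (x \<bullet> b) *\<^sub>R \<xi> b)"
    by (simp only: linear_sum[OF assms] linear_cmul[OF assms])
  finally have "Re (\<xi> x) = (\<Sum>b\<in>Basis. (x \<bullet> b) * Re (\<xi> b))" by simp
  moreover have "re_vec \<xi> \<bullet> x = (\<Sum>b\<in>Basis. Re (\<xi> b) * (b \<bullet> x))" by (simp add: re_vec_def inner_sum_left)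
  ultimately show ?thesis by (simp add: inner_commute mult.commute)
qed

text \<open>Integrates the pointwise decomposition. The cone at v is the translate of
  \<open>polar_cone \<xi>\<close> by \<open>vh h v\<close>, whence the factor
  \<open>exp (\<xi> (vh h v))\<close>, the only dependence on h.\<close>

lemma integral_exp_signed:
  assumes h: "small h" and lin: "linear \<xi>" and ne: "\<And>v j. v \<in> verts \<Longrightarrow> j \<in> idx v \<Longrightarrow> Re (\<xi> (\<alpha> v j)) \<noteq> 0"
  shows "(LINT x|lborel. indicator (\<Delta>h h) x *\<^sub>R exp (\<xi> x)) =
    (\<Sum>v\<in>verts. exp (\<xi> (vh h v)) * of_real (cell_vol v) * (\<Prod>j\<in>idx v. - 1 / \<xi> (\<alpha> v j)))"
proof -
  let ?\<eta> = "re_vec \<xi>"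
  have \<eta>: "generic ?\<eta>" using ne by (auto simp: generic_def inner_re_vec[OF lin])
  let ?C = "\<lambda>v x. \<forall>j\<in>idx v. (if ?\<eta> \<bullet> \<alpha> v j < 0 then 0 \<le> sl j x + h j else sl j x + h j < 0)"
  let ?s = "\<lambda>v. (-1) ^ card (pos ?\<eta> v) :: real"
  have v1: "has_bochner_integral lborel (\<lambda>x. of_real (?s v) * ((if ?C v x then 1 else 0) *\<^sub>R exp (\<xi> x)))
    (exp (\<xi> (vh h v)) * of_real (cell_vol v) * (\<Prod>j\<in>idx v. - 1 / \<xi> (\<alpha> v j)))" if v: "v \<in> verts" for v
  proof -
    interpret D: dual_bases "idx v" "\<alpha> v" u by (rule dual_bases_vert[OF v])
    have "has_bochner_integral lborel (\<lambda>x. indicator (D.polar_cone \<xi>) (x - vh h v) *\<^sub>R exp (\<xi> (x - vh h v)))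
      (D.vol *\<^sub>R (\<Prod>j\<in>idx v. (if Re (\<xi> (\<alpha> v j)) < 0 then - 1 else 1) / \<xi> (\<alpha> v j)))"
      by (intro has_bochner_integral_translate D.has_bochner_integral_polar_cone lin ne v)
    then have "has_bochner_integral lborel (\<lambda>x. of_real (?s v) * exp (\<xi> (vh h v)) * (indicator (D.polar_cone \<xi>) (x - vh h v) *\<^sub>R exp (\<xi> (x - vh h v))))
      (of_real (?s v) * exp (\<xi> (vh h v)) * (D.vol *\<^sub>R (\<Prod>j\<in>idx v. (if Re (\<xi> (\<alpha> v j)) < 0 then - 1 else 1) / \<xi> (\<alpha> v j))))"
      by (rule has_bochner_integral_mult_right)
    moreover have "of_real (?s v) * exp (\<xi> (vh h v)) * (indicator (D.polar_cone \<xi>) (x - vh h v) *\<^sub>R exp (\<xi> (x - vh h v)))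
        = of_real (?s v) * ((if ?C v x then 1 else 0) *\<^sub>R exp (\<xi> x))" for x
    proof -
      have "u j \<bullet> (x - vh h v) = sl j x + h j" if "j \<in> idx v" for j
        using sl_diff[of j x "vh h v"] sl_vh[OF v that] by simp
      then have "indicator (D.polar_cone \<xi>) (x - vh h v) = (if ?C v x then 1 else 0 :: real)"
        by (simp add: D.polar_cone_def inner_re_vec[OF lin] indicator_def)
      moreover have "exp (\<xi> (vh h v)) * exp (\<xi> (x - vh h v)) = exp (\<xi> x)"
        by (simp add: exp_add[symmetric] linear_diff[OF lin])
      ultimately show ?thesis by auto
    qed
    moreover have "of_real (?s v) * exp (\<xi> (vh h v)) * (D.vol *\<^sub>R (\<Prod>j\<in>idx v. (if Re (\<xi> (\<alpha> v j)) < 0 then - 1 else 1) / \<xi> (\<alpha> v j)))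
       = exp (\<xi> (vh h v)) * of_real (cell_vol v) * (\<Prod>j\<in>idx v. - 1 / \<xi> (\<alpha> v j))"
    proof -
      have "(\<Prod>j\<in>idx v. (if Re (\<xi> (\<alpha> v j)) < 0 then - 1 else 1) / \<xi> (\<alpha> v j)) =
         (\<Prod>j\<in>idx v. (if Re (\<xi> (\<alpha> v j)) < 0 then 1 else - 1) * (- 1 / \<xi> (\<alpha> v j)))"
        by (intro prod.cong) auto
      moreover have "of_real (?s v) * (\<Prod>j\<in>idx v. (if Re (\<xi> (\<alpha> v j)) < 0 then 1 else - 1) * (- 1 / \<xi> (\<alpha> v j)))
         = (\<Prod>j\<in>idx v. - 1 / \<xi> (\<alpha> v j))"
        by (rule prod_sign) (use ne v in \<open>auto simp: inner_re_vec[OF lin]\<close>)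
      ultimately show ?thesis by (simp add: cell_vol_def scaleR_conv_of_real mult_ac)
    qed
    ultimately show ?thesis by simp
  qed
  have "has_bochner_integral lborel (\<lambda>x. \<Sum>v\<in>verts. of_real (?s v) * ((if ?C v x then 1 else 0) *\<^sub>R exp (\<xi> x)))
    (\<Sum>v\<in>verts. exp (\<xi> (vh h v)) * of_real (cell_vol v) * (\<Prod>j\<in>idx v. - 1 / \<xi> (\<alpha> v j)))"
    by (intro has_bochner_integral_sum v1)
  moreover have "(\<Sum>v\<in>verts. of_real (?s v) * ((if ?C v x then 1 else 0) *\<^sub>R exp (\<xi> x))) = indicator (\<Delta>h h) x *\<^sub>R exp (\<xi> x)" for x
  proof -
    have "(\<Sum>v\<in>verts. of_real (?s v) * ((if ?C v x then 1 else 0) *\<^sub>R exp (\<xi> x))) =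
       (\<Sum>v\<in>verts. if ?C v x then ?s v else 0) *\<^sub>R exp (\<xi> x)"
      unfolding scaleR_sum_left by (intro sum.cong refl) (auto simp: scaleR_conv_of_real)
    then show ?thesis by (simp only: polar_decomposition[OF h \<eta>])
  qed
  ultimately show ?thesis by (simp add: has_bochner_integral_integral_eq)
qed

text \<open>
  A perturbation in a generic real direction makes all real parts along the edges nonzero, so
  the two sides of Brion's formulas extend to the remaining exponents by continuity.
\<close>

definition pert :: "('a \<Rightarrow> complex) \<Rightarrow> 'a \<Rightarrow> real \<Rightarrow> 'a \<Rightarrow> complex" where
  "pert \<xi> \<theta> r x = \<xi> x + of_real r * of_real (\<theta> \<bullet> x)"

lemma Re_pert: "Re (pert \<xi> \<theta> r x) = Re (\<xi> x) + r * (\<theta> \<bullet> x)"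
  by (simp add: pert_def)

lemma linear_pert: "linear \<xi> \<Longrightarrow> linear (pert \<xi> \<theta> r)"
  by (rule linearI) (auto simp: pert_def linear_add linear_cmul inner_add_right algebra_simps scaleR_conv_of_real)

text \<open>The sequence is a tail of 1 / (n + 1), beginning where the perturbed real part is
  generic.\<close>

lemma perturbation:
  assumes lin: "linear \<xi>"
  obtains \<theta> r where "\<And>n :: nat. \<And>v j. v \<in> verts \<Longrightarrow> j \<in> idx v \<Longrightarrow> Re (pert \<xi> \<theta> (r n) (\<alpha> v j)) \<noteq> 0"
    "r \<longlonglongrightarrow> 0" "\<And>x. (\<lambda>n. pert \<xi> \<theta> (r n) x) \<longlonglongrightarrow> \<xi> x"
proof -
  obtain \<theta> where \<theta>: "generic \<theta>" using generic_exists by auto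
  have "filterlim (\<lambda>n. inverse (real (Suc n))) (at_right 0) sequentially"
    unfolding filterlim_at using LIMSEQ_inverse_real_of_nat by auto
  then have "eventually (\<lambda>n. generic (re_vec \<xi> + inverse (real (Suc n)) *\<^sub>R \<theta>)) sequentially"
    by (rule eventually_compose_filterlim[OF eventually_generic[OF \<theta>]])
  then obtain N where N: "\<And>n. n \<ge> N \<Longrightarrow> generic (re_vec \<xi> + inverse (real (Suc n)) *\<^sub>R \<theta>)"
    by (auto simp: eventually_sequentially)
  let ?r = "\<lambda>n. inverse (real (Suc (n + N)))"
  have r: "?r \<longlonglongrightarrow> 0" by (rule LIMSEQ_ignore_initial_segment[OF LIMSEQ_inverse_real_of_nat])
  show thesis
  proof (rule that[where r = ?r and \<theta> = \<theta>])
    fix n v j assume "v \<in> verts" "j \<in> idx v"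
    then have "(re_vec \<xi> + ?r n *\<^sub>R \<theta>) \<bullet> \<alpha> v j \<noteq> 0" using N[of "n + N"] by (auto simp: generic_def)
    then show "Re (pert \<xi> \<theta> (?r n) (\<alpha> v j)) \<noteq> 0"
      unfolding inner_add_left inner_re_vec[OF lin] inner_scaleR_left Re_pert .
  next
    fix x
    have "(\<lambda>n. \<xi> x + of_real (?r n) * of_real (\<theta> \<bullet> x)) \<longlonglongrightarrow> \<xi> x + of_real 0 * of_real (\<theta> \<bullet> x)"
      by (intro tendsto_intros r)
    then show "(\<lambda>n. pert \<xi> \<theta> (?r n) x) \<longlonglongrightarrow> \<xi> x" by (simp add: pert_def)
  qed (rule r)
qed

lemma compact_\<Delta>h: "small h \<Longrightarrow> compact (\<Delta>h h)"
  using bounded_\<Delta>h closed_\<Delta>h compact_eq_bounded_closed by blast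

lemma integral_exp:
  fixes \<xi> :: "'a \<Rightarrow> complex"
  assumes h: "small h" and lin: "linear \<xi>" and ne: "\<And>v j. v \<in> verts \<Longrightarrow> j \<in> idx v \<Longrightarrow> \<xi> (\<alpha> v j) \<noteq> 0"
  shows "(LINT x|lborel. indicator (\<Delta>h h) x *\<^sub>R exp (\<xi> x)) =
    (\<Sum>v\<in>verts. exp (\<xi> (vh h v)) * of_real (cell_vol v) * (\<Prod>j\<in>idx v. - 1 / \<xi> (\<alpha> v j)))"
proof -
  obtain \<theta> r where \<theta>: "\<And>n :: nat. \<And>v j. v \<in> verts \<Longrightarrow> j \<in> idx v \<Longrightarrow> Re (pert \<xi> \<theta> (r n) (\<alpha> v j)) \<noteq> 0"
    and r: "r \<longlonglongrightarrow> 0" and lim: "\<And>x. (\<lambda>n. pert \<xi> \<theta> (r n) x) \<longlonglongrightarrow> \<xi> x"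
    using perturbation[OF lin] by metis
  have "linear (\<lambda>x. complex_of_real (\<theta> \<bullet> x))"
    by (rule linearI) (auto simp: inner_add_right scaleR_conv_of_real)
  then have "(\<lambda>n. LINT x|lborel. indicator (\<Delta>h h) x *\<^sub>R exp (pert \<xi> \<theta> (r n) x)) \<longlonglongrightarrow> (LINT x|lborel. indicator (\<Delta>h h) x *\<^sub>R exp (\<xi> x))"
    unfolding pert_def by (intro integral_exp_perturb_tendsto compact_\<Delta>h h lin r)
  moreover have "(\<lambda>n. LINT x|lborel. indicator (\<Delta>h h) x *\<^sub>R exp (pert \<xi> \<theta> (r n) x)) \<longlonglongrightarrow>
    (\<Sum>v\<in>verts. exp (\<xi> (vh h v)) * of_real (cell_vol v) * (\<Prod>j\<in>idx v. - 1 / \<xi> (\<alpha> v j)))"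
  proof -
    have eq: "(LINT x|lborel. indicator (\<Delta>h h) x *\<^sub>R exp (pert \<xi> \<theta> (r n) x)) =
      (\<Sum>v\<in>verts. exp (pert \<xi> \<theta> (r n) (vh h v)) * of_real (cell_vol v) * (\<Prod>j\<in>idx v. - 1 / pert \<xi> \<theta> (r n) (\<alpha> v j)))" for n
      by (rule integral_exp_signed[OF h linear_pert[OF lin]]) (rule \<theta>)
    show ?thesis unfolding eq by (intro tendsto_intros lim ne)
  qed
  ultimately show ?thesis by (rule LIMSEQ_unique)
qed

section \<open>Brion's formula for the lattice sum\<close>

definition latpt :: "'a \<Rightarrow> (nat \<Rightarrow> int) \<Rightarrow> 'a" where
  "latpt v k = v + (\<Sum>j\<in>idx v. of_int (k j) *\<^sub>R \<alpha> v j)"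

text \<open>Every point of L in the cone is v plus an integer combination of the edge vectors, since
  \<open>u j\<close> and \<open>c j\<close> are integral; averaging
  \<open>e1 (y \<bullet> x)\<close> over \<open>reps v\<close> removes the combinations outside L.
  For each y there remains a product of geometric series.\<close>

lemma has_sum_cone:
  assumes lin: "linear \<xi>" and v: "v \<in> verts" and ne: "\<And>j. j \<in> idx v \<Longrightarrow> Re (\<xi> (\<alpha> v j)) \<noteq> 0"
  shows "((\<lambda>x. exp (\<xi> x)) has_sum
     (exp (\<xi> v) / of_nat (card (reps v)) * (\<Sum>y\<in>reps v. e1 (y \<bullet> v) *
       (\<Prod>j\<in>idx v. (if Re (\<xi> (\<alpha> v j)) < 0 then 1 else - 1) * (1 / (1 - e1 (y \<bullet> \<alpha> v j) * exp (\<xi> (\<alpha> v j))))))))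
    {x \<in> L. \<forall>j\<in>idx v. (if Re (\<xi> (\<alpha> v j)) < 0 then 0 \<le> sl j x else sl j x < 0)}"
    (is "(_ has_sum ?S) ?X")
proof -
  interpret D: dual_bases "idx v" "\<alpha> v" u by (rule dual_bases_vert[OF v])
  let ?K = "\<lambda>j. if Re (\<xi> (\<alpha> v j)) < 0 then {0..} else {..<0::int}"
  let ?q = "\<lambda>y j. e1 (y \<bullet> \<alpha> v j) * exp (\<xi> (\<alpha> v j))"
  have sl_latpt: "sl j (latpt v k) = of_int (k j)" if "j \<in> idx v" for j k
    using that D.inner_comb[OF that, of "\<lambda>j. of_int (k j)"] by (simp add: latpt_def sl_add idx_def)
  have geo: "((\<lambda>k. ?q y j powi k) has_sum ((if Re (\<xi> (\<alpha> v j)) < 0 then 1 else - 1) * (1 / (1 - ?q y j)))) (?K j)"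
    "(\<lambda>k. norm (?q y j powi k)) summable_on (?K j)" if j: "j \<in> idx v" for j y
    using ne[OF j] has_sum_powi_nonneg[of "?q y j"] has_sum_powi_neg[of "?q y j"]
    by (auto simp: norm_mult norm_exp_eq_Re)
  have prod: "((\<lambda>k. \<Prod>j\<in>idx v. ?q y j powi k j) has_sum
      (\<Prod>j\<in>idx v. (if Re (\<xi> (\<alpha> v j)) < 0 then 1 else - 1) * (1 / (1 - ?q y j)))) (PiE (idx v) ?K)" for y
    by (rule has_sum_prod_PiE) (use geo finite_idx in auto)
  have "((\<lambda>k. exp (\<xi> v) / of_nat (card (reps v)) * (\<Sum>y\<in>reps v. e1 (y \<bullet> v) * (\<Prod>j\<in>idx v. ?q y j powi k j))) has_sum ?S) (PiE (idx v) ?K)"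
    by (intro has_sum_cmult_right has_sum_sum_finite finite_reps v prod)
  moreover have "exp (\<xi> v) / of_nat (card (reps v)) * (\<Sum>y\<in>reps v. e1 (y \<bullet> v) * (\<Prod>j\<in>idx v. ?q y j powi k j))
     = (if latpt v k \<in> L then exp (\<xi> (latpt v k)) else 0)" for k
  proof -
    have "\<xi> (latpt v k) = \<xi> v + (\<Sum>j\<in>idx v. of_int (k j) * \<xi> (\<alpha> v j))"
      by (simp add: latpt_def linear_add[OF lin] linear_sum[OF lin] linear_cmul[OF lin] scaleR_conv_of_real)
    then have e: "exp (\<xi> (latpt v k)) = exp (\<xi> v) * (\<Prod>j\<in>idx v. exp (\<xi> (\<alpha> v j)) powi k j)"
      by (simp add: exp_add exp_sum finite_idx exp_power_int)
    have y: "e1 (y \<bullet> latpt v k) = e1 (y \<bullet> v) * (\<Prod>j\<in>idx v. e1 (y \<bullet> \<alpha> v j) powi k j)" for y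
      by (simp add: latpt_def inner_add_right inner_sum_right e1_add e1_sum e1_of_int_mult)
    have "exp (\<xi> v) * (e1 (y \<bullet> v) * (\<Prod>j\<in>idx v. ?q y j powi k j)) = exp (\<xi> (latpt v k)) * e1 (y \<bullet> latpt v k)" for y
      by (simp add: e y power_int_mult_distrib prod.distrib)
    then have "exp (\<xi> v) * (\<Sum>y\<in>reps v. e1 (y \<bullet> v) * (\<Prod>j\<in>idx v. ?q y j powi k j)) =
       exp (\<xi> (latpt v k)) * (\<Sum>y\<in>reps v. e1 (y \<bullet> latpt v k))"
      by (simp add: sum_distrib_left)
    moreover have "(\<Sum>y\<in>reps v. e1 (y \<bullet> latpt v k)) = (if latpt v k \<in> L then of_nat (card (reps v)) else 0)"
    proof (rule lattice_indicator_vert[OF v])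
      fix j assume j: "j \<in> idx v"
      \<comment> \<open>The average is the indicator of L only where the normals take integer
        values; this holds here because the \<open>c j\<close> are integers, even if v is not in
        L.\<close>
      then have "u j \<bullet> latpt v k = of_int (k j) - c j" using sl_latpt[OF j, of k] by (simp add: sl_def)
      then show "u j \<bullet> latpt v k \<in> \<int>" using c_int[of j] j by (auto simp: idx_def)
    qed
    ultimately show ?thesis using card_reps_pos[OF v] by (auto simp: field_simps)
  qed
  ultimately have "((\<lambda>k. if latpt v k \<in> L then exp (\<xi> (latpt v k)) else 0) has_sum ?S) (PiE (idx v) ?K)" by simp
  then have 1: "((\<lambda>k. exp (\<xi> (latpt v k))) has_sum ?S) {k \<in> PiE (idx v) ?K. latpt v k \<in> L}"
    by (rule has_sum_cong_neutral[THEN iffD1, rotated -1]) auto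
  have "bij_betw (latpt v) {k \<in> PiE (idx v) ?K. latpt v k \<in> L} ?X"
  proof (rule bij_betwI[where g = "\<lambda>x. \<lambda>j\<in>idx v. \<lfloor>sl j x\<rfloor>"])
    show "latpt v \<in> {k \<in> PiE (idx v) ?K. latpt v k \<in> L} \<rightarrow> ?X"
      using sl_latpt by (auto simp: PiE_iff split: if_splits)
    have int: "of_int \<lfloor>sl j x\<rfloor> = sl j x" if "x \<in> L" "j \<in> idx v" for x j
    proof -
      have "u j \<bullet> x \<in> \<int>" using u_dual[of j] that by (auto simp: idx_def dual_lattice_def)
      then have "sl j x \<in> \<int>" using c_int[of j] that by (auto simp: sl_def idx_def)
      then show ?thesis by simp
    qed
    have lx: "latpt v (\<lambda>j\<in>idx v. \<lfloor>sl j x\<rfloor>) = x" if "x \<in> L" for x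
    proof -
      have "latpt v (\<lambda>j\<in>idx v. \<lfloor>sl j x\<rfloor>) = v + (\<Sum>j\<in>idx v. sl j x *\<^sub>R \<alpha> v j)"
        unfolding latpt_def
        by (intro arg_cong2[where f = "(+)"] refl sum.cong) (simp only: restrict_apply' int[OF that])
      then show ?thesis by (simp add: expand_vert[OF v])
    qed
    then show "latpt v (\<lambda>j\<in>idx v. \<lfloor>sl j x\<rfloor>) = x" if "x \<in> ?X" for x using that by blast
    show "(\<lambda>x. \<lambda>j\<in>idx v. \<lfloor>sl j x\<rfloor>) \<in> ?X \<rightarrow> {k \<in> PiE (idx v) ?K. latpt v k \<in> L}"
      using lx by (auto simp: PiE_iff floor_less_zero split: if_splits)
    show "(\<lambda>j\<in>idx v. \<lfloor>sl j (latpt v k)\<rfloor>) = k" if "k \<in> {k \<in> PiE (idx v) ?K. latpt v k \<in> L}" for k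
      using that sl_latpt by (auto simp: PiE_iff extensional_def fun_eq_iff)
  qed
  from has_sum_reindex_bij_betw[OF this, THEN iffD1, OF 1] show ?thesis .
qed

lemma finite_\<Delta>_L: "finite (\<Delta> \<inter> L)"
  using LB.finite_lat_Int_bounded[of \<Delta>] compact_imp_bounded[OF compact_\<Delta>] by (simp add: LB_lat)

lemma lattice_sum_signed:
  assumes lin: "linear \<xi>" and ne: "\<And>v j. v \<in> verts \<Longrightarrow> j \<in> idx v \<Longrightarrow> Re (\<xi> (\<alpha> v j)) \<noteq> 0"
  shows "(\<Sum>x\<in>\<Delta> \<inter> L. exp (\<xi> x)) =
    (\<Sum>v\<in>verts. exp (\<xi> v) / of_nat (card (reps v)) * (\<Sum>y\<in>reps v. e1 (y \<bullet> v) *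
       (\<Prod>j\<in>idx v. 1 / (1 - e1 (y \<bullet> \<alpha> v j) * exp (\<xi> (\<alpha> v j))))))"
proof -
  let ?\<eta> = "re_vec \<xi>"
  have \<eta>: "generic ?\<eta>" using ne by (auto simp: generic_def inner_re_vec[OF lin])
  let ?C = "\<lambda>v x. \<forall>j\<in>idx v. (if ?\<eta> \<bullet> \<alpha> v j < 0 then 0 \<le> sl j x else sl j x < 0)"
  let ?s = "\<lambda>v. (-1) ^ card (pos ?\<eta> v) :: real"
  have v1: "((\<lambda>x. of_real (?s v) * (if ?C v x then exp (\<xi> x) else 0)) has_sum
     (exp (\<xi> v) / of_nat (card (reps v)) * (\<Sum>y\<in>reps v. e1 (y \<bullet> v) *
       (\<Prod>j\<in>idx v. 1 / (1 - e1 (y \<bullet> \<alpha> v j) * exp (\<xi> (\<alpha> v j))))))) L" if v: "v \<in> verts" for v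
  proof -
    have "((\<lambda>x. if ?C v x then exp (\<xi> x) else 0) has_sum
     (exp (\<xi> v) / of_nat (card (reps v)) * (\<Sum>y\<in>reps v. e1 (y \<bullet> v) *
       (\<Prod>j\<in>idx v. (if Re (\<xi> (\<alpha> v j)) < 0 then 1 else - 1) * (1 / (1 - e1 (y \<bullet> \<alpha> v j) * exp (\<xi> (\<alpha> v j)))))))) L"
      using has_sum_cone[OF lin v ne[OF v]]
      by (rule has_sum_cong_neutral[THEN iffD1, rotated -1]) (auto simp: inner_re_vec[OF lin])
    from has_sum_cmult_right[OF this, of "of_real (?s v)"] show ?thesis
    proof (rule back_subst[where P = "\<lambda>z. (_ has_sum z) L"])
      have p: "of_real (?s v) * (\<Prod>j\<in>idx v. (if Re (\<xi> (\<alpha> v j)) < 0 then 1 else - 1) * (1 / (1 - e1 (y \<bullet> \<alpha> v j) * exp (\<xi> (\<alpha> v j))))) =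
        (\<Prod>j\<in>idx v. 1 / (1 - e1 (y \<bullet> \<alpha> v j) * exp (\<xi> (\<alpha> v j))))" for y
        by (rule prod_sign) (use ne v in \<open>auto simp: inner_re_vec[OF lin]\<close>)
      have q: "of_real (?s v) * (E * (\<Sum>y\<in>reps v. e y * g y)) = E * (\<Sum>y\<in>reps v. e y * (of_real (?s v) * g y))"
        for E :: complex and e g by (simp add: sum_distrib_left mult_ac)
      show "of_real (?s v) * (exp (\<xi> v) / of_nat (card (reps v)) * (\<Sum>y\<in>reps v. e1 (y \<bullet> v) *
       (\<Prod>j\<in>idx v. (if Re (\<xi> (\<alpha> v j)) < 0 then 1 else - 1) * (1 / (1 - e1 (y \<bullet> \<alpha> v j) * exp (\<xi> (\<alpha> v j))))))) =
        exp (\<xi> v) / of_nat (card (reps v)) * (\<Sum>y\<in>reps v. e1 (y \<bullet> v) *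
       (\<Prod>j\<in>idx v. 1 / (1 - e1 (y \<bullet> \<alpha> v j) * exp (\<xi> (\<alpha> v j)))))"
        unfolding q p ..
    qed
  qed
  have "((\<lambda>x. \<Sum>v\<in>verts. of_real (?s v) * (if ?C v x then exp (\<xi> x) else 0)) has_sum
    (\<Sum>v\<in>verts. exp (\<xi> v) / of_nat (card (reps v)) * (\<Sum>y\<in>reps v. e1 (y \<bullet> v) *
       (\<Prod>j\<in>idx v. 1 / (1 - e1 (y \<bullet> \<alpha> v j) * exp (\<xi> (\<alpha> v j))))))) L" (is "(_ has_sum ?T) L")
    by (intro has_sum_sum_finite finite_verts v1)
  moreover have "(\<Sum>v\<in>verts. of_real (?s v) * (if ?C v x then exp (\<xi> x) else 0)) = indicator \<Delta> x *\<^sub>R exp (\<xi> x)" for x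
  proof -
    have "(\<Sum>v\<in>verts. of_real (?s v) * (if ?C v x then exp (\<xi> x) else 0)) =
       (\<Sum>v\<in>verts. if ?C v x then ?s v else 0) *\<^sub>R exp (\<xi> x)"
      unfolding scaleR_sum_left by (intro sum.cong refl) (auto simp: scaleR_conv_of_real)
    also have "(\<Sum>v\<in>verts. if ?C v x then ?s v else 0) = indicator (\<Delta>h (\<lambda>_. 0)) x"
      using polar_decomposition[OF small_0 \<eta>, of x] by (simp only: add_0_right)
    also have "\<Delta>h (\<lambda>_. 0) = \<Delta>" by (simp add: \<Delta>h_def halfsp)
    finally show ?thesis .
  qed
  ultimately have "((\<lambda>x. indicator \<Delta> x *\<^sub>R exp (\<xi> x)) has_sum ?T) L" by simp
  then have "((\<lambda>x. exp (\<xi> x)) has_sum ?T) (\<Delta> \<inter> L)"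
    by (rule has_sum_cong_neutral[THEN iffD1, rotated -1]) auto
  moreover have "((\<lambda>x. exp (\<xi> x)) has_sum (\<Sum>x\<in>\<Delta> \<inter> L. exp (\<xi> x))) (\<Delta> \<inter> L)"
    using finite_\<Delta>_L by simp
  ultimately show ?thesis using has_sum_unique by blast
qed

lemma lattice_sum:
  assumes lin: "linear \<xi>"
    and ne: "\<And>v j y. v \<in> verts \<Longrightarrow> j \<in> idx v \<Longrightarrow> y \<in> reps v \<Longrightarrow> e1 (y \<bullet> \<alpha> v j) * exp (\<xi> (\<alpha> v j)) \<noteq> 1"
  shows "(\<Sum>x\<in>\<Delta> \<inter> L. exp (\<xi> x)) =
    (\<Sum>v\<in>verts. exp (\<xi> v) / of_nat (card (reps v)) * (\<Sum>y\<in>reps v. e1 (y \<bullet> v) *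
       (\<Prod>j\<in>idx v. 1 / (1 - e1 (y \<bullet> \<alpha> v j) * exp (\<xi> (\<alpha> v j))))))" (is "_ = ?T")
proof -
  obtain \<theta> r where \<theta>: "\<And>n :: nat. \<And>v j. v \<in> verts \<Longrightarrow> j \<in> idx v \<Longrightarrow> Re (pert \<xi> \<theta> (r n) (\<alpha> v j)) \<noteq> 0"
    and r: "r \<longlonglongrightarrow> 0" and lim: "\<And>x. (\<lambda>n. pert \<xi> \<theta> (r n) x) \<longlonglongrightarrow> \<xi> x"
    using perturbation[OF lin] by metis
  have "(\<lambda>n. \<Sum>x\<in>\<Delta> \<inter> L. exp (pert \<xi> \<theta> (r n) x)) \<longlonglongrightarrow> (\<Sum>x\<in>\<Delta> \<inter> L. exp (\<xi> x))"
    by (intro tendsto_intros lim)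
  moreover have "(\<lambda>n. \<Sum>x\<in>\<Delta> \<inter> L. exp (pert \<xi> \<theta> (r n) x)) \<longlonglongrightarrow> ?T"
  proof -
    have eq: "(\<Sum>x\<in>\<Delta> \<inter> L. exp (pert \<xi> \<theta> (r n) x)) =
      (\<Sum>v\<in>verts. exp (pert \<xi> \<theta> (r n) v) / of_nat (card (reps v)) * (\<Sum>y\<in>reps v. e1 (y \<bullet> v) *
       (\<Prod>j\<in>idx v. 1 / (1 - e1 (y \<bullet> \<alpha> v j) * exp (pert \<xi> \<theta> (r n) (\<alpha> v j))))))" for n
      by (rule lattice_sum_signed[OF linear_pert[OF lin]]) (rule \<theta>)
    have nz: "of_nat (card (reps v)) \<noteq> (0::complex)" if "v \<in> verts" for v
      using card_reps_pos[OF that] by simp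
    have ne': "1 - e1 (y \<bullet> \<alpha> v j) * exp (\<xi> (\<alpha> v j)) \<noteq> 0" if "v \<in> verts" "j \<in> idx v" "y \<in> reps v" for v j y
      using ne[OF that] by simp
    show ?thesis unfolding eq by (intro tendsto_intros lim nz ne')
  qed
  ultimately show ?thesis by (rule LIMSEQ_unique)
qed

end

section \<open>Power series of several variables and the Todd function\<close>

lemma multi_indices_0: "multi_indices 0 k = (if k = 0 then {\<lambda>_. 0} else {})"
  by (auto simp: multi_indices_def)

lemma multi_indices_Suc_bij:
  "bij_betw (\<lambda>(l, m). m(Suc d := l)) (SIGMA l:{..k}. multi_indices d (k - l)) (multi_indices (Suc d) k)"
proof (rule bij_betwI[where g = "\<lambda>m. (m (Suc d), m(Suc d := 0))"])
  have s: "(\<Sum>i=1..d. (m(Suc d := l)) i) = (\<Sum>i=1..d. m i)" for m :: "nat \<Rightarrow> nat" and l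
    by (rule sum.cong) auto
  show "(\<lambda>(l, m). m(Suc d := l)) \<in> (SIGMA l:{..k}. multi_indices d (k - l)) \<rightarrow> multi_indices (Suc d) k"
    by (auto simp: multi_indices_def s simp del: fun_upd_apply) (auto simp: fun_upd_def)
  show "(\<lambda>m. (m (Suc d), m(Suc d := 0))) \<in> multi_indices (Suc d) k \<rightarrow> (SIGMA l:{..k}. multi_indices d (k - l))"
    by (auto simp: multi_indices_def s simp del: fun_upd_apply) (auto simp: fun_upd_def)
  show "(\<lambda>m. (m (Suc d), m(Suc d := 0))) ((\<lambda>(l, m). m(Suc d := l)) x) = x"
    if "x \<in> (SIGMA l:{..k}. multi_indices d (k - l))" for x
    using that by (auto simp: multi_indices_def fun_eq_iff)
  show "(\<lambda>(l, m). m(Suc d := l)) ((\<lambda>m. (m (Suc d), m(Suc d := 0))) m) = m"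
    if "m \<in> multi_indices (Suc d) k" for m by (auto simp: fun_eq_iff)
qed

lemma finite_multi_indices: "finite (multi_indices d k)"
proof (induction d arbitrary: k)
  case (Suc d)
  have "finite (SIGMA l:{..k}. multi_indices d (k - l))" using Suc by auto
  then show ?case using bij_betw_finite[OF multi_indices_Suc_bij] by blast
qed (simp add: multi_indices_0)

text \<open>Splitting off the last exponent produces a Cauchy product, the form needed for
  inductions on d.\<close>

lemma sum_multi_indices_Suc:
  fixes f :: "nat \<Rightarrow> nat \<Rightarrow> 'a::comm_ring_1"
  shows "(\<Sum>m\<in>multi_indices (Suc d) k. \<Prod>i=1..Suc d. f i (m i)) =
    (\<Sum>l\<le>k. f (Suc d) l * (\<Sum>m\<in>multi_indices d (k - l). \<Prod>i=1..d. f i (m i)))"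
proof -
  have "(\<Sum>m\<in>multi_indices (Suc d) k. \<Prod>i=1..Suc d. f i (m i)) =
    (\<Sum>x\<in>(SIGMA l:{..k}. multi_indices d (k - l)). \<Prod>i=1..Suc d. f i (((\<lambda>(l, m). m(Suc d := l)) x) i))"
    by (rule sum.reindex_bij_betw[OF multi_indices_Suc_bij, symmetric])
  also have "\<dots> = (\<Sum>(l, m)\<in>(SIGMA l:{..k}. multi_indices d (k - l)). f (Suc d) l * (\<Prod>i=1..d. f i (m i)))"
  proof (intro sum.cong refl)
    fix x assume "x \<in> (SIGMA l:{..k}. multi_indices d (k - l))"
    obtain l m where x: "x = (l, m)" by (cases x)
    have "(\<Prod>i=1..d. f i ((m(Suc d := l)) i)) = (\<Prod>i=1..d. f i (m i))" by (rule prod.cong) auto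
    then show "(\<Prod>i=1..Suc d. f i (((\<lambda>(l, m). m(Suc d := l)) x) i)) = (case x of (l, m) \<Rightarrow> f (Suc d) l * (\<Prod>i=1..d. f i (m i)))"
      by (simp add: x mult.commute)
  qed
  also have "\<dots> = (\<Sum>l\<le>k. \<Sum>m\<in>multi_indices d (k - l). f (Suc d) l * (\<Prod>i=1..d. f i (m i)))"
    by (rule sum.Sigma[symmetric]) (auto simp: finite_multi_indices)
  finally show ?thesis by (simp add: sum_distrib_left)
qed

lemma summable_multi_indices:
  fixes f :: "nat \<Rightarrow> nat \<Rightarrow> real"
  assumes "\<And>i. i \<in> {1..d} \<Longrightarrow> summable (f i)" "\<And>i n. 0 \<le> f i n"
  shows "summable (\<lambda>k. \<Sum>m\<in>multi_indices d k. \<Prod>i=1..d. f i (m i))"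
  using assms(1)
proof (induction d)
  case 0
  have "(\<lambda>k. \<Sum>m\<in>multi_indices 0 k. \<Prod>i=1..0. f i (m i)) = (\<lambda>k. if k = 0 then 1 else 0)"
    by (auto simp: multi_indices_0)
  then show ?case by simp
next
  case (Suc d)
  have "summable (\<lambda>k. \<Sum>l\<le>k. f (Suc d) l * (\<Sum>m\<in>multi_indices d (k - l). \<Prod>i=1..d. f i (m i)))"
  proof (rule summable_Cauchy_product)
    show "summable (\<lambda>k. norm (f (Suc d) k))" using Suc.prems assms(2) by simp
    have "0 \<le> (\<Sum>m\<in>multi_indices d k. \<Prod>i=1..d. f i (m i))" for k
      by (intro sum_nonneg prod_nonneg) (use assms(2) in auto)
    then show "summable (\<lambda>k. norm (\<Sum>m\<in>multi_indices d k. \<Prod>i=1..d. f i (m i)))"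
      using Suc by simp
  qed
  then show ?case by (simp only: sum_multi_indices_Suc)
qed

lemma norm_sum_multi_indices_le:
  fixes f :: "nat \<Rightarrow> nat \<Rightarrow> complex"
  assumes "\<And>i n. i \<in> {1..d} \<Longrightarrow> norm (f i n) \<le> g i n"
  shows "norm (\<Sum>m\<in>multi_indices d k. \<Prod>i=1..d. f i (m i)) \<le> (\<Sum>m\<in>multi_indices d k. \<Prod>i=1..d. g i (m i))"
  by (intro sum_norm_le) (auto simp: prod_norm[symmetric] intro!: prod_mono assms)

text \<open>Induction on d with Cauchy products: for absolutely convergent factors, the product
  series may be grouped by total degree.\<close>

lemma sums_multi_indices:
  fixes f :: "nat \<Rightarrow> nat \<Rightarrow> complex"
  assumes "\<And>i. i \<in> {1..d} \<Longrightarrow> summable (\<lambda>n. norm (f i n))" "\<And>i. i \<in> {1..d} \<Longrightarrow> f i sums s i"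
  shows "(\<lambda>k. \<Sum>m\<in>multi_indices d k. \<Prod>i=1..d. f i (m i)) sums (\<Prod>i=1..d. s i)"
  using assms
proof (induction d)
  case 0
  have "(\<lambda>k. \<Sum>m\<in>multi_indices 0 k. \<Prod>i=1..0. f i (m i)) = (\<lambda>k. if k = 0 then 1 else 0)"
    by (auto simp: multi_indices_0)
  then show ?case using sums_single[of 0 "\<lambda>_. 1::complex"] by simp
next
  case (Suc d)
  let ?S = "\<lambda>k. \<Sum>m\<in>multi_indices d k. \<Prod>i=1..d. f i (m i)"
  have S: "?S sums (\<Prod>i=1..d. s i)" using Suc by simp
  have "summable (\<lambda>k. \<Sum>m\<in>multi_indices d k. \<Prod>i=1..d. norm (f i (m i)))"
    using Suc.prems by (intro summable_multi_indices) auto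
  then have N: "summable (\<lambda>k. norm (?S k))"
    by (rule summable_comparison_test'[where N = 0])
      (simp only: real_norm_def abs_norm_cancel, intro norm_sum_multi_indices_le order_refl)
  have "(\<lambda>k. \<Sum>l\<le>k. f (Suc d) l * ?S (k - l)) sums ((\<Sum>k. f (Suc d) k) * (\<Sum>k. ?S k))"
    using Suc.prems N by (intro Cauchy_product_sums) auto
  moreover have "(\<Sum>k. f (Suc d) k) = s (Suc d)" "(\<Sum>k. ?S k) = (\<Prod>i=1..d. s i)"
    using Suc.prems S by (auto simp: sums_iff)
  ultimately show ?case by (simp only: sum_multi_indices_Suc) (simp add: mult.commute)
qed

section \<open>Iterated partial derivatives\<close>

definition polydisc :: "nat \<Rightarrow> real \<Rightarrow> (nat \<Rightarrow> 's::real_normed_vector) set" where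
  "polydisc d \<rho> = {S. \<forall>i\<in>{1..d}. norm (S i) < \<rho>}"

lemma polydisc_upd:
  assumes "S \<in> polydisc d \<rho>" "norm t < \<rho>"
  shows "S(i := t) \<in> polydisc d \<rho>"
  using assms by (auto simp: polydisc_def)

text \<open>The other factors are constants for the variable i. The formula for g on the polydisc
  suffices because \<open>deriv\<close> depends only on values near the point.\<close>

lemma partial_deriv_product:
  assumes i: "i \<in> {1..d}" and \<rho>: "\<rho> > 0"
    and g: "\<And>S. S \<in> polydisc d \<rho> \<Longrightarrow> g S = (\<Sum>k\<in>K. C k * (\<Prod>l=1..d. \<psi> k l (S l)))"
    and hol: "\<And>k. k \<in> K \<Longrightarrow> \<psi> k i holomorphic_on ball 0 \<rho>"
    and S: "S \<in> polydisc d \<rho>"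
  shows "(partial_deriv deriv i ^^ n) g S =
     (\<Sum>k\<in>K. C k * (\<Prod>l=1..d. (if l = i then (deriv ^^ n) (\<psi> k i) else \<psi> k l) (S l)))"
  using S
proof (induction n arbitrary: S)
  case 0
  have "(if l = i then (deriv ^^ 0) (\<psi> k i) else \<psi> k l) (S l) = \<psi> k l (S l)" for k l by simp
  then show ?case by (simp only: g[OF 0] funpow_0)
next
  case (Suc n)
  let ?r = "\<lambda>k. \<Prod>l\<in>{1..d} - {i}. \<psi> k l (S l)"
  let ?\<chi> = "\<lambda>k. (deriv ^^ n) (\<psi> k i)"
  have split: "(\<Prod>l=1..d. (if l = i then \<phi> else \<psi> k l) ((S(i := t)) l)) = \<phi> t * ?r k" for \<phi> t k
  proof -
    have "(\<Prod>l=1..d. (if l = i then \<phi> else \<psi> k l) ((S(i := t)) l)) =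
      (if i = i then \<phi> else \<psi> k i) ((S(i := t)) i) * (\<Prod>l\<in>{1..d} - {i}. (if l = i then \<phi> else \<psi> k l) ((S(i := t)) l))"
      using i by (intro prod.remove) auto
    also have "(\<Prod>l\<in>{1..d} - {i}. (if l = i then \<phi> else \<psi> k l) ((S(i := t)) l)) = ?r k"
      by (intro prod.cong) auto
    finally show ?thesis by simp
  qed
  have Si: "norm (S i) < \<rho>" using Suc.prems i by (auto simp: polydisc_def)
  have ev: "eventually (\<lambda>t. (partial_deriv deriv i ^^ n) g (S(i := t)) = (\<Sum>k\<in>K. C k * (?\<chi> k t * ?r k))) (nhds (S i))"
  proof -
    have "eventually (\<lambda>t. t \<in> ball 0 \<rho>) (nhds (S i))"
      using Si by (intro eventually_nhds_in_open) auto
    then show ?thesis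
    proof eventually_elim
      case (elim t)
      then have "S(i := t) \<in> polydisc d \<rho>" by (intro polydisc_upd Suc.prems) auto
      from Suc.IH[OF this] show ?case by (simp only: split)
    qed
  qed
  have "((\<lambda>t. \<Sum>k\<in>K. C k * (?\<chi> k t * ?r k)) has_field_derivative (\<Sum>k\<in>K. C k * (deriv (?\<chi> k) (S i) * ?r k))) (at (S i))"
  proof (intro DERIV_sum DERIV_cmult DERIV_cmult_right)
    fix k assume "k \<in> K"
    then have "?\<chi> k holomorphic_on ball 0 \<rho>" by (intro holomorphic_higher_deriv hol) auto
    then show "(?\<chi> k has_field_derivative deriv (?\<chi> k) (S i)) (at (S i))"
      using Si by (intro holomorphic_derivI[of _ "ball 0 \<rho>"]) auto
  qed
  then have "deriv (\<lambda>t. \<Sum>k\<in>K. C k * (?\<chi> k t * ?r k)) (S i) = (\<Sum>k\<in>K. C k * (deriv (?\<chi> k) (S i) * ?r k))"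
    by (rule DERIV_imp_deriv)
  then have "(partial_deriv deriv i ^^ Suc n) g S = (\<Sum>k\<in>K. C k * (deriv (?\<chi> k) (S i) * ?r k))"
    using deriv_cong_ev[OF ev refl] by (simp add: partial_deriv_def)
  also have "\<dots> = (\<Sum>k\<in>K. C k * (\<Prod>l=1..d. (if l = i then (deriv ^^ Suc n) (\<psi> k i) else \<psi> k l) (S l)))"
    using split[of "(deriv ^^ Suc n) (\<psi> k i)" k "S i" for k] by (simp add: fun_upd_idem)
  finally show ?case .
qed

text \<open>One variable after another; in the proof the exponent
  \<open>if l \<le> e then m l else 0\<close> records which variables have been treated.\<close>

lemma multi_deriv_product:
  assumes \<rho>: "\<rho> > 0"
    and hol: "\<And>k l. k \<in> K \<Longrightarrow> l \<in> {1..d} \<Longrightarrow> \<phi> k l holomorphic_on ball 0 \<rho>"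
    and g: "\<And>S. S \<in> polydisc d \<rho> \<Longrightarrow> g S = (\<Sum>k\<in>K. C k * (\<Prod>l=1..d. \<phi> k l (S l)))"
    and S: "S \<in> polydisc d \<rho>"
  shows "multi_deriv deriv d m g S = (\<Sum>k\<in>K. C k * (\<Prod>l=1..d. (deriv ^^ m l) (\<phi> k l) (S l)))"
proof -
  have "fold (\<lambda>i. partial_deriv deriv i ^^ m i) [1..<Suc e] g S =
    (\<Sum>k\<in>K. C k * (\<Prod>l=1..d. (deriv ^^ (if l \<le> e then m l else 0)) (\<phi> k l) (S l)))"
    if "e \<le> d" "S \<in> polydisc d \<rho>" for e S
    using that
  proof (induction e arbitrary: S)
    case 0
    then show ?case using g by simp
  next
    case (Suc e)
    let ?G = "fold (\<lambda>i. partial_deriv deriv i ^^ m i) [1..<Suc e] g"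
    let ?\<psi> = "\<lambda>k l. (deriv ^^ (if l \<le> e then m l else 0)) (\<phi> k l)"
    have "fold (\<lambda>i. partial_deriv deriv i ^^ m i) [1..<Suc (Suc e)] g S = (partial_deriv deriv (Suc e) ^^ m (Suc e)) ?G S"
      by simp
    also have "\<dots> = (\<Sum>k\<in>K. C k * (\<Prod>l=1..d. (if l = Suc e then (deriv ^^ m (Suc e)) (?\<psi> k (Suc e)) else ?\<psi> k l) (S l)))"
    proof (rule partial_deriv_product[OF _ \<rho>])
      show "?G S' = (\<Sum>k\<in>K. C k * (\<Prod>l=1..d. ?\<psi> k l (S' l)))" if "S' \<in> polydisc d \<rho>" for S'
        using Suc.IH[OF _ that] Suc.prems by simp
    qed (use Suc.prems hol in auto)
    also have "\<dots> = (\<Sum>k\<in>K. C k * (\<Prod>l=1..d. (deriv ^^ (if l \<le> Suc e then m l else 0)) (\<phi> k l) (S l)))"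
      by (intro sum.cong refl arg_cong2[where f = "(*)"] prod.cong) (auto simp: le_Suc_eq)
    finally show ?case .
  qed
  moreover have "(\<Prod>l=1..d. (deriv ^^ (if l \<le> d then m l else 0)) (\<phi> k l) (S l)) = (\<Prod>l=1..d. (deriv ^^ m l) (\<phi> k l) (S l))" for k
    by (intro prod.cong) auto
  ultimately show ?thesis
    unfolding multi_deriv_def using S by (simp only: order_refl)
qed

text \<open>Leibniz rule: each differentiation brings down a factor \<open>b q i t\<close> under the
  integral.\<close>

lemma partial_deriv_exp_integral:
  fixes W :: "'q \<Rightarrow> real \<Rightarrow> complex" and b :: "'q \<Rightarrow> nat \<Rightarrow> real \<Rightarrow> complex"
  assumes i: "i \<in> {1..d}" and \<rho>: "\<rho> > 0"
    and W: "\<And>q. q \<in> Q \<Longrightarrow> continuous_on {0..1} (W q)"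
    and b: "\<And>q l. q \<in> Q \<Longrightarrow> continuous_on {0..1} (b q l)"
    and g: "\<And>h. h \<in> polydisc d \<rho> \<Longrightarrow> g h = (\<Sum>q\<in>Q. integral {0..1} (\<lambda>t. W q t * exp (\<Sum>l=1..d. b q l t * of_real (h l))))"
    and h: "h \<in> polydisc d \<rho>"
  shows "(partial_deriv (\<lambda>f t. vector_derivative f (at t)) i ^^ n) g h =
     (\<Sum>q\<in>Q. integral {0..1} (\<lambda>t. W q t * b q i t ^ n * exp (\<Sum>l=1..d. b q l t * of_real (h l))))"
  using h
proof (induction n arbitrary: h)
  case 0
  then show ?case using g by simp
next
  case (Suc n)
  let ?E = "\<lambda>q x t. exp (\<Sum>l=1..d. b q l t * of_real ((h(i := x)) l))"
  have lin: "(\<Sum>l=1..d. b q l t * of_real ((h(i := x)) l)) = b q i t * of_real x + (\<Sum>l\<in>{1..d} - {i}. b q l t * of_real (h l))" for q x t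
  proof -
    have "(\<Sum>l=1..d. b q l t * of_real ((h(i := x)) l)) = b q i t * of_real ((h(i := x)) i) + (\<Sum>l\<in>{1..d} - {i}. b q l t * of_real ((h(i := x)) l))"
      using i by (intro sum.remove) auto
    also have "(\<Sum>l\<in>{1..d} - {i}. b q l t * of_real ((h(i := x)) l)) = (\<Sum>l\<in>{1..d} - {i}. b q l t * of_real (h l))"
      by (intro sum.cong) auto
    finally show ?thesis by simp
  qed
  have bq: "continuous_on (UNIV \<times> {0..1}) (\<lambda>p. b q l (snd p))" if "q \<in> Q" for q l
    by (rule continuous_on_compose2[OF b[OF that]]) (auto intro: continuous_intros)
  have Wq: "continuous_on (UNIV \<times> {0..1}) (\<lambda>p. W q (snd p))" if "q \<in> Q" for q
    by (rule continuous_on_compose2[OF W[OF that]]) (auto intro: continuous_intros)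
  have der: "((\<lambda>x. integral {0..1} (\<lambda>t. W q t * b q i t ^ n * ?E q x t)) has_vector_derivative
     integral {0..1} (\<lambda>t. W q t * b q i t ^ Suc n * ?E q (h i) t)) (at (h i))" if q: "q \<in> Q" for q
  proof -
    have "((\<lambda>x. integral (cbox 0 1) (\<lambda>t. W q t * b q i t ^ n * ?E q x t)) has_vector_derivative
     integral (cbox 0 1) (\<lambda>t. W q t * b q i t ^ Suc n * ?E q (h i) t)) (at (h i) within UNIV)"
    proof (rule leibniz_rule_vector_derivative)
      fix x t :: real
      show "((\<lambda>x. W q t * b q i t ^ n * ?E q x t) has_vector_derivative W q t * b q i t ^ Suc n * ?E q x t) (at x within UNIV)"
        unfolding lin by (rule has_vector_derivative_real_field) (auto intro!: derivative_eq_intros)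
    next
      fix x
      have "continuous_on {0..1} (\<lambda>t. W q t * b q i t ^ n * ?E q x t)"
        by (intro continuous_intros W b q)
      then show "(\<lambda>t. W q t * b q i t ^ n * ?E q x t) integrable_on cbox 0 1"
        by (simp add: integrable_continuous_interval)
    next
      show "continuous_on (UNIV \<times> cbox 0 1) (\<lambda>(x, t). W q t * b q i t ^ Suc n * ?E q x t)"
        unfolding lin case_prod_beta cbox_interval
        by (intro continuous_intros bq Wq q)
    qed auto
    then show ?thesis by simp
  qed
  have sum: "((\<lambda>x. \<Sum>q\<in>Q. integral {0..1} (\<lambda>t. W q t * b q i t ^ n * ?E q x t)) has_vector_derivative
     (\<Sum>q\<in>Q. integral {0..1} (\<lambda>t. W q t * b q i t ^ Suc n * ?E q (h i) t))) (at (h i))"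
    by (intro has_vector_derivative_sum der)
  have hi: "norm (h i) < \<rho>" using Suc.prems i by (auto simp: polydisc_def)
  have "((\<lambda>x. (partial_deriv (\<lambda>f t. vector_derivative f (at t)) i ^^ n) g (h(i := x))) has_vector_derivative
     (\<Sum>q\<in>Q. integral {0..1} (\<lambda>t. W q t * b q i t ^ Suc n * ?E q (h i) t))) (at (h i))"
  proof (rule has_vector_derivative_transform_within_open[OF sum, of "ball 0 \<rho>"])
    fix x :: real assume "x \<in> ball 0 \<rho>"
    then have "h(i := x) \<in> polydisc d \<rho>" by (intro polydisc_upd Suc.prems) auto
    from Suc.IH[OF this] show "(\<Sum>q\<in>Q. integral {0..1} (\<lambda>t. W q t * b q i t ^ n * ?E q x t)) =
      (partial_deriv (\<lambda>f t. vector_derivative f (at t)) i ^^ n) g (h(i := x))" ..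
  qed (use hi in auto)
  then have "vector_derivative (\<lambda>x. (partial_deriv (\<lambda>f t. vector_derivative f (at t)) i ^^ n) g (h(i := x))) (at (h i)) =
     (\<Sum>q\<in>Q. integral {0..1} (\<lambda>t. W q t * b q i t ^ Suc n * ?E q (h i) t))"
    by (rule vector_derivative_at)
  moreover have "(partial_deriv (\<lambda>f t. vector_derivative f (at t)) i ^^ Suc n) g h =
    vector_derivative (\<lambda>x. (partial_deriv (\<lambda>f t. vector_derivative f (at t)) i ^^ n) g (h(i := x))) (at (h i))"
    by (subst funpow.simps(2), subst o_apply, subst partial_deriv_def, rule refl)
  ultimately show ?case by (simp only: fun_upd_triv)
qed

lemma multi_deriv_exp_integral:
  fixes W :: "'q \<Rightarrow> real \<Rightarrow> complex" and b :: "'q \<Rightarrow> nat \<Rightarrow> real \<Rightarrow> complex"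
  assumes \<rho>: "\<rho> > 0"
    and W: "\<And>q. q \<in> Q \<Longrightarrow> continuous_on {0..1} (W q)"
    and b: "\<And>q l. q \<in> Q \<Longrightarrow> continuous_on {0..1} (b q l)"
    and g: "\<And>h. h \<in> polydisc d \<rho> \<Longrightarrow> g h = (\<Sum>q\<in>Q. integral {0..1} (\<lambda>t. W q t * exp (\<Sum>l=1..d. b q l t * of_real (h l))))"
    and h: "h \<in> polydisc d \<rho>"
  shows "multi_deriv (\<lambda>f t. vector_derivative f (at t)) d m g h =
     (\<Sum>q\<in>Q. integral {0..1} (\<lambda>t. W q t * (\<Prod>l=1..d. b q l t ^ m l) * exp (\<Sum>l=1..d. b q l t * of_real (h l))))"
proof -
  let ?D = "partial_deriv (\<lambda>f t. vector_derivative f (at t))"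
  have "fold (\<lambda>i. ?D i ^^ m i) [1..<Suc e] g h =
     (\<Sum>q\<in>Q. integral {0..1} (\<lambda>t. W q t * (\<Prod>l=1..e. b q l t ^ m l) * exp (\<Sum>l=1..d. b q l t * of_real (h l))))"
    if "e \<le> d" "h \<in> polydisc d \<rho>" for e h
    using that
  proof (induction e arbitrary: h)
    case 0
    then show ?case using g by simp
  next
    case (Suc e)
    let ?G = "fold (\<lambda>i. ?D i ^^ m i) [1..<Suc e] g"
    have "fold (\<lambda>i. ?D i ^^ m i) [1..<Suc (Suc e)] g h = (?D (Suc e) ^^ m (Suc e)) ?G h"
      by simp
    also have "\<dots> = (\<Sum>q\<in>Q. integral {0..1} (\<lambda>t. W q t * (\<Prod>l=1..e. b q l t ^ m l) * b q (Suc e) t ^ m (Suc e) * exp (\<Sum>l=1..d. b q l t * of_real (h l))))"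
    proof (rule partial_deriv_exp_integral[OF _ \<rho>])
      show "?G h' = (\<Sum>q\<in>Q. integral {0..1} (\<lambda>t. W q t * (\<Prod>l=1..e. b q l t ^ m l) * exp (\<Sum>l=1..d. b q l t * of_real (h' l))))"
        if "h' \<in> polydisc d \<rho>" for h'
        using Suc.IH[OF _ that] Suc.prems by simp
    qed (use Suc.prems in \<open>auto intro!: continuous_intros W b\<close>)
    finally show ?case by (simp add: mult.assoc)
  qed
  from this[of d h] h show ?thesis unfolding multi_deriv_def by simp
qed

text \<open>For x in [0, 1) the distance from 0 to the nearest pole of
  \<open>todd_factor (e1 x)\<close>: the zeros of the denominator are s = 2 pi i (x - n) for
  integers n, and for x = 0 the one at the origin is cancelled by the numerator.\<close>

definition radius :: "real \<Rightarrow> real" where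
  "radius x = 2 * pi * (if x = 0 then 1 else min x (1 - x))"

lemma radius_pos: "0 \<le> x \<Longrightarrow> x < 1 \<Longrightarrow> radius x > 0"
  by (auto simp: radius_def)

lemma todd_pole:
  assumes x: "0 \<le> x" "x < 1" and s: "norm s < radius x" and eq: "e1 x * exp (- s) = 1"
  shows "x = 0 \<and> s = 0"
proof -
  have "exp (2 * of_real pi * \<i> * of_real x - s) = 1"
    using eq by (simp add: e1_def exp_diff exp_minus divide_inverse)
  then obtain n :: int where n: "Re (2 * of_real pi * \<i> * of_real x - s) = 0"
     "Im (2 * of_real pi * \<i> * of_real x - s) = of_int (2 * n) * pi"
    unfolding exp_eq_1 by blast
  have "Re s = 0" "Im s = 2 * pi * (x - of_int n)" using n by (auto simp: algebra_simps)
  then have ns: "norm s = 2 * pi * \<bar>x - of_int n\<bar>" by (simp add: cmod_eq_Im abs_mult)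
  show ?thesis
  proof (cases "x = of_int n")
    case True
    then have "n = 0" using x by linarith
    then show ?thesis using True ns by simp
  next
    case False
    have "(if x = 0 then 1 else min x (1 - x)) \<le> \<bar>x - of_int n\<bar>"
    proof (cases "n \<le> 0")
      case True
      then have "of_int n \<le> (0::real)" "n = 0 \<or> of_int n \<le> (-1::real)" by linarith+
      then show ?thesis using False x by auto
    next
      case False
      then have "(1::real) \<le> of_int n" by linarith
      then show ?thesis using x by auto
    qed
    then have "radius x \<le> norm s" unfolding ns radius_def by (intro mult_left_mono) auto
    then show ?thesis using s by simp
  qed
qed

text \<open>Away from the origin the denominator has no zero in the disc. For x = 0 the singularity
  at the origin is removable, since the quotient of 1 - exp (- s) by s tends to 1.\<close>

lemma todd_factor_holomorphic:
  assumes x: "0 \<le> x" "x < 1"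
  shows "todd_factor (e1 x) holomorphic_on ball 0 (radius x)"
proof (cases "x = 0")
  case False
  then have "e1 x \<noteq> 1" using x e1_eq_1_iff[of x] by (auto elim!: Ints_cases)
  then have eq: "todd_factor (e1 x) = (\<lambda>s. s / (1 - e1 x * exp (- s)))" by (auto simp: todd_factor_def)
  show ?thesis unfolding eq
    by (intro holomorphic_intros) (use todd_pole[OF x] False in auto)
next
  case True
  have eq: "todd_factor 1 s = s / (1 - exp (- s))" if "s \<noteq> 0" for s using that by (simp add: todd_factor_def)
  have "todd_factor 1 holomorphic_on ball 0 (radius 0)"
  proof (rule no_isolated_singularity'[where K = "{0}"])
    have "(\<lambda>s. s / (1 - exp (- s))) holomorphic_on ball 0 (radius 0) - {0}"
      by (intro holomorphic_intros) (use todd_pole[of 0] in auto)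
    then show "todd_factor 1 holomorphic_on ball 0 (radius 0) - {0}"
      by (rule holomorphic_transform) (auto simp: eq)
    fix z :: complex assume "z \<in> {0}"
    have "((\<lambda>s::complex. 1 - exp (- s)) has_field_derivative 1) (at 0)"
      by (auto intro!: derivative_eq_intros)
    then have "((\<lambda>s::complex. (1 - exp (- s)) / s) \<longlongrightarrow> 1) (at 0)"
      by (simp add: has_field_derivative_iff)
    then have "((\<lambda>s::complex. inverse ((1 - exp (- s)) / s)) \<longlongrightarrow> inverse 1) (at 0)"
      by (rule tendsto_inverse) simp
    then have "((\<lambda>s::complex. s / (1 - exp (- s))) \<longlongrightarrow> 1) (at 0)" by simp
    then have "(todd_factor 1 \<longlongrightarrow> 1) (at 0)"
      by (rule Lim_transform_eventually) (auto simp: eventually_at_filter eq)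
    then show "(todd_factor 1 \<longlongrightarrow> todd_factor 1 z) (at z within ball 0 (radius 0))"
      using \<open>z \<in> {0}\<close> by (auto simp: todd_factor_def intro: tendsto_within_subset)
  qed auto
  then show ?thesis using True by simp
qed

definition todd_coeff :: "complex \<Rightarrow> nat \<Rightarrow> complex" where
  "todd_coeff a n = (deriv ^^ n) (todd_factor a) 0 / fact n"

text \<open>This vanishing eliminates the faces that do not contain a given vertex.\<close>

lemma todd_coeff_0: "a \<noteq> 1 \<Longrightarrow> todd_coeff a 0 = 0"
  by (simp add: todd_coeff_def todd_factor_def)

lemma
  assumes x: "0 \<le> x" "x < 1" and s: "norm s < radius x"
  shows todd_coeff_sums: "(\<lambda>n. todd_coeff (e1 x) n * s ^ n) sums todd_factor (e1 x) s"
    and todd_coeff_summable: "summable (\<lambda>n. norm (todd_coeff (e1 x) n) * norm s ^ n)"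
proof -
  have sums: "(\<lambda>n. todd_coeff (e1 x) n * s ^ n) sums todd_factor (e1 x) s" if "norm s < radius x" for s
    using holomorphic_power_series[OF todd_factor_holomorphic[OF x], of s] that
    by (simp add: todd_coeff_def)
  then show "(\<lambda>n. todd_coeff (e1 x) n * s ^ n) sums todd_factor (e1 x) s" using s .
  \<comment> \<open>Convergence at a point farther out gives absolute convergence at s.\<close>
  obtain r where r: "norm s < r" "r < radius x" using s dense by blast
  have r0: "0 < r" using r(1) by (meson le_less_trans norm_ge_zero)
  have "summable (\<lambda>n. todd_coeff (e1 x) n * of_real r ^ n)"
    using sums[of "of_real r"] r r0 by (auto simp: sums_iff)
  then have "summable (\<lambda>n. norm (todd_coeff (e1 x) n * s ^ n))"
    by (rule powser_insidea) (use r r0 in auto)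
  then show "summable (\<lambda>n. norm (todd_coeff (e1 x) n) * norm s ^ n)"
    by (simp add: norm_mult norm_power)
qed

lemma todd_factor_holomorphic_near_0:
  "\<exists>\<rho>>0. todd_factor a holomorphic_on ball 0 \<rho>"
proof (cases "a = 1")
  case True
  then show ?thesis using todd_factor_holomorphic[of 0] radius_pos[of 0] by auto
next
  case False
  have "open {s. 1 - a * exp (- s) \<noteq> 0}"
    by (intro open_Collect_neq continuous_intros)
  then obtain \<rho> where \<rho>: "\<rho> > 0" "ball 0 \<rho> \<subseteq> {s. 1 - a * exp (- s) \<noteq> 0}"
    by (rule openE[of _ 0]) (use False in auto)
  have eq: "todd_factor a = (\<lambda>s. s / (1 - a * exp (- s)))" using False by (auto simp: todd_factor_def)
  have "todd_factor a holomorphic_on ball 0 \<rho>"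
    unfolding eq by (intro holomorphic_intros) (use \<rho> in auto)
  then show ?thesis using \<rho> by auto
qed

text \<open>The finitely many factors are holomorphic on one common disc, where mixed derivatives
  split into derivatives of the factors.\<close>

lemma taylor_coeff_product:
  fixes a :: "'k \<Rightarrow> nat \<Rightarrow> complex"
  assumes K: "finite K"
  shows "taylor_coeff d (\<lambda>S. \<Sum>k\<in>K. C k * (\<Prod>l=1..d. todd_factor (a k l) (S l))) m =
    (\<Sum>k\<in>K. C k * (\<Prod>l=1..d. todd_coeff (a k l) (m l)))"
proof -
  obtain r where r: "\<And>a. r a > 0" "\<And>a. todd_factor a holomorphic_on ball 0 (r a)"
    using todd_factor_holomorphic_near_0 by metis
  let ?R = "insert 1 ((\<lambda>(k, l). r (a k l)) ` (K \<times> {1..d}))"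
  define \<rho> where "\<rho> = Min ?R"
  have fin: "finite ?R" using K by auto
  have \<rho>: "\<rho> > 0" unfolding \<rho>_def using fin r by (subst Min_gr_iff) auto
  have hol: "todd_factor (a k l) holomorphic_on ball 0 \<rho>" if "k \<in> K" "l \<in> {1..d}" for k l
  proof -
    have "\<rho> \<le> r (a k l)" unfolding \<rho>_def using that fin by (intro Min_le) auto
    then show ?thesis by (intro holomorphic_on_subset[OF r(2)]) auto
  qed
  have "multi_deriv deriv d m (\<lambda>S. \<Sum>k\<in>K. C k * (\<Prod>l=1..d. todd_factor (a k l) (S l))) (\<lambda>_. 0) =
    (\<Sum>k\<in>K. C k * (\<Prod>l=1..d. (deriv ^^ m l) (todd_factor (a k l)) 0))"
    by (rule multi_deriv_product[OF \<rho>]) (use hol \<rho> in \<open>auto simp: polydisc_def\<close>)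
  then have "taylor_coeff d (\<lambda>S. \<Sum>k\<in>K. C k * (\<Prod>l=1..d. todd_factor (a k l) (S l))) m =
    (\<Sum>k\<in>K. C k * (\<Prod>l=1..d. (deriv ^^ m l) (todd_factor (a k l)) 0)) / (\<Prod>l=1..d. fact (m l))"
    by (simp add: taylor_coeff_def)
  also have "\<dots> = (\<Sum>k\<in>K. C k * (\<Prod>l=1..d. todd_coeff (a k l) (m l)))"
    by (simp add: sum_divide_distrib todd_coeff_def prod_dividef)
  finally show ?thesis .
qed

section \<open>Groups of the faces\<close>

context simple_rational_polytope
begin

abbreviation "fidx F \<equiv> face_index d u c F"

lemma mem_fidx: "i \<in> fidx F \<longleftrightarrow> i \<in> {1..d} \<and> (\<forall>x\<in>F. sl i x = 0)"
  by (simp add: face_index_def sl_def)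

lemma fidx_vert: "fidx {v} = idx v"
  by (auto simp: mem_fidx idx_def)

lemma face_eq_cut:
  assumes F: "F \<in> faces \<Delta>"
  shows "F = face_cut (fidx F)"
proof -
  have "F face_of \<Delta>" "F \<noteq> {}" using F by (auto simp: faces_def)
  then obtain x0 where x0: "x0 \<in> rel_interior F"
    using rel_interior_eq_empty face_of_imp_convex by blast
  have eq: "F = face_cut (idx x0)" by (rule face_rel_interior[OF \<open>F face_of \<Delta>\<close> x0])
  moreover have "x0 \<in> F" using x0 rel_interior_subset by auto
  then have "fidx F \<subseteq> idx x0" by (auto simp: mem_fidx idx_def)
  moreover have "idx x0 \<subseteq> fidx F" using eq by (auto simp: mem_fidx idx_def face_cut_def)
  ultimately show ?thesis by auto
qed

lemma mem_face_iff: "F \<in> faces \<Delta> \<Longrightarrow> x \<in> F \<longleftrightarrow> x \<in> face_cut (fidx F)"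
  by (rule eqset_imp_iff) (rule face_eq_cut)

lemma face_eqI: "E \<in> faces \<Delta> \<Longrightarrow> F \<in> faces \<Delta> \<Longrightarrow> fidx E = fidx F \<Longrightarrow> E = F"
  using mem_face_iff[of E] mem_face_iff[of F] by (intro set_eqI) (simp only:)

lemma face_vertex: "F \<in> faces \<Delta> \<Longrightarrow> \<exists>v\<in>verts. v \<in> F"
  using vert_on_face[of F] by (auto simp: faces_def)

lemma vert_mem_face_iff:
  assumes "F \<in> faces \<Delta>" "v \<in> verts"
  shows "v \<in> F \<longleftrightarrow> fidx F \<subseteq> idx v"
proof
  show "v \<in> F \<Longrightarrow> fidx F \<subseteq> idx v" by (auto simp: mem_fidx idx_def)
  assume "fidx F \<subseteq> idx v"
  then have "v \<in> face_cut (fidx F)" using vert_in_\<Delta>[OF assms(2)] by (auto simp: face_cut_def idx_def)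
  then show "v \<in> F" using mem_face_iff[OF assms(1)] by blast
qed

text \<open>Simplicity: any subset of the constraints active at v is the index set of a face. A
  small step from v along all edges with index outside A leaves precisely the active hyperplanes
  outside A.\<close>

lemma vertex_cut:
  assumes v: "v \<in> verts" and A: "A \<subseteq> idx v"
  shows "face_cut A \<in> faces \<Delta>" "fidx (face_cut A) = A"
proof -
  interpret D: dual_bases "idx v" "\<alpha> v" u by (rule dual_bases_vert[OF v])
  have Ad: "A \<subseteq> {1..d}" using A by (auto simp: idx_def)
  have vA: "v \<in> face_cut A" using A vert_in_\<Delta>[OF v] by (auto simp: face_cut_def idx_def)
  then show "face_cut A \<in> faces \<Delta>" using face_cut_face_of[OF Ad] by (auto simp: faces_def)
  let ?t = "\<Sum>i\<in>idx v. (if i \<in> A then 0 else 1) *\<^sub>R \<alpha> v i"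
  have ut: "u i \<bullet> ?t = (if i \<in> A then 0 else 1)" if "i \<in> idx v" for i by (rule D.inner_comb[OF that])
  obtain r where r: "0 < r" "v + r *\<^sub>R ?t \<in> \<Delta>" "\<And>i. i \<in> {1..d} - idx v \<Longrightarrow> 0 < sl i (v + r *\<^sub>R ?t)"
    by (rule local_stepE[OF vert_in_\<Delta>[OF v], of ?t]) (auto simp: ut)
  have w: "v + r *\<^sub>R ?t \<in> face_cut A"
    using r A by (auto simp: face_cut_def sl_add ut subset_iff) (auto simp: idx_def)
  have "i \<in> A" if i: "i \<in> fidx (face_cut A)" for i
  proof (rule ccontr)
    assume "i \<notin> A"
    have i0: "sl i (v + r *\<^sub>R ?t) = 0" and id: "i \<in> {1..d}" using i w by (auto simp: mem_fidx)
    show False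
    proof (cases "i \<in> idx v")
      case True
      then have "sl i (v + r *\<^sub>R ?t) = r" using ut[OF True] \<open>i \<notin> A\<close> by (simp add: sl_add idx_def)
      then show False using i0 r by simp
    next
      case False
      then show False using r(3)[of i] i0 id by auto
    qed
  qed
  moreover have "A \<subseteq> fidx (face_cut A)" using Ad by (auto simp: mem_fidx face_cut_def)
  ultimately show "fidx (face_cut A) = A" by auto
qed

lemma dual_bases_vert': "v \<in> verts \<Longrightarrow> dual_bases (idx v) u (\<alpha> v)"
  using dual_bases.swap[OF dual_bases_vert] .

text \<open>F contains small steps from v along the edges with index outside \<open>fidx F\<close>,
  and these edge vectors span its tangent space.\<close>

lemma face_conormal_eq:
  assumes F: "F \<in> faces \<Delta>" and v: "v \<in> verts" "v \<in> F"
  shows "face_conormal F = {y. \<forall>j\<in>idx v - fidx F. y \<bullet> \<alpha> v j = 0}"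
proof (intro equalityI subsetI)
  interpret D: dual_bases "idx v" "\<alpha> v" u by (rule dual_bases_vert[OF v(1)])
  have sub: "fidx F \<subseteq> idx v" using vert_mem_face_iff[OF F v(1)] v by simp
  {
    fix y assume y: "y \<in> face_conormal F"
    show "y \<in> {y. \<forall>j\<in>idx v - fidx F. y \<bullet> \<alpha> v j = 0}"
    proof safe
      fix j assume j: "j \<in> idx v" "j \<notin> fidx F"
      obtain r where r: "0 < r" "v + r *\<^sub>R \<alpha> v j \<in> \<Delta>"
        by (rule local_stepE[OF vert_in_\<Delta>[OF v(1)], of "\<alpha> v j"]) (use D.dual j in auto)
      have "sl i (v + r *\<^sub>R \<alpha> v j) = 0" if "i \<in> fidx F" for i
      proof -
        have "i \<in> idx v" "i \<noteq> j" using that sub j by auto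
        then show ?thesis using D.dual[of i j] j by (simp add: sl_add idx_def)
      qed
      then have "v + r *\<^sub>R \<alpha> v j \<in> face_cut (fidx F)" using r by (simp add: face_cut_def)
      then have "v + r *\<^sub>R \<alpha> v j \<in> F" using mem_face_iff[OF F] by blast
      moreover have "\<alpha> v j = (1 / r) *\<^sub>R ((v + r *\<^sub>R \<alpha> v j) - v)" using r by simp
      ultimately have "\<alpha> v j \<in> face_tangent F" using v unfolding face_tangent_def by blast
      then show "y \<bullet> \<alpha> v j = 0" using y by (simp add: face_conormal_def)
    qed
  next
    fix y assume y: "y \<in> {y. \<forall>j\<in>idx v - fidx F. y \<bullet> \<alpha> v j = 0}"
    show "y \<in> face_conormal F"
      unfolding face_conormal_def
    proof (intro CollectI ballI)
      fix t assume "t \<in> face_tangent F"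
      then obtain r x x' where t: "t = r *\<^sub>R (x - x')" "x \<in> F" "x' \<in> F" by (auto simp: face_tangent_def)
      have "u k \<bullet> t * (y \<bullet> \<alpha> v k) = 0" if k: "k \<in> idx v" for k
      proof (cases "k \<in> fidx F")
        case True
        then have "sl k x = 0" "sl k x' = 0" using t by (auto simp: mem_fidx)
        then have "u k \<bullet> (x - x') = 0" using sl_diff[of k x x'] by simp
        then show ?thesis by (simp add: t)
      qed (use y k in auto)
      then show "y \<bullet> t = 0" by (subst D.inner_expand) (simp add: sum.neutral)
    qed
  }
qed

text \<open>
  For a face \<open>F\<close> through \<open>v\<close>, the set \<open>flat v (fidx F)\<close> represents \<open>\<Gamma>\<^sub>F\<^sup>\<flat>\<close>: an element lies in the
  group of a larger face iff one of its coefficients is an integer.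
\<close>

definition supp :: "'a \<Rightarrow> 'a \<Rightarrow> nat set" where "supp v y = {j \<in> idx v. y \<bullet> \<alpha> v j \<noteq> 0}"

definition flat :: "'a \<Rightarrow> nat set \<Rightarrow> 'a set" where "flat v A = {y \<in> reps v. supp v y = A}"

lemma int_span_normals:
  assumes v: "v \<in> verts" and A: "A \<subseteq> idx v"
  shows "int_span (u ` A) = {z. (\<forall>j\<in>idx v. z \<bullet> \<alpha> v j \<in> \<int>) \<and> (\<forall>j\<in>idx v - A. z \<bullet> \<alpha> v j = 0)}"
proof -
  interpret D': dual_bases "idx v" u "\<alpha> v" by (rule dual_bases_vert'[OF v])
  show ?thesis using D'.int_span_subset_eq[OF A] by (simp add: D'.lat_def inner_commute conj_commute)
qed

lemma normal_coset_eq_iff: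
  assumes v: "v \<in> verts" and A: "A \<subseteq> idx v"
  shows "normal_coset u A y = normal_coset u A y' \<longleftrightarrow> y - y' \<in> int_span (u ` A)"
proof -
  note S = int_span_normals[OF v A]
  have 0: "0 \<in> int_span (u ` A)" by (simp add: S)
  have add: "z + w \<in> int_span (u ` A)" if "z \<in> int_span (u ` A)" "w \<in> int_span (u ` A)" for z w
    using that by (auto simp: S inner_add_left)
  have neg: "- z \<in> int_span (u ` A)" if "z \<in> int_span (u ` A)" for z
    using that by (auto simp: S)
  have mem: "x \<in> normal_coset u A y \<longleftrightarrow> x - y \<in> int_span (u ` A)" for x y
  proof
    assume "x - y \<in> int_span (u ` A)"
    then show "x \<in> normal_coset u A y" unfolding normal_coset_def by (intro CollectI exI[of _ "x - y"]) simp
  qed (auto simp: normal_coset_def)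
  show ?thesis
  proof
    assume eq: "normal_coset u A y = normal_coset u A y'"
    have "y \<in> normal_coset u A y" using 0 by (simp add: mem)
    then show "y - y' \<in> int_span (u ` A)" using eq by (simp add: mem)
  next
    assume yy: "y - y' \<in> int_span (u ` A)"
    show "normal_coset u A y = normal_coset u A y'"
    proof (intro set_eqI)
      fix x
      show "x \<in> normal_coset u A y \<longleftrightarrow> x \<in> normal_coset u A y'"
        unfolding mem using add[of "x - y" "y - y'"] add[of "x - y'" "- (y - y')"] yy neg[OF yy] by auto
    qed
  qed
qed

text \<open>The smaller span lies in the larger one, so the union of cosets is a single coset with
  the same representative.\<close>

lemma group_embed_coset:
  assumes v: "v \<in> verts" and F: "F \<in> faces \<Delta>" "v \<in> F" and A: "A \<subseteq> fidx F"
  shows "group_embed d u c F (normal_coset u A y) = normal_coset u (fidx F) y"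
proof -
  have sub: "fidx F \<subseteq> idx v" using vert_mem_face_iff[OF F(1) v] F by simp
  have AI: "A \<subseteq> idx v" using A sub by auto
  have mono: "int_span (u ` A) \<subseteq> int_span (u ` fidx F)"
    using A by (auto simp: int_span_normals[OF v AI] int_span_normals[OF v sub])
  have "normal_coset u (fidx F) y' = normal_coset u (fidx F) y" if "y' \<in> normal_coset u A y" for y'
  proof -
    have "y' - y \<in> int_span (u ` A)" using that by (auto simp: normal_coset_def)
    then show ?thesis using mono by (auto simp: normal_coset_eq_iff[OF v sub])
  qed
  moreover have "y \<in> normal_coset u A y"
    unfolding normal_coset_def by (intro CollectI exI[of _ 0]) (simp add: int_span_normals[OF v AI])
  ultimately show ?thesis unfolding group_embed_def by blast
qed

lemma u_inner_\<alpha>: "v \<in> verts \<Longrightarrow> i \<in> idx v \<Longrightarrow> j \<in> idx v \<Longrightarrow> u i \<bullet> \<alpha> v j = (if i = j then 1 else 0)"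
  using dual_bases.dual[OF dual_bases_vert] .

lemma dual_lattice_diff: "x \<in> dual_lattice L \<Longrightarrow> y \<in> dual_lattice L \<Longrightarrow> x - y \<in> dual_lattice L"
  by (auto simp: dual_lattice_def inner_diff_left)

lemma int_span_dual_lattice:
  assumes "A \<subseteq> {1..d}" "z \<in> int_span (u ` A)"
  shows "z \<in> dual_lattice L"
proof -
  obtain T k where z: "z = (\<Sum>b\<in>T. of_int (k b) *\<^sub>R b)" and T: "T \<subseteq> u ` A"
    using assms(2) unfolding int_span_def by blast
  have "b \<bullet> x \<in> \<int>" if "b \<in> T" "x \<in> L" for b x
    using that T assms(1) u_dual by (force simp: dual_lattice_def)
  then show ?thesis by (auto simp: z dual_lattice_def inner_sum_left intro!: Ints_sum Ints_mult)
qed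

text \<open>Passing to fractional parts of the coefficients changes y by an integer combination of
  normals with index in A.\<close>

lemma reduce_rep:
  assumes v: "v \<in> verts" and A: "A \<subseteq> idx v" and y: "y \<in> dual_lattice L" "\<forall>j\<in>idx v - A. y \<bullet> \<alpha> v j = 0"
  obtains y0 where "y0 \<in> reps v" "supp v y0 \<subseteq> A" "y - y0 \<in> int_span (u ` A)"
proof -
  interpret D': dual_bases "idx v" u "\<alpha> v" by (rule dual_bases_vert'[OF v])
  have fr: "D'.red y \<bullet> \<alpha> v j = frac (y \<bullet> \<alpha> v j)" if "j \<in> idx v" for j
    using D'.inner_red[OF that, of y] by (simp add: inner_commute)
  have span: "y - D'.red y \<in> int_span (u ` A)"
    unfolding int_span_normals[OF v A] using y(2) by (auto simp: inner_diff_left fr) (auto simp: frac_def)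
  have "y - (y - D'.red y) \<in> dual_lattice L"
    using A by (intro dual_lattice_diff y int_span_dual_lattice[OF _ span]) (auto simp: idx_def)
  then have "D'.red y \<in> reps v" by (auto simp: reps_def fr frac_ge_0 frac_lt_1)
  moreover have "supp v (D'.red y) \<subseteq> A" using y(2) by (auto simp: supp_def fr) (metis DiffI frac_eq_0_iff Ints_0)
  ultimately show thesis using span that by blast
qed

lemma reps_frac: "v \<in> verts \<Longrightarrow> y \<in> reps v \<Longrightarrow> j \<in> supp v y \<Longrightarrow> y \<bullet> \<alpha> v j \<notin> \<int>"
  by (auto simp: reps_def supp_def elim!: Ints_cases)

lemma face_group_eq:
  assumes F: "F \<in> faces \<Delta>" and v: "v \<in> verts" "v \<in> F"
  shows "face_group L d u c F = normal_coset u (fidx F) ` {y \<in> reps v. supp v y \<subseteq> fidx F}"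
proof -
  have sub: "fidx F \<subseteq> idx v" using vert_mem_face_iff[OF F v(1)] v by simp
  show ?thesis
  proof (intro equalityI subsetI)
    fix \<gamma> assume "\<gamma> \<in> face_group L d u c F"
    then obtain y where y: "\<gamma> = normal_coset u (fidx F) y" "y \<in> dual_lattice L" "\<forall>j\<in>idx v - fidx F. y \<bullet> \<alpha> v j = 0"
      by (auto simp: face_group_def face_conormal_eq[OF F v])
    obtain y0 where "y0 \<in> reps v" "supp v y0 \<subseteq> fidx F" "y - y0 \<in> int_span (u ` fidx F)"
      by (rule reduce_rep[OF v(1) sub y(2,3)])
    then show "\<gamma> \<in> normal_coset u (fidx F) ` {y \<in> reps v. supp v y \<subseteq> fidx F}"
      using normal_coset_eq_iff[OF v(1) sub, of y y0] y(1) by auto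
  next
    fix \<gamma> assume "\<gamma> \<in> normal_coset u (fidx F) ` {y \<in> reps v. supp v y \<subseteq> fidx F}"
    then obtain y where y: "\<gamma> = normal_coset u (fidx F) y" "y \<in> reps v" "supp v y \<subseteq> fidx F" by auto
    then have "y \<in> face_conormal F \<inter> dual_lattice L"
      by (auto simp: face_conormal_eq[OF F v] reps_def supp_def)
    then show "\<gamma> \<in> face_group L d u c F" using y(1) by (auto simp: face_group_def)
  qed
qed

text \<open>A strictly larger face E lacks some index j of F, so representatives of its group have
  coefficient 0 at j; modulo the normals of F this leaves an integer, which a coefficient in the
  support is not. Conversely, an element whose support A is smaller than \<open>fidx F\<close> comes
  from the face \<open>face_cut A\<close>.\<close>

lemma face_group_flat_eq:
  assumes F: "F \<in> faces \<Delta>" and v: "v \<in> verts" "v \<in> F"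
  shows "face_group_flat L \<Delta> d u c F = normal_coset u (fidx F) ` flat v (fidx F)"
proof -
  have sub: "fidx F \<subseteq> idx v" using vert_mem_face_iff[OF F v(1)] v by simp
  have upper: "fidx E \<subset> fidx F \<and> v \<in> E" if E: "E \<in> faces \<Delta>" "F \<subset> E" for E
  proof -
    have "fidx E \<subseteq> fidx F" unfolding subset_iff mem_fidx using E(2) by blast
    moreover have "fidx E \<noteq> fidx F" using face_eqI[OF E(1) F] E(2) by blast
    ultimately show ?thesis using E v by auto
  qed
  have "normal_coset u (fidx F) y \<in> (\<Union>E\<in>{E \<in> faces \<Delta>. F \<subset> E}. group_embed d u c F ` face_group L d u c E)
     \<longleftrightarrow> supp v y \<noteq> fidx F" if y: "y \<in> reps v" "supp v y \<subseteq> fidx F" for y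
  proof
    assume "normal_coset u (fidx F) y \<in> (\<Union>E\<in>{E \<in> faces \<Delta>. F \<subset> E}. group_embed d u c F ` face_group L d u c E)"
    then obtain E \<delta> where E: "E \<in> faces \<Delta>" "F \<subset> E" and \<delta>: "\<delta> \<in> face_group L d u c E"
      and eq: "normal_coset u (fidx F) y = group_embed d u c F \<delta>" by auto
    have vE: "v \<in> E" and EF: "fidx E \<subset> fidx F" using upper[OF E] by auto
    obtain y' where y': "y' \<in> reps v" "supp v y' \<subseteq> fidx E" "\<delta> = normal_coset u (fidx E) y'"
      using \<delta> unfolding face_group_eq[OF E(1) v(1) vE] by auto
    have "normal_coset u (fidx F) y = normal_coset u (fidx F) y'"
      using eq group_embed_coset[OF v(1) F v(2), of "fidx E" y'] EF y'(3) by auto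
    then have yy: "y - y' \<in> int_span (u ` fidx F)" by (simp add: normal_coset_eq_iff[OF v(1) sub])
    obtain j where j: "j \<in> fidx F" "j \<notin> fidx E" using EF by auto
    show "supp v y \<noteq> fidx F"
    proof
      assume "supp v y = fidx F"
      then have "y \<bullet> \<alpha> v j \<notin> \<int>" using reps_frac[OF v(1) y(1)] j by auto
      moreover have "y' \<bullet> \<alpha> v j = 0" using y'(2) j sub by (auto simp: supp_def)
      moreover have "(y - y') \<bullet> \<alpha> v j \<in> \<int>" using yy j sub by (auto simp: int_span_normals[OF v(1) sub])
      ultimately show False by (simp add: inner_diff_left)
    qed
  next
    assume ne: "supp v y \<noteq> fidx F"
    let ?E = "face_cut (supp v y)"
    have sE: "supp v y \<subseteq> idx v" by (auto simp: supp_def)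
    have E: "?E \<in> faces \<Delta>" "fidx ?E = supp v y" using vertex_cut[OF v(1) sE] .
    have "F \<subseteq> ?E"
    proof
      fix x assume "x \<in> F"
      then have "x \<in> face_cut (fidx F)" using mem_face_iff[OF F] by blast
      then show "x \<in> ?E" using y(2) by (auto simp: face_cut_def)
    qed
    moreover have "F \<noteq> ?E" using E(2) ne by auto
    ultimately have FE: "F \<subset> ?E" by auto
    have vE: "v \<in> ?E" using v FE by auto
    have "normal_coset u (fidx ?E) y \<in> face_group L d u c ?E"
      unfolding face_group_eq[OF E(1) v(1) vE] using y E(2) by auto
    moreover have "group_embed d u c F (normal_coset u (fidx ?E) y) = normal_coset u (fidx F) y"
      using group_embed_coset[OF v(1) F v(2), of "fidx ?E" y] E(2) y(2) by simp
    ultimately show "normal_coset u (fidx F) y \<in> (\<Union>E\<in>{E \<in> faces \<Delta>. F \<subset> E}. group_embed d u c F ` face_group L d u c E)"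
      using E(1) FE by (intro UN_I[of ?E]) (auto intro: rev_image_eqI)
  qed
  then show ?thesis
    unfolding face_group_flat_def face_group_eq[OF F v] flat_def by auto
qed

text \<open>All elements of \<open>reps v\<close> lie in one half-open cell, so congruent ones
  coincide.\<close>

lemma inj_on_flat:
  assumes F: "F \<in> faces \<Delta>" and v: "v \<in> verts" "v \<in> F"
  shows "inj_on (normal_coset u (fidx F)) (flat v (fidx F))"
proof (rule inj_onI)
  have sub: "fidx F \<subseteq> idx v" using vert_mem_face_iff[OF F v(1)] v by simp
  interpret D': dual_bases "idx v" u "\<alpha> v" by (rule dual_bases_vert'[OF v(1)])
  fix y y' assume y: "y \<in> flat v (fidx F)" "y' \<in> flat v (fidx F)" "normal_coset u (fidx F) y = normal_coset u (fidx F) y'"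
  then have "y - y' \<in> int_span (u ` fidx F)" by (simp add: normal_coset_eq_iff[OF v(1) sub])
  then have "y - y' \<in> D'.lat" by (auto simp: int_span_normals[OF v(1) sub] D'.lat_def inner_commute)
  then show "y = y'" by (rule D'.cell_eqI[rotated 2]) (use y in \<open>auto simp: flat_def reps_def D'.cell_def inner_commute\<close>)
qed

text \<open>Independence of the three choices: another member of the coset differs by an integer
  combination of normals, another dual vector has the same pairings with the normals of F, and any x
  in F has \<open>u k \<bullet> x = - c k\<close>, an integer.\<close>

lemma
  assumes F: "F \<in> faces \<Delta>" and v: "v \<in> verts" "v \<in> F" and y: "y \<in> flat v (fidx F)"
  shows group_char_flat: "\<And>j. j \<in> fidx F \<Longrightarrow> group_char u (fidx F) (normal_coset u (fidx F) y) j = e1 (y \<bullet> \<alpha> v j)"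
    and face_char_flat: "face_char F (normal_coset u (fidx F) y) = e1 (y \<bullet> v)"
proof -
  have sub: "fidx F \<subseteq> idx v" using vert_mem_face_iff[OF F v(1)] v by simp
  interpret D': dual_bases "idx v" u "\<alpha> v" by (rule dual_bases_vert'[OF v(1)])
  let ?\<gamma> = "normal_coset u (fidx F) y"
  define z where "z = (SOME z. z \<in> ?\<gamma>) - y"
  have "\<exists>z. z \<in> ?\<gamma>"
    unfolding normal_coset_def by (intro exI[of _ y] CollectI exI[of _ 0]) (simp add: int_span_normals[OF v(1) sub])
  then have "(SOME z. z \<in> ?\<gamma>) \<in> ?\<gamma>" by (rule someI_ex)
  then have z: "z \<in> int_span (u ` fidx F)" unfolding z_def by (auto simp: normal_coset_def)
  have some: "(SOME z. z \<in> ?\<gamma>) = y + z" by (simp add: z_def)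
  have int: "z \<bullet> \<alpha> v k \<in> \<int>" if "k \<in> idx v" for k
    using z that by (auto simp: int_span_normals[OF v(1) sub])
  have zz: "z \<bullet> \<alpha> v k = 0" if "k \<in> idx v - fidx F" for k
    using z that by (auto simp: int_span_normals[OF v(1) sub])
  have yz: "y \<bullet> \<alpha> v k = 0" if "k \<in> idx v - fidx F" for k
    using y that by (auto simp: flat_def supp_def)
  have expand: "w \<bullet> x = (\<Sum>k\<in>fidx F. (w \<bullet> \<alpha> v k) * (u k \<bullet> x))" if "\<And>k. k \<in> idx v - fidx F \<Longrightarrow> w \<bullet> \<alpha> v k = 0" for w x
  proof -
    have "w \<bullet> x = x \<bullet> w" by (rule inner_commute)
    also have "\<dots> = (\<Sum>k\<in>idx v. (\<alpha> v k \<bullet> w) * (x \<bullet> u k))" by (rule D'.inner_expand)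
    also have "\<dots> = (\<Sum>k\<in>idx v. (w \<bullet> \<alpha> v k) * (u k \<bullet> x))" by (simp add: inner_commute)
    also have "\<dots> = (\<Sum>k\<in>fidx F. (w \<bullet> \<alpha> v k) * (u k \<bullet> x))"
      using that sub by (intro sum.mono_neutral_right) (auto simp: finite_idx)
    finally show ?thesis .
  qed
  show "group_char u (fidx F) ?\<gamma> j = e1 (y \<bullet> \<alpha> v j)" if j: "j \<in> fidx F" for j
  proof -
    let ?\<beta> = "dual_vec u (fidx F) j"
    have \<beta>: "\<forall>k\<in>fidx F. u k \<bullet> ?\<beta> = (if k = j then 1 else 0)"
      unfolding dual_vec_def
    proof (rule someI[of _ "\<alpha> v j"], rule ballI)
      fix k assume "k \<in> fidx F"
      then show "u k \<bullet> \<alpha> v j = (if k = j then 1 else 0)"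
        using j sub by (intro u_inner_\<alpha>[OF v(1)]) auto
    qed
    have fin: "finite (fidx F)" using sub finite_idx finite_subset by blast
    have *: "w \<bullet> ?\<beta> = w \<bullet> \<alpha> v j" if w: "\<And>k. k \<in> idx v - fidx F \<Longrightarrow> w \<bullet> \<alpha> v k = 0" for w
    proof -
      have "w \<bullet> ?\<beta> = (\<Sum>k\<in>fidx F. (w \<bullet> \<alpha> v k) * (u k \<bullet> ?\<beta>))" by (rule expand[OF w])
      also have "\<dots> = (\<Sum>k\<in>fidx F. if k = j then w \<bullet> \<alpha> v k else 0)"
        using \<beta> by (intro sum.cong) auto
      also have "\<dots> = w \<bullet> \<alpha> v j" using fin j by simp
      finally show ?thesis .
    qed
    have "group_char u (fidx F) ?\<gamma> j = e1 ((y + z) \<bullet> ?\<beta>)" by (simp add: group_char_def e1_def some)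
    also have "(y + z) \<bullet> ?\<beta> = y \<bullet> \<alpha> v j + z \<bullet> \<alpha> v j"
      using *[OF yz] *[OF zz] by (simp add: inner_add_left)
    also have "e1 \<dots> = e1 (y \<bullet> \<alpha> v j)" using int[of j] j sub by (intro e1_cong) auto
    finally show ?thesis .
  qed
  show "face_char F ?\<gamma> = e1 (y \<bullet> v)"
  proof -
    let ?x = "SOME x. x \<in> F"
    have x: "?x \<in> F" using v by (intro someI) auto
    have ux: "u k \<bullet> ?x = - c k" "u k \<bullet> v = - c k" if "k \<in> fidx F" for k
    proof -
      have "sl k ?x = 0" "sl k v = 0" using that x v unfolding mem_fidx by blast+
      then show "u k \<bullet> ?x = - c k" "u k \<bullet> v = - c k" by (simp_all add: sl_def)
    qed
    have "y \<bullet> ?x = (\<Sum>k\<in>fidx F. (y \<bullet> \<alpha> v k) * (u k \<bullet> ?x))" by (rule expand[OF yz])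
    also have "\<dots> = (\<Sum>k\<in>fidx F. (y \<bullet> \<alpha> v k) * (u k \<bullet> v))" by (intro sum.cong) (simp_all only: ux)
    also have "\<dots> = y \<bullet> v" by (rule expand[OF yz, symmetric])
    finally have "y \<bullet> ?x = y \<bullet> v" .
    moreover have "(\<Sum>k\<in>fidx F. (z \<bullet> \<alpha> v k) * (u k \<bullet> ?x)) \<in> \<int>"
    proof (intro Ints_sum Ints_mult)
      fix k assume k: "k \<in> fidx F"
      then show "z \<bullet> \<alpha> v k \<in> \<int>" using int sub by blast
      show "u k \<bullet> ?x \<in> \<int>" using ux(1)[OF k] c_int[of k] k unfolding mem_fidx by simp
    qed
    then have "z \<bullet> ?x \<in> \<int>" using expand[OF zz, of ?x] by (simp only:)
    ultimately have "(y + z) \<bullet> ?x - y \<bullet> v \<in> \<int>" by (simp add: inner_add_left)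
    then have "e1 ((y + z) \<bullet> ?x) = e1 (y \<bullet> v)" by (rule e1_cong)
    then show ?thesis by (simp add: face_char_def e1_def some)
  qed
qed

lemma finite_faces: "finite (faces \<Delta>)"
proof (rule finite_subset)
  show "faces \<Delta> \<subseteq> face_cut ` Pow {1..d}"
  proof
    fix F assume "F \<in> faces \<Delta>"
    then show "F \<in> face_cut ` Pow {1..d}"
      by (intro image_eqI[of _ _ "fidx F"] face_eq_cut) (auto simp: mem_fidx)
  qed
qed simp

text \<open>The coefficients of y, extended by 0 so that \<open>e1 (chi v y i) = 1\<close> at the
  inactive indices; the two products in \<open>Todd\<close> then merge into one over all
  variables.\<close>

definition chi :: "'a \<Rightarrow> 'a \<Rightarrow> nat \<Rightarrow> real" where
  "chi v y i = (if i \<in> idx v then y \<bullet> \<alpha> v i else 0)"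

lemma chi_range: "v \<in> verts \<Longrightarrow> y \<in> reps v \<Longrightarrow> 0 \<le> chi v y i \<and> chi v y i < 1"
  by (auto simp: chi_def reps_def)

lemma finite_flat: "v \<in> verts \<Longrightarrow> finite (flat v A)"
  using finite_reps by (simp add: flat_def)

text \<open>Stated for a general \<phi> in order to serve both \<open>todd_factor\<close> and
  \<open>todd_coeff\<close>. Any vertex of the face may be used.\<close>

lemma sum_face_group_flat:
  assumes F: "F \<in> faces \<Delta>" and v: "v \<in> verts" "v \<in> F"
  shows "(\<Sum>\<gamma>\<in>face_group_flat L \<Delta> d u c F. face_char F \<gamma> *
        (\<Prod>j\<in>{1..d} - fidx F. \<phi> 1 j) * (\<Prod>j\<in>fidx F. \<phi> (group_char u (fidx F) \<gamma> j) j)) =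
    (\<Sum>y\<in>flat v (fidx F). e1 (y \<bullet> v) * (\<Prod>j=1..d. \<phi> (e1 (chi v y j)) j))"
proof -
  have sub: "fidx F \<subseteq> idx v" using vert_mem_face_iff[OF F v(1)] v by simp
  have subd: "fidx F \<subseteq> {1..d}" by (auto simp: mem_fidx)
  have "(\<Sum>\<gamma>\<in>face_group_flat L \<Delta> d u c F. face_char F \<gamma> *
        (\<Prod>j\<in>{1..d} - fidx F. \<phi> 1 j) * (\<Prod>j\<in>fidx F. \<phi> (group_char u (fidx F) \<gamma> j) j)) =
    (\<Sum>y\<in>flat v (fidx F). e1 (y \<bullet> v) * (\<Prod>j\<in>{1..d} - fidx F. \<phi> 1 j) * (\<Prod>j\<in>fidx F. \<phi> (e1 (y \<bullet> \<alpha> v j)) j))"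
    unfolding face_group_flat_eq[OF F v] sum.reindex[OF inj_on_flat[OF F v]] o_def
    by (intro sum.cong refl arg_cong2[where f = "(*)"] prod.cong)
      (auto simp: face_char_flat[OF F v] group_char_flat[OF F v])
  also have "\<dots> = (\<Sum>y\<in>flat v (fidx F). e1 (y \<bullet> v) * (\<Prod>j=1..d. \<phi> (e1 (chi v y j)) j))"
  proof (rule sum.cong[OF refl])
    fix y assume y: "y \<in> flat v (fidx F)"
    have "(\<Prod>j=1..d. \<phi> (e1 (chi v y j)) j) = (\<Prod>j\<in>{1..d} - fidx F. \<phi> (e1 (chi v y j)) j) * (\<Prod>j\<in>fidx F. \<phi> (e1 (chi v y j)) j)"
      by (rule prod.subset_diff[OF subd]) simp
    also have "(\<Prod>j\<in>{1..d} - fidx F. \<phi> (e1 (chi v y j)) j) = (\<Prod>j\<in>{1..d} - fidx F. \<phi> 1 j)"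
    proof (intro prod.cong refl)
      fix j assume "j \<in> {1..d} - fidx F"
      then have "j \<notin> supp v y" using y by (simp add: flat_def)
      then show "\<phi> (e1 (chi v y j)) j = \<phi> 1 j" by (simp add: chi_def supp_def)
    qed
    also have "(\<Prod>j\<in>fidx F. \<phi> (e1 (chi v y j)) j) = (\<Prod>j\<in>fidx F. \<phi> (e1 (y \<bullet> \<alpha> v j)) j)"
      using sub by (intro prod.cong) (auto simp: chi_def)
    finally show "e1 (y \<bullet> v) * (\<Prod>j\<in>{1..d} - fidx F. \<phi> 1 j) * (\<Prod>j\<in>fidx F. \<phi> (e1 (y \<bullet> \<alpha> v j)) j) =
      e1 (y \<bullet> v) * (\<Prod>j=1..d. \<phi> (e1 (chi v y j)) j)" by simp
  qed
  finally show ?thesis .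
qed

definition vert_of :: "'a set \<Rightarrow> 'a" where "vert_of F = (SOME v. v \<in> verts \<and> v \<in> F)"

lemma vert_of: "F \<in> faces \<Delta> \<Longrightarrow> vert_of F \<in> verts \<and> vert_of F \<in> F"
  unfolding vert_of_def by (rule someI_ex) (use face_vertex in blast)

text \<open>A finite sum of products of functions of one variable, the form that
  \<open>taylor_coeff_product\<close> handles. Each face is expressed through a vertex of its
  own.\<close>

lemma Todd_eq:
  "Todd L \<Delta> d u c = (\<lambda>S. \<Sum>(F, y)\<in>(SIGMA F:faces \<Delta>. flat (vert_of F) (fidx F)).
     e1 (y \<bullet> vert_of F) * (\<Prod>j=1..d. todd_factor (e1 (chi (vert_of F) y j)) (S j)))"
proof
  fix S
  have "Todd L \<Delta> d u c S = (\<Sum>F\<in>faces \<Delta>. \<Sum>y\<in>flat (vert_of F) (fidx F).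
     e1 (y \<bullet> vert_of F) * (\<Prod>j=1..d. todd_factor (e1 (chi (vert_of F) y j)) (S j)))"
    unfolding Todd_def
    by (intro sum.cong refl sum_face_group_flat[of _ _ "\<lambda>a j. todd_factor a (S j)"]) (use vert_of in auto)
  also have "\<dots> = (\<Sum>(F, y)\<in>(SIGMA F:faces \<Delta>. flat (vert_of F) (fidx F)).
     e1 (y \<bullet> vert_of F) * (\<Prod>j=1..d. todd_factor (e1 (chi (vert_of F) y j)) (S j)))"
    by (rule sum.Sigma) (use finite_faces finite_flat vert_of in auto)
  finally show "Todd L \<Delta> d u c S = \<dots>" .
qed

lemma taylor_coeff_Todd:
  "taylor_coeff d (Todd L \<Delta> d u c) m = (\<Sum>F\<in>faces \<Delta>. \<Sum>\<gamma>\<in>face_group_flat L \<Delta> d u c F. face_char F \<gamma> *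
     (\<Prod>j\<in>{1..d} - fidx F. todd_coeff 1 (m j)) * (\<Prod>j\<in>fidx F. todd_coeff (group_char u (fidx F) \<gamma> j) (m j)))"
proof -
  have "taylor_coeff d (Todd L \<Delta> d u c) m = (\<Sum>x\<in>(SIGMA F:faces \<Delta>. flat (vert_of F) (fidx F)).
     e1 (snd x \<bullet> vert_of (fst x)) * (\<Prod>j=1..d. todd_coeff (e1 (chi (vert_of (fst x)) (snd x) j)) (m j)))"
    unfolding Todd_eq case_prod_beta
    by (rule taylor_coeff_product[where C = "\<lambda>x. e1 (snd x \<bullet> vert_of (fst x))" and a = "\<lambda>x j. e1 (chi (vert_of (fst x)) (snd x) j)"]) (use finite_faces finite_flat vert_of in auto)
  also have "\<dots> = (\<Sum>F\<in>faces \<Delta>. \<Sum>y\<in>flat (vert_of F) (fidx F).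
     e1 (y \<bullet> vert_of F) * (\<Prod>j=1..d. todd_coeff (e1 (chi (vert_of F) y j)) (m j)))"
    by (subst sum.Sigma) (use finite_faces finite_flat vert_of in \<open>auto simp: case_prod_beta\<close>)
  also have "\<dots> = (\<Sum>F\<in>faces \<Delta>. \<Sum>\<gamma>\<in>face_group_flat L \<Delta> d u c F. face_char F \<gamma> *
     (\<Prod>j\<in>{1..d} - fidx F. todd_coeff 1 (m j)) * (\<Prod>j\<in>fidx F. todd_coeff (group_char u (fidx F) \<gamma> j) (m j)))"
    by (rule sum.cong[OF refl], rule sum_face_group_flat[of _ _ "\<lambda>a j. todd_coeff a (m j)", symmetric]) (use vert_of in auto)
  finally show ?thesis .
qed

lemma chi_supp_ne_1:
  assumes "v \<in> verts" "y \<in> flat v A" "j \<in> A"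
  shows "e1 (chi v y j) \<noteq> 1"
  using assms reps_frac[OF assms(1), of y j] by (auto simp: e1_eq_1_iff chi_def flat_def supp_def)

text \<open>
  Only the faces through \<open>v\<close> contribute, since \<open>todd_coeff a 0 = 0\<close> for \<open>a \<noteq> 1\<close>; the sets
  \<open>flat v (fidx F)\<close> of these faces partition \<open>reps v\<close>.
\<close>

lemma Todd_homogeneous_at_vertex:
  assumes v: "v \<in> verts" and b: "\<And>i. i \<in> {1..d} - idx v \<Longrightarrow> b i = 0"
  shows "(\<Sum>m\<in>multi_indices d k. taylor_coeff d (Todd L \<Delta> d u c) m * (\<Prod>i=1..d. b i ^ m i)) =
    (\<Sum>y\<in>reps v. e1 (y \<bullet> v) * (\<Sum>m\<in>multi_indices d k. \<Prod>i=1..d. todd_coeff (e1 (chi v y i)) (m i) * b i ^ m i))"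
proof -
  let ?T = "\<lambda>F m. \<Sum>\<gamma>\<in>face_group_flat L \<Delta> d u c F. face_char F \<gamma> *
     (\<Prod>j\<in>{1..d} - fidx F. todd_coeff 1 (m j)) * (\<Prod>j\<in>fidx F. todd_coeff (group_char u (fidx F) \<gamma> j) (m j))"
  have T: "?T F m = (\<Sum>y\<in>flat w (fidx F). e1 (y \<bullet> w) * (\<Prod>j=1..d. todd_coeff (e1 (chi w y j)) (m j)))"
    if "F \<in> faces \<Delta>" "w \<in> verts" "w \<in> F" for F w m
    by (rule sum_face_group_flat[of _ _ "\<lambda>a j. todd_coeff a (m j)"]) (use that in auto)
  have key: "(\<Sum>F\<in>faces \<Delta>. ?T F m) * (\<Prod>i=1..d. b i ^ m i) =
    (\<Sum>y\<in>reps v. e1 (y \<bullet> v) * (\<Prod>i=1..d. todd_coeff (e1 (chi v y i)) (m i) * b i ^ m i))" for m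
  proof -
    let ?B = "\<Prod>i=1..d. b i ^ m i"
    let ?g = "\<lambda>y. e1 (y \<bullet> v) * (\<Prod>i=1..d. todd_coeff (e1 (chi v y i)) (m i) * b i ^ m i)"
    \<comment> \<open>A face off v has an index j that is not active at v. If
      \<open>m j = 0\<close>, the coefficient vanishes since the character at j is not 1; otherwise
      \<open>b j = 0\<close> kills the monomial.\<close>
    have zero: "?T F m * ?B = 0" if F: "F \<in> faces \<Delta>" "v \<notin> F" for F
    proof -
      let ?w = "vert_of F"
      have w: "?w \<in> verts" "?w \<in> F" using vert_of[OF F(1)] by auto
      obtain j where j: "j \<in> fidx F" "j \<notin> idx v" using vert_mem_face_iff[OF F(1) v] F(2) by auto
      have jd: "j \<in> {1..d}" using j by (auto simp: mem_fidx)
      have "(\<Prod>i=1..d. todd_coeff (e1 (chi ?w y i)) (m i)) * ?B = 0" if y: "y \<in> flat ?w (fidx F)" for y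
      proof -
        have "todd_coeff (e1 (chi ?w y j)) (m j) * b j ^ m j = 0"
        proof (cases "m j = 0")
          case True
          then show ?thesis using todd_coeff_0[OF chi_supp_ne_1[OF w(1) y j(1)]] by simp
        next
          case False
          then show ?thesis using b[of j] jd j by simp
        qed
        then have "(\<Prod>i=1..d. todd_coeff (e1 (chi ?w y i)) (m i) * b i ^ m i) = 0"
          using jd by (intro prod_zero) auto
        then show ?thesis by (simp only: prod.distrib)
      qed
      then have "e1 (y \<bullet> ?w) * (\<Prod>j=1..d. todd_coeff (e1 (chi ?w y j)) (m j)) * ?B = 0" if "y \<in> flat ?w (fidx F)" for y
        using that by (simp only: mult.assoc mult_zero_right)
      then show ?thesis unfolding T[OF F(1) w] sum_distrib_right by (intro sum.neutral ballI)
    qed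
    have "(\<Sum>F\<in>faces \<Delta>. ?T F m) * ?B = (\<Sum>F\<in>faces \<Delta>. ?T F m * ?B)" by (rule sum_distrib_right)
    also have "\<dots> = (\<Sum>F\<in>{F \<in> faces \<Delta>. v \<in> F}. ?T F m * ?B)"
      using zero finite_faces by (intro sum.mono_neutral_right) auto
    also have "\<dots> = (\<Sum>F\<in>{F \<in> faces \<Delta>. v \<in> F}. \<Sum>y\<in>flat v (fidx F). ?g y)"
    proof (intro sum.cong refl)
      fix F assume "F \<in> {F \<in> faces \<Delta>. v \<in> F}"
      then have "?T F m = (\<Sum>y\<in>flat v (fidx F). e1 (y \<bullet> v) * (\<Prod>j=1..d. todd_coeff (e1 (chi v y j)) (m j)))"
        by (intro T) (use v in auto)
      then show "?T F m * ?B = (\<Sum>y\<in>flat v (fidx F). ?g y)"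
        by (simp only: sum_distrib_right prod.distrib mult.assoc)
    qed
    also have "\<dots> = sum ?g (\<Union>F\<in>{F \<in> faces \<Delta>. v \<in> F}. flat v (fidx F))"
    proof (rule sum.UNION_disjoint[symmetric])
      show "\<forall>i\<in>{F \<in> faces \<Delta>. v \<in> F}. \<forall>j\<in>{F \<in> faces \<Delta>. v \<in> F}. i \<noteq> j \<longrightarrow> flat v (fidx i) \<inter> flat v (fidx j) = {}"
      proof (intro ballI impI)
        fix E F assume *: "E \<in> {F \<in> faces \<Delta>. v \<in> F}" "F \<in> {F \<in> faces \<Delta>. v \<in> F}" "E \<noteq> F"
        then have "fidx E \<noteq> fidx F" using face_eqI[of E F] by blast
        then show "flat v (fidx E) \<inter> flat v (fidx F) = {}" by (auto simp: flat_def)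
      qed
    qed (use finite_faces finite_flat v in auto)
    \<comment> \<open>Every y belongs to the face through v whose index set is the support of
      y.\<close>
    also have "(\<Union>F\<in>{F \<in> faces \<Delta>. v \<in> F}. flat v (fidx F)) = reps v"
    proof (intro equalityI subsetI)
      fix y assume y: "y \<in> reps v"
      have s: "supp v y \<subseteq> idx v" by (auto simp: supp_def)
      have "face_cut (supp v y) \<in> faces \<Delta>" "fidx (face_cut (supp v y)) = supp v y"
        using vertex_cut[OF v s] by auto
      moreover from this have "v \<in> face_cut (supp v y)" using vert_mem_face_iff[OF _ v] s by auto
      ultimately show "y \<in> (\<Union>F\<in>{F \<in> faces \<Delta>. v \<in> F}. flat v (fidx F))"
        using y by (intro UN_I[of "face_cut (supp v y)"]) (auto simp: flat_def)
    qed (auto simp: flat_def)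
    finally show ?thesis .
  qed
  have "(\<Sum>m\<in>multi_indices d k. taylor_coeff d (Todd L \<Delta> d u c) m * (\<Prod>i=1..d. b i ^ m i)) =
    (\<Sum>m\<in>multi_indices d k. \<Sum>y\<in>reps v. e1 (y \<bullet> v) * (\<Prod>i=1..d. todd_coeff (e1 (chi v y i)) (m i) * b i ^ m i))"
    unfolding taylor_coeff_Todd key ..
  also have "\<dots> = (\<Sum>y\<in>reps v. \<Sum>m\<in>multi_indices d k. e1 (y \<bullet> v) * (\<Prod>i=1..d. todd_coeff (e1 (chi v y i)) (m i) * b i ^ m i))"
    by (rule sum.swap)
  finally show ?thesis by (simp only: sum_distrib_left)
qed

end

section \<open>The Euler-Maclaurin formula\<close>

definition circ :: "real \<Rightarrow> real \<Rightarrow> complex" where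
  "circ r t = of_real r * exp (2 * of_real pi * \<i> * of_real t)"

lemma norm_circ: "r > 0 \<Longrightarrow> norm (circ r t) = r"
  by (simp add: circ_def norm_mult norm_exp_eq_Re)

lemma circ_nonzero: "r > 0 \<Longrightarrow> circ r t \<noteq> 0"
  by (simp add: circ_def)

lemma continuous_circ: "continuous_on A (circ r)"
  unfolding circ_def by (intro continuous_intros)

lemma higher_deriv_exp_mult: "(deriv ^^ n) (\<lambda>z. exp (s * z)) = (\<lambda>z. s ^ n * exp (s * z :: complex))"
proof (induction n)
  case (Suc n)
  have "deriv (\<lambda>z. s ^ n * exp (s * z)) z = s ^ Suc n * exp (s * z)" for z
    by (rule DERIV_imp_deriv) (auto intro!: derivative_eq_intros)
  then show ?case using Suc by simp
qed simp

text \<open>Cauchy's formula for the m-th derivative of \<open>exp (s * z)\<close> at 0. The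
  derivative of the parametrised circle absorbs one factor of the denominator, whence the exponent m
  rather than m + 1.\<close>

lemma power_as_circle_integral:
  assumes r: "r > 0"
  shows "integral {0..1} (\<lambda>t. fact m / circ r t ^ m * exp (s * circ r t)) = s ^ m"
proof -
  let ?f = "\<lambda>z. exp (s * z)"
  have "(deriv ^^ m) ?f 0 = fact m / (2 * pi * \<i>) * contour_integral (circlepath 0 r) (\<lambda>u. ?f u / (u - 0) ^ Suc m)"
    by (rule Cauchy_higher_derivative_integral_circlepath(2))
      (use r in \<open>auto intro!: continuous_intros holomorphic_intros\<close>)
  also have "contour_integral (circlepath 0 r) (\<lambda>u. ?f u / (u - 0) ^ Suc m) =
    integral {0..1} (\<lambda>t. ?f (circlepath 0 r t) / (circlepath 0 r t - 0) ^ Suc m * vector_derivative (circlepath 0 r) (at t))"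
    by (rule contour_integral_integral)
  also have "\<dots> = integral {0..1} (\<lambda>t. (2 * of_real pi * \<i>) * (exp (s * circ r t) / circ r t ^ m))"
  proof (rule integral_cong)
    fix t
    have c: "circlepath 0 r t = circ r t" by (simp add: circlepath circ_def)
    have "vector_derivative (circlepath 0 r) (at t) = 2 * of_real pi * \<i> * circ r t"
      by (simp add: vector_derivative_circlepath circ_def)
    then show "?f (circlepath 0 r t) / (circlepath 0 r t - 0) ^ Suc m * vector_derivative (circlepath 0 r) (at t) =
      (2 * of_real pi * \<i>) * (exp (s * circ r t) / circ r t ^ m)"
      using circ_nonzero[OF r, of t] by (simp add: c field_simps)
  qed
  also have "fact m / (2 * pi * \<i>) * \<dots> = fact m * integral {0..1} (\<lambda>t. exp (s * circ r t) / circ r t ^ m)"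
  proof -
    have "a / z * (z * X) = a * X" if "z \<noteq> 0" for a z X :: complex using that by simp
    from this[of "2 * pi * \<i>"] show ?thesis unfolding integral_mult_right by simp
  qed
  also have "\<dots> = integral {0..1} (\<lambda>t. fact m / circ r t ^ m * exp (s * circ r t))"
    unfolding integral_mult_right[symmetric] by (simp add: mult_ac)
  finally show ?thesis by (simp add: higher_deriv_exp_mult)
qed

text \<open>Weierstrass M-test, followed by integration of the uniform limit.\<close>

lemma integral_sums_uniform:
  fixes f :: "nat \<Rightarrow> real \<Rightarrow> complex"
  assumes cont: "\<And>k. continuous_on {0..1} (f k)"
    and M: "\<And>k t. t \<in> {0..1} \<Longrightarrow> norm (f k t) \<le> M k" "summable M"
    and F: "\<And>t. t \<in> {0..1} \<Longrightarrow> (\<lambda>k. f k t) sums F t"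
  shows "(\<lambda>k. integral {0..1} (f k)) sums integral {0..1} F"
proof -
  have "uniform_limit {0..1} (\<lambda>n t. \<Sum>k<n. f k t) (\<lambda>t. suminf (\<lambda>k. f k t)) sequentially"
    by (rule Weierstrass_m_test[OF M])
  then have "uniform_limit {0..1} (\<lambda>n t. \<Sum>k<n. f k t) F sequentially"
    by (rule uniform_limit_cong'[THEN iffD1, rotated -1]) (use F in \<open>auto simp: sums_iff\<close>)
  then obtain I J where IJ: "\<And>n. ((\<lambda>t. \<Sum>k<n. f k t) has_integral I n) {0..1}" "(F has_integral J) {0..1}" "I \<longlonglongrightarrow> J"
    by (rule uniform_limit_integral) (auto intro!: continuous_intros cont)
  have "I n = (\<Sum>k<n. integral {0..1} (f k))" for n
    using IJ(1)[of n] by (subst integral_sum[symmetric]) (auto intro!: integrable_continuous_interval cont simp: integral_unique)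
  then have "I = (\<lambda>n. \<Sum>k<n. integral {0..1} (f k))" by auto
  moreover have "integral {0..1} F = J" using IJ(2) by (rule integral_unique)
  ultimately show ?thesis using IJ(3) by (simp only: sums_def)
qed

text \<open>The weights are the coefficients of degree l of the Lagrange basis polynomials of A:
  applied to the values of a polynomial of degree below \<open>card A\<close>, they return its
  coefficient of degree l.\<close>

lemma lagrange_functional:
  fixes A :: "real set"
  assumes fin: "finite A" and l: "l < card A"
  shows "\<exists>c. \<forall>i<card A. (\<Sum>s\<in>A. c s * s ^ i) = (if i = l then 1 else 0)"
proof -
  define P :: "real \<Rightarrow> real poly" where
    "P s = smult (1 / (\<Prod>t\<in>A - {s}. s - t)) (\<Prod>t\<in>A - {s}. [:- t, 1:])" for s
  have P: "poly (P s) t = (if s = t then 1 else 0)" if "s \<in> A" "t \<in> A" for s t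
  proof (cases "s = t")
    case True
    have "(\<Prod>t\<in>A - {s}. s - t) \<noteq> 0" using fin by auto
    then show ?thesis using True by (simp add: P_def poly_prod)
  next
    case False
    then have "(\<Prod>t'\<in>A - {s}. t - t') = 0" using fin that by (intro prod_zero) auto
    then show ?thesis using False by (simp add: P_def poly_prod)
  qed
  have deg: "degree (P s) < card A" if "s \<in> A" for s
  proof -
    have "degree (P s) \<le> degree (\<Prod>t\<in>A - {s}. [:- t, 1:])" unfolding P_def by (rule degree_smult_le)
    also have "\<dots> \<le> (\<Sum>t\<in>A - {s}. degree [:- t, 1:])" using degree_prod_sum_le[of "A - {s}" "\<lambda>t. [:- t, 1:]"] fin by (simp add: o_def)
    also have "\<dots> = card (A - {s})" by simp
    also have "\<dots> < card A" using fin that by (intro psubset_card_mono) auto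
    finally show ?thesis .
  qed
  have "(\<Sum>s\<in>A. coeff (P s) l * s ^ i) = (if i = l then 1 else 0)" if i: "i < card A" for i
  proof -
    have "(\<Sum>s\<in>A. smult (s ^ i) (P s)) = monom 1 i"
    proof (rule poly_eqI_degree[of A])
      fix t assume t: "t \<in> A"
      have "(\<Sum>s\<in>A. s ^ i * poly (P s) t) = (\<Sum>s\<in>A. if s = t then s ^ i else 0)"
        using t P by (intro sum.cong) auto
      then show "poly (\<Sum>s\<in>A. smult (s ^ i) (P s)) t = poly (monom 1 i) t"
        using fin t by (simp add: poly_sum poly_monom)
    next
      have "degree (smult (s ^ i) (P s)) \<le> card A - 1" if "s \<in> A" for s
        using degree_smult_le[of "s ^ i" "P s"] deg[OF that] by linarith
      then have "degree (\<Sum>s\<in>A. smult (s ^ i) (P s)) \<le> card A - 1"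
        by (intro degree_sum_le fin)
      then show "card A > degree (\<Sum>s\<in>A. smult (s ^ i) (P s))" using l by linarith
      show "card A > degree (monom 1 i :: real poly)" using i by (simp add: degree_monom_eq)
    qed
    then have "coeff (\<Sum>s\<in>A. smult (s ^ i) (P s)) l = coeff (monom 1 i) l" by simp
    then show ?thesis by (simp add: coeff_sum mult.commute)
  qed
  then show ?thesis by (intro exI[of _ "\<lambda>s. coeff (P s) l"]) auto
qed

section \<open>Polynomials as combinations of powers of generic linear forms\<close>

context simple_rational_polytope
begin

inductive_set powers_span :: "('a \<Rightarrow> complex) set" where
  zero: "(\<lambda>_. 0) \<in> powers_span"
| step: "f \<in> powers_span \<Longrightarrow> generic \<eta> \<Longrightarrow> (\<lambda>x. a * of_real ((\<eta> \<bullet> x) ^ m) + f x) \<in> powers_span"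

lemma powers_span_gen: "generic \<eta> \<Longrightarrow> (\<lambda>x. a * of_real ((\<eta> \<bullet> x) ^ m)) \<in> powers_span"
  using powers_span.step[OF powers_span.zero, of \<eta> a m] by simp

lemma powers_span_add: "f \<in> powers_span \<Longrightarrow> g \<in> powers_span \<Longrightarrow> (\<lambda>x. f x + g x) \<in> powers_span"
proof (induction rule: powers_span.induct)
  case (step f \<eta> a m)
  from powers_span.step[OF step.IH[OF step.prems] \<open>generic \<eta>\<close>, of a m] show ?case by (simp add: add.assoc)
qed simp

lemma powers_span_cmult: "f \<in> powers_span \<Longrightarrow> (\<lambda>x. k * f x) \<in> powers_span"
proof (induction rule: powers_span.induct)
  case (step f \<eta> a m)
  then show ?case using powers_span.step[of "\<lambda>x. k * f x" \<eta> "k * a" m] by (simp add: distrib_left mult.assoc)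
qed (simp add: powers_span.zero)

lemma powers_span_sum:
  assumes "finite A" "\<And>i. i \<in> A \<Longrightarrow> f i \<in> powers_span"
  shows "(\<lambda>x. \<Sum>i\<in>A. f i x) \<in> powers_span"
  using assms by (induction A rule: finite_induct) (auto intro: powers_span_add powers_span.zero)

text \<open>Polarization: as a polynomial in s, the power
  \<open>((\<eta> + s *\<^sub>R \<theta>) \<bullet> x) ^ (m + l)\<close> has the wanted product,
  times a binomial coefficient, as its coefficient of degree l. This is recovered from the values at
  m + l + 1 small s, for which the form is generic.\<close>

lemma powers_span_gen_mult:
  assumes \<eta>: "generic \<eta>" and \<theta>: "generic \<theta>"
  shows "(\<lambda>x. of_real ((\<eta> \<bullet> x) ^ m) * of_real ((\<theta> \<bullet> x) ^ l)) \<in> powers_span"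
proof -
  let ?N = "m + l"
  obtain \<delta> where \<delta>: "\<delta> > 0" "\<And>s. 0 < s \<Longrightarrow> s < \<delta> \<Longrightarrow> generic (\<eta> + s *\<^sub>R \<theta>)"
    using eventually_generic[OF \<theta>, of \<eta>] by (auto simp: eventually_at_right_field)
  \<comment> \<open>The offset 2 keeps all nodes strictly below \<delta>, also for k = 0.\<close>
  let ?s = "\<lambda>k::nat. \<delta> / (real k + 2)"
  define A where "A = ?s ` {..?N}"
  have "inj_on ?s {..?N}" using \<delta>(1) by (auto simp: inj_on_def field_simps)
  then have A: "finite A" "card A = Suc ?N" by (auto simp: A_def card_image)
  have gen: "generic (\<eta> + s *\<^sub>R \<theta>)" if s: "s \<in> A" for s
  proof -
    obtain k where "s = ?s k" using s unfolding A_def by blast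
    moreover have "\<delta> * 1 < \<delta> * (real k + 2)" using \<delta>(1) by (intro mult_strict_left_mono) auto
    ultimately have "0 < s" "s < \<delta>" using \<delta>(1) by (auto simp: pos_divide_less_eq)
    then show ?thesis by (rule \<delta>(2))
  qed
  obtain c where c: "\<And>i. i \<le> ?N \<Longrightarrow> (\<Sum>s\<in>A. c s * s ^ i) = (if i = l then 1 else 0)"
    using lagrange_functional[OF A(1), of l] A(2) by (auto simp: less_Suc_eq_le)
  have eq: "(\<Sum>s\<in>A. c s * ((\<eta> + s *\<^sub>R \<theta>) \<bullet> x) ^ ?N) = of_nat (?N choose l) * ((\<eta> \<bullet> x) ^ m * (\<theta> \<bullet> x) ^ l)" for x
  proof -
    have "(\<Sum>s\<in>A. c s * ((\<eta> + s *\<^sub>R \<theta>) \<bullet> x) ^ ?N) =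
      (\<Sum>s\<in>A. \<Sum>i\<le>?N. c s * (of_nat (?N choose i) * (s * (\<theta> \<bullet> x)) ^ i * (\<eta> \<bullet> x) ^ (?N - i)))"
    proof (intro sum.cong refl)
      fix s
      have "(\<eta> + s *\<^sub>R \<theta>) \<bullet> x = s * (\<theta> \<bullet> x) + \<eta> \<bullet> x" by (simp add: inner_add_left)
      then show "c s * ((\<eta> + s *\<^sub>R \<theta>) \<bullet> x) ^ ?N = (\<Sum>i\<le>?N. c s * (of_nat (?N choose i) * (s * (\<theta> \<bullet> x)) ^ i * (\<eta> \<bullet> x) ^ (?N - i)))"
        by (simp only: binomial_ring sum_distrib_left)
    qed
    also have "\<dots> = (\<Sum>i\<le>?N. \<Sum>s\<in>A. c s * (of_nat (?N choose i) * (s * (\<theta> \<bullet> x)) ^ i * (\<eta> \<bullet> x) ^ (?N - i)))"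
      by (rule sum.swap)
    also have "\<dots> = (\<Sum>i\<le>?N. (\<Sum>s\<in>A. c s * s ^ i) * (of_nat (?N choose i) * (\<theta> \<bullet> x) ^ i * (\<eta> \<bullet> x) ^ (?N - i)))"
    proof (intro sum.cong refl)
      fix i
      have "c s * (of_nat (?N choose i) * (s * (\<theta> \<bullet> x)) ^ i * (\<eta> \<bullet> x) ^ (?N - i)) =
        (c s * s ^ i) * (of_nat (?N choose i) * (\<theta> \<bullet> x) ^ i * (\<eta> \<bullet> x) ^ (?N - i))" for s
        by (simp add: power_mult_distrib mult_ac)
      then show "(\<Sum>s\<in>A. c s * (of_nat (?N choose i) * (s * (\<theta> \<bullet> x)) ^ i * (\<eta> \<bullet> x) ^ (?N - i))) =
        (\<Sum>s\<in>A. c s * s ^ i) * (of_nat (?N choose i) * (\<theta> \<bullet> x) ^ i * (\<eta> \<bullet> x) ^ (?N - i))"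
        by (simp only: sum_distrib_right)
    qed
    also have "\<dots> = (\<Sum>i\<le>?N. if i = l then of_nat (?N choose i) * (\<theta> \<bullet> x) ^ i * (\<eta> \<bullet> x) ^ (?N - i) else 0)"
      by (intro sum.cong refl) (simp add: c)
    also have "\<dots> = of_nat (?N choose l) * ((\<eta> \<bullet> x) ^ m * (\<theta> \<bullet> x) ^ l)" by simp
    finally show ?thesis .
  qed
  let ?C = "of_nat (?N choose l) :: real"
  have C: "?C \<noteq> 0" by simp
  have "(\<lambda>x. \<Sum>s\<in>A. of_real (c s / ?C) * of_real (((\<eta> + s *\<^sub>R \<theta>) \<bullet> x) ^ ?N)) \<in> powers_span"
    by (intro powers_span_sum A powers_span_gen gen)
  moreover have "(\<Sum>s\<in>A. of_real (c s / ?C) * of_real (((\<eta> + s *\<^sub>R \<theta>) \<bullet> x) ^ ?N)) =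
    (of_real ((\<eta> \<bullet> x) ^ m) * of_real ((\<theta> \<bullet> x) ^ l) :: complex)" for x
  proof -
    have "(\<Sum>s\<in>A. of_real (c s / ?C) * of_real (((\<eta> + s *\<^sub>R \<theta>) \<bullet> x) ^ ?N)) =
       (of_real ((\<Sum>s\<in>A. c s * ((\<eta> + s *\<^sub>R \<theta>) \<bullet> x) ^ ?N) / ?C) :: complex)"
      unfolding of_real_sum sum_divide_distrib by (intro sum.cong refl) simp
    also have "\<dots> = of_real ((\<eta> \<bullet> x) ^ m * (\<theta> \<bullet> x) ^ l)" unfolding eq using C by simp
    finally show ?thesis by simp
  qed
  ultimately show ?thesis by simp
qed

lemma powers_span_mult:
  assumes f: "f \<in> powers_span" and g: "g \<in> powers_span"
  shows "(\<lambda>x. f x * g x) \<in> powers_span"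
  using f
proof (induction rule: powers_span.induct)
  case (step f \<eta> a m)
  have "(\<lambda>x. of_real ((\<eta> \<bullet> x) ^ m) * g x) \<in> powers_span"
    using g
  proof (induction rule: powers_span.induct)
    case (step g' \<theta> a' m')
    have "(\<lambda>x. a' * (of_real ((\<eta> \<bullet> x) ^ m) * of_real ((\<theta> \<bullet> x) ^ m')) + of_real ((\<eta> \<bullet> x) ^ m) * g' x) \<in> powers_span"
      by (intro powers_span_add powers_span_cmult powers_span_gen_mult step \<open>generic \<eta>\<close>)
    then show ?case by (simp add: algebra_simps)
  qed (simp add: powers_span.zero)
  then have "(\<lambda>x. a * (of_real ((\<eta> \<bullet> x) ^ m) * g x) + f x * g x) \<in> powers_span"
    by (intro powers_span_add powers_span_cmult step)
  then show ?case by (simp add: algebra_simps)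
qed (simp add: powers_span.zero)

text \<open>A linear form w is written as \<open>w + r *\<^sub>R \<theta>\<close> minus r times
  \<theta>, both generic; constants are zeroth powers of a generic form.\<close>

lemma real_polynomial_powers_span:
  fixes p :: "'a \<Rightarrow> real"
  assumes "real_polynomial_function p"
  shows "(\<lambda>x. of_real (p x)) \<in> powers_span"
  using assms
proof (induction rule: real_polynomial_function.induct)
  case (linear f)
  obtain \<theta> where \<theta>: "generic \<theta>" using generic_exists by auto
  define w where "w = (\<Sum>b\<in>Basis. f b *\<^sub>R b)"
  have f: "f x = w \<bullet> x" for x
  proof -
    have lin: "linear f" using linear by (rule bounded_linear.linear)
    have "f x = f (\<Sum>b\<in>Basis. (x \<bullet> b) *\<^sub>R b)" by (simp add: euclidean_representation)
    also have "\<dots> = (\<Sum>b\<in>Basis. (x \<bullet> b) * f b)"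
      by (simp only: linear_sum[OF lin] linear_cmul[OF lin] real_scaleR_def)
    finally have "f x = (\<Sum>b\<in>Basis. (x \<bullet> b) * f b)" .
    moreover have "w \<bullet> x = (\<Sum>b\<in>Basis. f b * (b \<bullet> x))" by (simp add: w_def inner_sum_left)
    ultimately show ?thesis by (simp add: inner_commute mult.commute)
  qed
  have "eventually (\<lambda>r. generic (w + r *\<^sub>R \<theta>)) (at_right 0)" by (rule eventually_generic[OF \<theta>])
  then obtain r where r: "generic (w + r *\<^sub>R \<theta>)"
    using eventually_happens'[OF trivial_limit_at_right_real] by blast
  have "(\<lambda>x. 1 * of_real (((w + r *\<^sub>R \<theta>) \<bullet> x) ^ 1) + (- of_real r) * of_real ((\<theta> \<bullet> x) ^ 1)) \<in> powers_span"
    by (intro powers_span_add powers_span_gen r \<theta>)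
  then show ?case by (simp add: f inner_add_left)
next
  case (const c)
  obtain \<theta> where "generic \<theta>" using generic_exists by auto
  from powers_span_gen[OF this, of "of_real c" 0] show ?case by simp
next
  case (add f g)
  then show ?case using powers_span_add by fastforce
next
  case (mult f g)
  then show ?case using powers_span_mult by fastforce
qed

lemma polynomial_powers_span:
  fixes p :: "'a \<Rightarrow> complex"
  assumes "polynomial_function p"
  shows "p \<in> powers_span"
proof -
  have "real_polynomial_function (Re \<circ> p)" "real_polynomial_function (Im \<circ> p)"
    using assms bounded_linear_Re bounded_linear_Im by (auto simp: polynomial_function_def)
  then have "(\<lambda>x. of_real ((Re \<circ> p) x) + \<i> * of_real ((Im \<circ> p) x)) \<in> powers_span"
    by (intro powers_span_add powers_span_cmult real_polynomial_powers_span)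
  moreover have "(\<lambda>x. of_real ((Re \<circ> p) x) + \<i> * of_real ((Im \<circ> p) x)) = p"
    by (auto simp: complex_eq[symmetric])
  ultimately show ?thesis by simp
qed

lemma set_integral_lattice_lborel:
  assumes f: "continuous_on UNIV f" and h: "small h"
  shows "(LINT x:\<Delta>h h|lattice_lborel L. f x) = of_real (1 / covolume L) * (LINT x|lborel. indicator (\<Delta>h h) x *\<^sub>R f x :: complex)"
proof -
  have [measurable]: "f \<in> borel_measurable borel" using f by (rule borel_measurable_continuous_onI)
  have [measurable]: "\<Delta>h h \<in> sets borel" using closed_\<Delta>h by (rule borel_closed)
  have "(LINT x:\<Delta>h h|lattice_lborel L. f x) = (LINT x|lborel. (1 / covolume L) *\<^sub>R (indicator (\<Delta>h h) x *\<^sub>R f x))"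
    unfolding lattice_lborel_def set_lebesgue_integral_def
    by (rule integral_density) (use covolume_pos in auto)
  then show ?thesis by (simp add: scaleR_conv_of_real)
qed

lemma integrable_\<Delta>h:
  assumes "continuous_on UNIV f" "small h"
  shows "integrable lborel (\<lambda>x. indicator (\<Delta>h h) x *\<^sub>R (f x :: complex))"
  using assms by (intro borel_integrable_compact compact_\<Delta>h) (auto intro: continuous_on_subset)

text \<open>The bound is applied to y, to \<open>y - u j\<close>, whose pairing with the edge vector
  has absolute value one minus that of y, and to \<open>u j\<close> itself when y pairs to
  0.\<close>

lemma admissible_radius:
  assumes adm: "admissible_exponent L \<Delta> d u c \<xi>" and v: "v \<in> verts" and j: "j \<in> idx v" and y: "y \<in> reps v"
  shows "norm (\<xi> (\<alpha> v j)) < radius (y \<bullet> \<alpha> v j)"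
proof -
  have A: "norm (\<xi> (\<alpha> v j)) < 2 * pi * \<bar>y \<bullet> \<alpha> v j\<bar>" if "y \<in> dual_lattice L" "y \<bullet> \<alpha> v j \<noteq> 0" for y
    using adm v j that unfolding admissible_exponent_def fidx_vert \<alpha>_def verts_def by blast
  have uj: "u j \<in> dual_lattice L" "u j \<bullet> \<alpha> v j = 1"
    using u_dual[of j] u_inner_\<alpha>[OF v j j] j by (auto simp: idx_def)
  have yL: "y \<in> dual_lattice L" and r: "0 \<le> y \<bullet> \<alpha> v j" "y \<bullet> \<alpha> v j < 1" using y j by (auto simp: reps_def)
  show ?thesis
  proof (cases "y \<bullet> \<alpha> v j = 0")
    case True
    then show ?thesis using A[OF uj(1)] uj(2) by (simp add: radius_def)
  next
    case False
    have "norm (\<xi> (\<alpha> v j)) < 2 * pi * \<bar>(y - u j) \<bullet> \<alpha> v j\<bar>"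
      using r uj by (intro A dual_lattice_diff yL) (auto simp: inner_diff_left)
    then have 1: "norm (\<xi> (\<alpha> v j)) < 2 * pi * (1 - y \<bullet> \<alpha> v j)" using r uj by (simp add: inner_diff_left)
    have 2: "norm (\<xi> (\<alpha> v j)) < 2 * pi * (y \<bullet> \<alpha> v j)" using A[OF yL False] r by simp
    show ?thesis using False 1 2 by (auto simp: radius_def min_def)
  qed
qed

text \<open>Finitely many strict inequalities that hold in the limit r = 0. The first keeps the
  circle away from exponents that vanish on an edge, the second keeps it inside the domain of
  convergence.\<close>

lemma circle_radius_exists:
  assumes adm: "admissible_exponent L \<Delta> d u c \<xi>" and \<eta>: "generic \<eta>"
  obtains r where "r > 0"
    "\<And>v j. v \<in> verts \<Longrightarrow> j \<in> idx v \<Longrightarrow> \<xi> (\<alpha> v j) \<noteq> 0 \<Longrightarrow> r * \<bar>\<eta> \<bullet> \<alpha> v j\<bar> < norm (\<xi> (\<alpha> v j))"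
    "\<And>v j y. v \<in> verts \<Longrightarrow> j \<in> idx v \<Longrightarrow> y \<in> reps v \<Longrightarrow> norm (\<xi> (\<alpha> v j)) + r * \<bar>\<eta> \<bullet> \<alpha> v j\<bar> < radius (y \<bullet> \<alpha> v j)"
proof -
  have lim: "((\<lambda>r. k + r * \<bar>\<eta> \<bullet> \<alpha> v j\<bar>) \<longlongrightarrow> k + 0 * \<bar>\<eta> \<bullet> \<alpha> v j\<bar>) (at_right 0)" for k v j
    by (intro tendsto_intros)
  have 1: "eventually (\<lambda>r. \<xi> (\<alpha> v j) \<noteq> 0 \<longrightarrow> r * \<bar>\<eta> \<bullet> \<alpha> v j\<bar> < norm (\<xi> (\<alpha> v j))) (at_right 0)" for v j
  proof (cases "\<xi> (\<alpha> v j) = 0")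
    case False
    then have "eventually (\<lambda>r. 0 + r * \<bar>\<eta> \<bullet> \<alpha> v j\<bar> < norm (\<xi> (\<alpha> v j))) (at_right 0)"
      by (intro order_tendstoD(2)[OF lim]) auto
    then show ?thesis by simp
  qed simp
  have 2: "eventually (\<lambda>r. norm (\<xi> (\<alpha> v j)) + r * \<bar>\<eta> \<bullet> \<alpha> v j\<bar> < radius (y \<bullet> \<alpha> v j)) (at_right 0)"
    if "v \<in> verts" "j \<in> idx v" "y \<in> reps v" for v j y
    by (rule order_tendstoD(2)[OF lim]) (use admissible_radius[OF adm that] in simp)
  have "eventually (\<lambda>r. \<forall>v\<in>verts. \<forall>j\<in>idx v. (\<xi> (\<alpha> v j) \<noteq> 0 \<longrightarrow> r * \<bar>\<eta> \<bullet> \<alpha> v j\<bar> < norm (\<xi> (\<alpha> v j))) \<and>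
     (\<forall>y\<in>reps v. norm (\<xi> (\<alpha> v j)) + r * \<bar>\<eta> \<bullet> \<alpha> v j\<bar> < radius (y \<bullet> \<alpha> v j))) (at_right 0)"
    by (intro eventually_ball_finite ballI eventually_conj finite_verts finite_idx finite_reps 1 2)
  then have "eventually (\<lambda>r. (\<forall>v\<in>verts. \<forall>j\<in>idx v. (\<xi> (\<alpha> v j) \<noteq> 0 \<longrightarrow> r * \<bar>\<eta> \<bullet> \<alpha> v j\<bar> < norm (\<xi> (\<alpha> v j))) \<and>
     (\<forall>y\<in>reps v. norm (\<xi> (\<alpha> v j)) + r * \<bar>\<eta> \<bullet> \<alpha> v j\<bar> < radius (y \<bullet> \<alpha> v j))) \<and> 0 < r) (at_right 0)"
    by (rule eventually_conj[OF _ eventually_at_right_less])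
  then obtain r where "(\<forall>v\<in>verts. \<forall>j\<in>idx v. (\<xi> (\<alpha> v j) \<noteq> 0 \<longrightarrow> r * \<bar>\<eta> \<bullet> \<alpha> v j\<bar> < norm (\<xi> (\<alpha> v j))) \<and>
     (\<forall>y\<in>reps v. norm (\<xi> (\<alpha> v j)) + r * \<bar>\<eta> \<bullet> \<alpha> v j\<bar> < radius (y \<bullet> \<alpha> v j))) \<and> 0 < r"
    using eventually_happens'[OF trivial_limit_at_right_real] by blast
  then show thesis using that by blast
qed

section \<open>Functions represented by integrals of exponentials\<close>

definition homog :: "nat \<Rightarrow> (nat \<Rightarrow> complex) \<Rightarrow> complex" where
  "homog k b = (\<Sum>m\<in>multi_indices d k. taylor_coeff d (Todd L \<Delta> d u c) m * (\<Prod>i=1..d. b i ^ m i))"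

text \<open>
  For an admissible exponent \<open>\<xi>\<close> that vanishes on an edge, the vertex terms of the integral are
  singular. Cauchy's formula writes \<open>(\<eta> \<bullet> x) ^ m * exp (\<xi> x)\<close> as an integral of exponentials
  over a circle of exponents around \<open>\<xi>\<close>, on which they are regular. In \<open>ws\<close> every pair consists
  of a weight and of the coefficients of \<open>h\<close> in the exponent, as functions of the position on
  the circle.
\<close>

definition represents :: "((real \<Rightarrow> complex) \<times> (nat \<Rightarrow> real \<Rightarrow> complex)) list \<Rightarrow> ('a \<Rightarrow> complex) \<Rightarrow> bool" where
  "represents ws f \<longleftrightarrow> continuous_on UNIV f \<and>
      (\<forall>(W, b)\<in>set ws. continuous_on {0..1} W \<and> (\<forall>l. continuous_on {0..1} (b l))) \<and>
      (\<forall>h. small h \<longrightarrow> (LINT x:\<Delta>h h|lattice_lborel L. f x) =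
         (\<Sum>(W, b)\<leftarrow>ws. integral {0..1} (\<lambda>t. W t * exp (\<Sum>l=1..d. b l t * of_real (h l))))) \<and>
      (\<lambda>k. \<Sum>(W, b)\<leftarrow>ws. integral {0..1} (\<lambda>t. W t * homog k (\<lambda>l. b l t))) sums (\<Sum>x\<in>\<Delta> \<inter> L. f x)"

definition good :: "('a \<Rightarrow> complex) \<Rightarrow> bool" where "good f \<longleftrightarrow> (\<exists>ws. represents ws f)"

lemma representsD:
  assumes "represents ws f"
  shows "continuous_on UNIV f"
      "\<forall>(W, b)\<in>set ws. continuous_on {0..1} W \<and> (\<forall>l. continuous_on {0..1} (b l))"
      "\<And>h. small h \<Longrightarrow> (LINT x:\<Delta>h h|lattice_lborel L. f x) =
         (\<Sum>(W, b)\<leftarrow>ws. integral {0..1} (\<lambda>t. W t * exp (\<Sum>l=1..d. b l t * of_real (h l))))"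
      "(\<lambda>k. \<Sum>(W, b)\<leftarrow>ws. integral {0..1} (\<lambda>t. W t * homog k (\<lambda>l. b l t))) sums (\<Sum>x\<in>\<Delta> \<inter> L. f x)"
  using assms unfolding represents_def by simp_all

lemma represents_zero: "represents [] (\<lambda>_. 0)"
  unfolding represents_def by (auto simp: set_lebesgue_integral_def)

lemma represents_add:
  assumes "represents ws f" "represents vs g"
  shows "represents (ws @ vs) (\<lambda>x. f x + g x)"
proof -
  note f = representsD[OF assms(1)] and g = representsD[OF assms(2)]
  have cont: "continuous_on UNIV (\<lambda>x. f x + g x)" by (intro continuous_intros f(1) g(1))
  have int: "(LINT x:\<Delta>h h|lattice_lborel L. f x + g x) = (LINT x:\<Delta>h h|lattice_lborel L. f x) + (LINT x:\<Delta>h h|lattice_lborel L. g x)"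
    if h: "small h" for h
    unfolding set_integral_lattice_lborel[OF f(1) h] set_integral_lattice_lborel[OF g(1) h] set_integral_lattice_lborel[OF cont h]
      scaleR_add_right Bochner_Integration.integral_add[OF integrable_\<Delta>h[OF f(1) h] integrable_\<Delta>h[OF g(1) h]]
    by (rule distrib_left)
  show ?thesis
    unfolding represents_def
  proof (intro conjI cont)
    show "\<forall>(W, b)\<in>set (ws @ vs). continuous_on {0..1} W \<and> (\<forall>l. continuous_on {0..1} (b l))"
      using f(2) g(2) by auto
    show "\<forall>h. small h \<longrightarrow> (LINT x:\<Delta>h h|lattice_lborel L. f x + g x) =
         (\<Sum>(W, b)\<leftarrow>ws @ vs. integral {0..1} (\<lambda>t. W t * exp (\<Sum>l=1..d. b l t * of_real (h l))))"
      using f(3) g(3) int by simp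
    show "(\<lambda>k. \<Sum>(W, b)\<leftarrow>ws @ vs. integral {0..1} (\<lambda>t. W t * homog k (\<lambda>l. b l t))) sums (\<Sum>x\<in>\<Delta> \<inter> L. f x + g x)"
      using sums_add[OF f(4) g(4)] by (simp add: sum.distrib)
  qed
qed

lemma represents_cmult:
  assumes "represents ws f"
  shows "represents (map (\<lambda>(W, b). (\<lambda>t. a * W t, b)) ws) (\<lambda>x. a * f x)"
proof -
  note f = representsD[OF assms]
  let ?vs = "map (\<lambda>(W, b). (\<lambda>t. a * W t, b)) ws"
  have lin: "(\<Sum>(W, b)\<leftarrow>?vs. integral {0..1} (\<lambda>t. W t * E b t)) = a * (\<Sum>(W, b)\<leftarrow>ws. integral {0..1} (\<lambda>t. W t * E b t))" for E
    by (simp add: o_def case_prod_unfold mult.assoc sum_list_const_mult)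
  show ?thesis
    unfolding represents_def
  proof (intro conjI)
    show "continuous_on UNIV (\<lambda>x. a * f x)" by (intro continuous_intros f(1))
    show "\<forall>(W, b)\<in>set ?vs. continuous_on {0..1} W \<and> (\<forall>l. continuous_on {0..1} (b l))"
      using f(2) by (auto intro!: continuous_intros)
    show "\<forall>h. small h \<longrightarrow> (LINT x:\<Delta>h h|lattice_lborel L. a * f x) =
         (\<Sum>(W, b)\<leftarrow>?vs. integral {0..1} (\<lambda>t. W t * exp (\<Sum>l=1..d. b l t * of_real (h l))))"
      unfolding lin[of "\<lambda>b t. exp (\<Sum>l=1..d. b l t * of_real (h l))" for h] using f(3) by simp
    show "(\<lambda>k. \<Sum>(W, b)\<leftarrow>?vs. integral {0..1} (\<lambda>t. W t * homog k (\<lambda>l. b l t))) sums (\<Sum>x\<in>\<Delta> \<inter> L. a * f x)"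
      unfolding lin[of "\<lambda>b t. homog k (\<lambda>l. b l t)" for k] sum_distrib_left[symmetric] by (rule sums_mult[OF f(4)])
  qed
qed

lemma good_zero: "good (\<lambda>_. 0)" and good_add: "good f \<Longrightarrow> good g \<Longrightarrow> good (\<lambda>x. f x + g x)"
  and good_cmult: "good f \<Longrightarrow> good (\<lambda>x. a * f x)"
  unfolding good_def using represents_zero represents_add represents_cmult by blast+

lemma good_sum:
  assumes "finite A" "\<And>i. i \<in> A \<Longrightarrow> good (f i)"
  shows "good (\<lambda>x. \<Sum>i\<in>A. f i x)"
  using assms by (induction A rule: finite_induct) (auto intro: good_add good_zero)


text \<open>Fubini on \<open>\<Delta>h h\<close> times the circle: the exponents on the circle
  vanish on no edge, so Brion's formula applies to each of them, even where it does not apply to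
  \<xi>.\<close>

lemma integral_power_exp:
  fixes \<xi> :: "'a \<Rightarrow> complex"
  assumes h: "small h" and lin: "linear \<xi>" and r: "r > 0"
    and ne: "\<And>t v j. v \<in> verts \<Longrightarrow> j \<in> idx v \<Longrightarrow> \<xi> (\<alpha> v j) + circ r t * of_real (\<eta> \<bullet> \<alpha> v j) \<noteq> 0"
  shows "(LINT x|lborel. indicator (\<Delta>h h) x *\<^sub>R (of_real ((\<eta> \<bullet> x) ^ m) * exp (\<xi> x))) =
    integral {0..1} (\<lambda>t. fact m / circ r t ^ m *
      (\<Sum>v\<in>verts. exp (\<xi> (vh h v) + circ r t * of_real (\<eta> \<bullet> vh h v)) * of_real (cell_vol v) *
        (\<Prod>j\<in>idx v. - 1 / (\<xi> (\<alpha> v j) + circ r t * of_real (\<eta> \<bullet> \<alpha> v j)))))"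
proof -
  let ?e = "\<lambda>t x. \<xi> x + circ r t * of_real (\<eta> \<bullet> x)"
  let ?w = "\<lambda>t. fact m / circ r t ^ m"
  let ?D = "\<Delta>h h"
  have cont\<xi>: "continuous_on A \<xi>" for A
    using lin by (auto intro: linear_continuous_on simp: linear_conv_bounded_linear)
  have wc: "continuous_on A ?w" for A
    using circ_nonzero[OF r] by (intro continuous_intros continuous_circ) auto
  have pe: "of_real ((\<eta> \<bullet> x) ^ m) * exp (\<xi> x) = (LINT t|lborel. indicator {0..1} t *\<^sub>R (?w t * exp (?e t x)))" for x
  proof -
    have c: "continuous_on {0..1} (\<lambda>t. ?w t * exp (?e t x))"
      by (intro continuous_intros wc continuous_circ)
    have "(LINT t|lborel. indicator {0..1} t *\<^sub>R (?w t * exp (?e t x))) = integral {0..1} (\<lambda>t. ?w t * exp (?e t x))"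
      using set_borel_integral_eq_integral(2)[of "{0..1}" "\<lambda>t. ?w t * exp (?e t x)"] borel_integrable_compact[OF _ c]
      by (simp add: set_integrable_def set_lebesgue_integral_def)
    also have "\<dots> = integral {0..1} (\<lambda>t. exp (\<xi> x) * (?w t * exp (of_real (\<eta> \<bullet> x) * circ r t)))"
      by (simp add: exp_add mult_ac)
    also have "\<dots> = exp (\<xi> x) * of_real (\<eta> \<bullet> x) ^ m"
      by (simp only: integral_mult_right power_as_circle_integral[OF r])
    finally show ?thesis by simp
  qed
  define g where "g x t = indicator (?D \<times> {0..1}) (x, t) *\<^sub>R (?w t * exp (?e t x))" for x and t :: real
  have gx: "g x t = indicator ?D x *\<^sub>R (indicator {0..1} t *\<^sub>R (?w t * exp (?e t x)))"
    and gt: "g x t = indicator {0..1} t *\<^sub>R (?w t * (indicator ?D x *\<^sub>R exp (?e t x)))" for x t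
    by (auto simp: g_def indicator_def)
  have w2: "continuous_on A (\<lambda>p. ?w (snd p))" for A :: "('a \<times> real) set"
    by (rule continuous_on_compose2[OF wc[of UNIV]]) (auto intro: continuous_intros)
  have c2: "continuous_on A (\<lambda>p. circ r (snd p))" for A :: "('a \<times> real) set"
    by (rule continuous_on_compose2[OF continuous_circ[of UNIV]]) (auto intro: continuous_intros)
  have x2: "continuous_on A (\<lambda>p. \<xi> (fst p))" for A :: "('a \<times> real) set"
    by (rule continuous_on_compose2[OF cont\<xi>[of UNIV]]) (auto intro: continuous_intros)
  have "integrable lborel (\<lambda>p. indicator (?D \<times> {0..1}) p *\<^sub>R (?w (snd p) * exp (?e (snd p) (fst p))))"
    by (intro borel_integrable_compact compact_Times compact_\<Delta>h h compact_Icc continuous_intros w2 c2 x2)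
  then have "integrable (lborel \<Otimes>\<^sub>M lborel) (case_prod g)"
    by (simp add: lborel_prod g_def case_prod_beta')
  then have "(LINT t|lborel. LINT x|lborel. g x t) = (LINT x|lborel. LINT t|lborel. g x t)"
    by (rule lborel_pair.Fubini_integral)
  moreover have "(LINT t|lborel. g x t) = indicator ?D x *\<^sub>R (of_real ((\<eta> \<bullet> x) ^ m) * exp (\<xi> x))" for x
    unfolding gx pe by (rule integral_scaleR_right)
  moreover have "(LINT x|lborel. g x t) = indicator {0..1} t *\<^sub>R (?w t *
      (\<Sum>v\<in>verts. exp (?e t (vh h v)) * of_real (cell_vol v) * (\<Prod>j\<in>idx v. - 1 / ?e t (\<alpha> v j))))" for t
  proof -
    have "linear (?e t)"
      by (rule linearI) (auto simp: linear_add[OF lin] linear_cmul[OF lin] inner_add_right algebra_simps scaleR_conv_of_real)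
    from integral_exp[OF h this ne] show ?thesis
      unfolding gt by (simp only: integral_scaleR_right integral_mult_right_zero)
  qed
  ultimately have "(LINT x|lborel. indicator ?D x *\<^sub>R (of_real ((\<eta> \<bullet> x) ^ m) * exp (\<xi> x))) =
    (LINT t|lborel. indicator {0..1} t *\<^sub>R (?w t *
      (\<Sum>v\<in>verts. exp (?e t (vh h v)) * of_real (cell_vol v) * (\<Prod>j\<in>idx v. - 1 / ?e t (\<alpha> v j)))))"
    by (simp only:)
  also have "\<dots> = integral {0..1} (\<lambda>t. ?w t * (\<Sum>v\<in>verts. exp (?e t (vh h v)) * of_real (cell_vol v) * (\<Prod>j\<in>idx v. - 1 / ?e t (\<alpha> v j))))"
    (is "_ = integral _ ?H")
  proof -
    have "continuous_on {0..1} ?H"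
      using ne by (intro continuous_intros wc continuous_circ) auto
    then show ?thesis
      using set_borel_integral_eq_integral(2)[of "{0..1}" ?H] borel_integrable_compact[of "{0..1}" ?H]
      by (simp add: set_integrable_def set_lebesgue_integral_def)
  qed
  finally show ?thesis .
qed

text \<open>The bounds \<beta> do not depend on t and lie below the radii of convergence, so one
  summable majorant serves all t and the series may be integrated termwise.\<close>

lemma homog_vertex_sums:
  fixes W :: "real \<Rightarrow> complex" and b :: "nat \<Rightarrow> real \<Rightarrow> complex"
  assumes v: "v \<in> verts" and b0: "\<And>t i. i \<in> {1..d} - idx v \<Longrightarrow> b i t = 0"
    and cont: "\<And>i. continuous_on {0..1} (b i)" and W: "continuous_on {0..1} W"
    and \<beta>: "\<And>t i. i \<in> idx v \<Longrightarrow> norm (b i t) \<le> \<beta> i"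
    and rad: "\<And>i y. i \<in> idx v \<Longrightarrow> y \<in> reps v \<Longrightarrow> \<beta> i < radius (y \<bullet> \<alpha> v i)"
  shows "(\<lambda>k. integral {0..1} (\<lambda>t. W t * homog k (\<lambda>l. b l t))) sums
    integral {0..1} (\<lambda>t. W t * (\<Sum>y\<in>reps v. e1 (y \<bullet> v) * (\<Prod>i=1..d. todd_factor (e1 (chi v y i)) (b i t))))"
proof -
  let ?\<beta> = "\<lambda>i. if i \<in> idx v then \<beta> i else 0"
  let ?A = "\<lambda>y i n. norm (todd_coeff (e1 (chi v y i)) n) * ?\<beta> i ^ n"
  have homog: "homog k (\<lambda>l. b l t) = (\<Sum>y\<in>reps v. e1 (y \<bullet> v) * (\<Sum>m\<in>multi_indices d k. \<Prod>i=1..d. todd_coeff (e1 (chi v y i)) (m i) * b i t ^ m i))" for k t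
    unfolding homog_def by (rule Todd_homogeneous_at_vertex[OF v b0])
  have nb: "norm (b i t) \<le> ?\<beta> i" if "i \<in> {1..d}" for i t using b0[of i t] \<beta>[of i t] that by auto
  have \<beta>0: "0 \<le> ?\<beta> i" if "i \<in> {1..d}" for i using nb[OF that, of 0] norm_ge_zero order_trans by blast
  have \<beta>r: "?\<beta> i < radius (chi v y i)" if "y \<in> reps v" for y i
    using rad[of i y] that radius_pos[of 0] by (auto simp: chi_def)
  have sumA: "summable (?A y i)" if "y \<in> reps v" "i \<in> {1..d}" for y i
    using todd_coeff_summable[of "chi v y i" "of_real (?\<beta> i)"] chi_range[OF v that(1), of i] \<beta>r[OF that(1), of i] \<beta>0[OF that(2)]
    by simp
  have "bounded (W ` {0..1})"
    by (rule compact_imp_bounded[OF compact_continuous_image[OF W]]) simp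
  then obtain K where K: "\<And>t. t \<in> {0..1} \<Longrightarrow> norm (W t) \<le> K"
    unfolding bounded_iff by blast
  let ?M = "\<lambda>k. K * (\<Sum>y\<in>reps v. \<Sum>m\<in>multi_indices d k. \<Prod>i=1..d. norm (todd_coeff (e1 (chi v y i)) (m i)) * ?\<beta> i ^ m i)"
  show ?thesis
  proof (rule integral_sums_uniform)
    show "continuous_on {0..1} (\<lambda>t. W t * homog k (\<lambda>l. b l t))" for k
      unfolding homog_def by (intro continuous_intros W cont)
    have "summable (\<lambda>k. \<Sum>m\<in>multi_indices d k. \<Prod>i=1..d. ?A y i (m i))" if "y \<in> reps v" for y
    proof -
      \<comment> \<open>Absolute values provide the nonnegativity at every index, also outside
        \<open>{1..d}\<close>, that \<open>summable_multi_indices\<close> asks for.\<close>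
      have "summable (\<lambda>k. \<Sum>m\<in>multi_indices d k. \<Prod>i=1..d. \<bar>?A y i (m i)\<bar>)"
        by (rule summable_multi_indices) (use sumA[OF that] \<beta>0 in \<open>auto simp: abs_mult\<close>)
      moreover have "(\<Prod>i=1..d. \<bar>?A y i (m i)\<bar>) = (\<Prod>i=1..d. ?A y i (m i))" for m
        using \<beta>0 by (intro prod.cong refl) (simp add: abs_mult)
      ultimately show ?thesis by (simp only:)
    qed
    then show "summable ?M" by (intro summable_mult summable_sum)
    show "norm (W t * homog k (\<lambda>l. b l t)) \<le> ?M k" if t: "t \<in> {0..1}" for k t
    proof -
      have "norm (homog k (\<lambda>l. b l t)) \<le> (\<Sum>y\<in>reps v. \<Sum>m\<in>multi_indices d k. \<Prod>i=1..d. ?A y i (m i))"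
        unfolding homog
      proof (rule sum_norm_le)
        fix y assume "y \<in> reps v"
        have "norm (\<Sum>m\<in>multi_indices d k. \<Prod>i=1..d. todd_coeff (e1 (chi v y i)) (m i) * b i t ^ m i)
          \<le> (\<Sum>m\<in>multi_indices d k. \<Prod>i=1..d. ?A y i (m i))"
        proof (rule norm_sum_multi_indices_le[of d "\<lambda>i n. todd_coeff (e1 (chi v y i)) n * b i t ^ n"])
          fix i n assume i: "i \<in> {1..d}"
          show "norm (todd_coeff (e1 (chi v y i)) n * b i t ^ n) \<le> ?A y i n"
            unfolding norm_mult norm_power by (intro mult_left_mono power_mono nb i norm_ge_zero)
        qed
        then show "norm (e1 (y \<bullet> v) * (\<Sum>m\<in>multi_indices d k. \<Prod>i=1..d. todd_coeff (e1 (chi v y i)) (m i) * b i t ^ m i))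
          \<le> (\<Sum>m\<in>multi_indices d k. \<Prod>i=1..d. ?A y i (m i))"
          by (simp only: norm_mult norm_e1 mult_1)
      qed
      then show ?thesis unfolding norm_mult
        by (intro mult_mono K t order_trans[OF norm_ge_zero K[OF t]]) auto
    qed
    show "(\<lambda>k. W t * homog k (\<lambda>l. b l t)) sums (W t * (\<Sum>y\<in>reps v. e1 (y \<bullet> v) * (\<Prod>i=1..d. todd_factor (e1 (chi v y i)) (b i t))))" for t
      unfolding homog
    proof (intro sums_mult sums_sum)
      fix y assume y: "y \<in> reps v"
      show "(\<lambda>k. \<Sum>m\<in>multi_indices d k. \<Prod>i=1..d. todd_coeff (e1 (chi v y i)) (m i) * b i t ^ m i) sums
        (\<Prod>i=1..d. todd_factor (e1 (chi v y i)) (b i t))"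
      proof (rule sums_multi_indices)
        fix i assume i: "i \<in> {1..d}"
        have "norm (b i t) < radius (chi v y i)" using nb[OF i, of t] \<beta>r[OF y, of i] by simp
        then show "summable (\<lambda>n. norm (todd_coeff (e1 (chi v y i)) n * b i t ^ n))"
          "(\<lambda>n. todd_coeff (e1 (chi v y i)) n * b i t ^ n) sums todd_factor (e1 (chi v y i)) (b i t)"
          using todd_coeff_summable[of "chi v y i" "b i t"] todd_coeff_sums[of "chi v y i" "b i t"] chi_range[OF v y, of i]
          by (auto simp: norm_mult norm_power)
      qed
    qed
  qed
qed

text \<open>The numerators \<open>- z j\<close> of the Todd factors cancel the poles
  \<open>- 1 / z j\<close> of the integral; at the inactive indices the factor is
  \<open>todd_factor 1 0 = 1\<close>.\<close>

lemma prod_todd_factor_vertex: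
  assumes v: "v \<in> verts" and y: "y \<in> reps v"
    and z: "\<And>j. j \<in> idx v \<Longrightarrow> z j \<noteq> 0"
  shows "(\<Prod>j\<in>idx v. - 1 / z j) * (\<Prod>i=1..d. todd_factor (e1 (chi v y i)) (if i \<in> idx v then - z i else 0)) =
    (\<Prod>j\<in>idx v. 1 / (1 - e1 (y \<bullet> \<alpha> v j) * exp (z j)))"
proof -
  have sub: "idx v \<subseteq> {1..d}" by (auto simp: idx_def)
  have "(\<Prod>i=1..d. todd_factor (e1 (chi v y i)) (if i \<in> idx v then - z i else 0)) =
    (\<Prod>i\<in>idx v. todd_factor (e1 (chi v y i)) (if i \<in> idx v then - z i else 0))"
    using sub by (intro prod.mono_neutral_right) (auto simp: chi_def todd_factor_def)
  also have "\<dots> = (\<Prod>i\<in>idx v. - z i / (1 - e1 (y \<bullet> \<alpha> v i) * exp (z i)))"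
    by (intro prod.cong refl) (use z in \<open>auto simp: chi_def todd_factor_def\<close>)
  finally show ?thesis
    by (simp only: prod.distrib[symmetric]) (intro prod.cong refl, use z in \<open>auto simp: field_simps\<close>)
qed

text \<open>Joins the two formulas of Brion: on the circle the operator turns the vertex terms of
  the integral into those of the lattice sum, and integrating over the circle recovers the power of
  \<eta> on both sides.\<close>

lemma good_power_exp:
  fixes \<xi> :: "'a \<Rightarrow> complex"
  assumes lin: "linear \<xi>" and adm: "admissible_exponent L \<Delta> d u c \<xi>" and \<eta>: "generic \<eta>"
  shows "good (\<lambda>x. of_real ((\<eta> \<bullet> x) ^ m) * exp (\<xi> x))"
proof -
  obtain r where r: "r > 0"
    and r1: "\<And>v j. v \<in> verts \<Longrightarrow> j \<in> idx v \<Longrightarrow> \<xi> (\<alpha> v j) \<noteq> 0 \<Longrightarrow> r * \<bar>\<eta> \<bullet> \<alpha> v j\<bar> < norm (\<xi> (\<alpha> v j))"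
    and r2: "\<And>v j y. v \<in> verts \<Longrightarrow> j \<in> idx v \<Longrightarrow> y \<in> reps v \<Longrightarrow> norm (\<xi> (\<alpha> v j)) + r * \<bar>\<eta> \<bullet> \<alpha> v j\<bar> < radius (y \<bullet> \<alpha> v j)"
    by (rule circle_radius_exists[OF adm \<eta>]) blast
  define e where "e t x = \<xi> x + circ r t * of_real (\<eta> \<bullet> x)" for t x
  define w where "w t = fact m / circ r t ^ m" for t
  have lin_e: "linear (e t)" for t
    unfolding e_def
    by (rule linearI) (auto simp: linear_add[OF lin] linear_cmul[OF lin] inner_add_right algebra_simps scaleR_conv_of_real)
  have norm_e: "norm (e t (\<alpha> v j)) \<le> norm (\<xi> (\<alpha> v j)) + r * \<bar>\<eta> \<bullet> \<alpha> v j\<bar>" for t v j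
    using norm_triangle_ineq[of "\<xi> (\<alpha> v j)" "circ r t * of_real (\<eta> \<bullet> \<alpha> v j)"] by (simp add: e_def norm_mult norm_circ[OF r])
  have ne: "e t (\<alpha> v j) \<noteq> 0" if "v \<in> verts" "j \<in> idx v" for t v j
  \<comment> \<open>If \<xi> vanishes on the edge, genericity of \<eta> keeps the circle off 0;
    otherwise the circle is too small to reach 0.\<close>
  proof (cases "\<xi> (\<alpha> v j) = 0")
    case True
    then show ?thesis using \<eta> that circ_nonzero[OF r] by (auto simp: e_def generic_def)
  next
    case False
    show ?thesis
    proof
      assume "e t (\<alpha> v j) = 0"
      then have "\<xi> (\<alpha> v j) = - (circ r t * of_real (\<eta> \<bullet> \<alpha> v j))" by (simp add: e_def eq_neg_iff_add_eq_0)
      then have "norm (\<xi> (\<alpha> v j)) = r * \<bar>\<eta> \<bullet> \<alpha> v j\<bar>" by (simp add: norm_mult norm_circ[OF r])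
      then show False using r1[OF that False] by simp
    qed
  qed
  have e_cont: "continuous_on A (\<lambda>t. e t x)" for A x
    unfolding e_def by (intro continuous_intros continuous_circ)
  have w_cont: "continuous_on A w" for A
    unfolding w_def using circ_nonzero[OF r] by (intro continuous_intros continuous_circ) auto
  \<comment> \<open>By definition of \<open>vh\<close>, the exponent at the shifted vertex is
    \<open>e t v\<close> minus the sum of the \<open>h l * e t (\<alpha> v l)\<close>; hence the
    sign.\<close>
  define b where "b v l t = (if l \<in> idx v then - e t (\<alpha> v l) else 0)" for v l t
  \<comment> \<open>The division by \<open>card (reps v)\<close> is the cell volume divided by the
    covolume.\<close>
  define W where "W v t = w t * (exp (e t v) / of_nat (card (reps v))) * (\<Prod>j\<in>idx v. - 1 / e t (\<alpha> v j))" for v t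
  have b_cont: "continuous_on A (b v l)" for A v l
    unfolding b_def by (cases "l \<in> idx v") (auto intro!: continuous_intros e_cont)
  have W_cont: "continuous_on A (W v)" if "v \<in> verts" for A v
    unfolding W_def using ne[OF that] card_reps_pos[OF that]
    by (intro continuous_intros e_cont w_cont) auto
  have repr: "of_real ((\<eta> \<bullet> x) ^ m) * exp (\<xi> x) = integral {0..1} (\<lambda>t. w t * exp (e t x))" for x
  proof -
    have "integral {0..1} (\<lambda>t. w t * exp (e t x)) = integral {0..1} (\<lambda>t. exp (\<xi> x) * (w t * exp (of_real (\<eta> \<bullet> x) * circ r t)))"
      by (simp add: e_def exp_add mult_ac)
    also have "\<dots> = exp (\<xi> x) * of_real (\<eta> \<bullet> x) ^ m"
      by (simp only: integral_mult_right w_def power_as_circle_integral[OF r])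
    finally show ?thesis by simp
  qed
  obtain vs where vs: "set vs = verts" "distinct vs" using finite_distinct_list[OF finite_verts] by blast
  let ?ws = "map (\<lambda>v. (W v, b v)) vs"
  have list: "(\<Sum>(W, b)\<leftarrow>?ws. G W b) = (\<Sum>v\<in>verts. G (W v) (b v))" for G :: "(real \<Rightarrow> complex) \<Rightarrow> (nat \<Rightarrow> real \<Rightarrow> complex) \<Rightarrow> complex"
    using vs by (simp add: o_def sum_list_distinct_conv_sum_set)
  have cf: "continuous_on UNIV (\<lambda>x. of_real ((\<eta> \<bullet> x) ^ m) * exp (\<xi> x))"
    using lin by (intro continuous_intros linear_continuous_on) (simp add: linear_conv_bounded_linear)
  have "represents ?ws (\<lambda>x. of_real ((\<eta> \<bullet> x) ^ m) * exp (\<xi> x))"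
    unfolding represents_def list
  proof (intro conjI cf allI impI)
    show "\<forall>(W, b)\<in>set ?ws. continuous_on {0..1} W \<and> (\<forall>l. continuous_on {0..1} (b l))"
      using vs W_cont b_cont by auto
  next
    fix h assume h: "small h"
    let ?S = "\<lambda>v t. exp (\<Sum>l=1..d. b v l t * of_real (h l))"
    have vhe: "exp (e t (vh h v)) = exp (e t v) * ?S v t" for v t
    proof -
      have "(\<Sum>l=1..d. b v l t * of_real (h l)) = (\<Sum>l\<in>idx v. - (e t (\<alpha> v l) * of_real (h l)))"
        by (intro sum.mono_neutral_cong_right) (auto simp: b_def idx_def)
      moreover have "e t (vh h v) = e t v - (\<Sum>l\<in>idx v. of_real (h l) * e t (\<alpha> v l))"
        by (simp add: vh_def linear_diff[OF lin_e] linear_sum[OF lin_e] linear_cmul[OF lin_e] scaleR_conv_of_real)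
      ultimately show ?thesis by (simp add: exp_add[symmetric] sum_negf mult.commute)
    qed
    have "(LINT x:\<Delta>h h|lattice_lborel L. of_real ((\<eta> \<bullet> x) ^ m) * exp (\<xi> x)) =
      of_real (1 / covolume L) * integral {0..1} (\<lambda>t. w t * (\<Sum>v\<in>verts. exp (e t (vh h v)) * of_real (cell_vol v) * (\<Prod>j\<in>idx v. - 1 / e t (\<alpha> v j))))"
      unfolding set_integral_lattice_lborel[OF cf h] w_def e_def
      by (subst integral_power_exp[OF h lin r]) (use ne in \<open>simp_all add: e_def\<close>)
    also have "\<dots> = integral {0..1} (\<lambda>t. of_real (1 / covolume L) * (w t * (\<Sum>v\<in>verts. exp (e t (vh h v)) * of_real (cell_vol v) * (\<Prod>j\<in>idx v. - 1 / e t (\<alpha> v j)))))"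
      by (rule integral_mult_right[symmetric])
    also have "\<dots> = integral {0..1} (\<lambda>t. \<Sum>v\<in>verts. W v t * ?S v t)"
    proof (rule integral_cong)
      fix t
      have "of_real (1 / covolume L) * (w t * (exp (e t (vh h v)) * of_real (cell_vol v) * (\<Prod>j\<in>idx v. - 1 / e t (\<alpha> v j)))) = W v t * ?S v t"
        if v: "v \<in> verts" for v
      proof -
        have "cell_vol v / covolume L = 1 / real (card (reps v))"
        proof -
          have "cell_vol v \<noteq> 0" using covolume_index[OF v] covolume_pos by auto
          then show ?thesis using covolume_index[OF v] by simp
        qed
        moreover have "of_real (1 / covolume L) * of_real (cell_vol v) = (of_real (cell_vol v / covolume L) :: complex)"
          by simp
        ultimately have cv: "of_real (1 / covolume L) * of_real (cell_vol v) = (1 / of_nat (card (reps v)) :: complex)"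
          by simp
        have "of_real (1 / covolume L) * (w t * (exp (e t (vh h v)) * of_real (cell_vol v) * (\<Prod>j\<in>idx v. - 1 / e t (\<alpha> v j))))
          = w t * exp (e t (vh h v)) * (of_real (1 / covolume L) * of_real (cell_vol v)) * (\<Prod>j\<in>idx v. - 1 / e t (\<alpha> v j))"
          by (simp only: mult_ac)
        also have "\<dots> = W v t * ?S v t" unfolding cv W_def vhe by (simp add: mult_ac)
        finally show ?thesis .
      qed
      then show "of_real (1 / covolume L) * (w t * (\<Sum>v\<in>verts. exp (e t (vh h v)) * of_real (cell_vol v) * (\<Prod>j\<in>idx v. - 1 / e t (\<alpha> v j)))) =
        (\<Sum>v\<in>verts. W v t * ?S v t)"
        unfolding sum_distrib_left by (intro sum.cong refl)
    qed
    also have "\<dots> = (\<Sum>v\<in>verts. integral {0..1} (\<lambda>t. W v t * ?S v t))"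
      by (intro integral_sum finite_verts integrable_continuous_interval continuous_intros W_cont b_cont)
    finally show "(LINT x:\<Delta>h h|lattice_lborel L. of_real ((\<eta> \<bullet> x) ^ m) * exp (\<xi> x)) =
      (\<Sum>v\<in>verts. integral {0..1} (\<lambda>t. W v t * ?S v t))" .
  next
    let ?T = "\<lambda>v t. \<Sum>y\<in>reps v. e1 (y \<bullet> v) * (\<Prod>i=1..d. todd_factor (e1 (chi v y i)) (b v i t))"
    have "(\<lambda>k. \<Sum>v\<in>verts. integral {0..1} (\<lambda>t. W v t * homog k (\<lambda>l. b v l t))) sums
      (\<Sum>v\<in>verts. integral {0..1} (\<lambda>t. W v t * ?T v t))"
    proof (rule sums_sum)
      fix v assume v: "v \<in> verts"
      show "(\<lambda>k. integral {0..1} (\<lambda>t. W v t * homog k (\<lambda>l. b v l t))) sums integral {0..1} (\<lambda>t. W v t * ?T v t)"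
        by (rule homog_vertex_sums[OF v, where \<beta> = "\<lambda>j. norm (\<xi> (\<alpha> v j)) + r * \<bar>\<eta> \<bullet> \<alpha> v j\<bar>"])
          (use norm_e r2[OF v] b_cont W_cont[OF v] in \<open>auto simp: b_def\<close>)
    qed
    moreover have WT: "W v t * ?T v t = w t * (exp (e t v) / of_nat (card (reps v)) * (\<Sum>y\<in>reps v. e1 (y \<bullet> v) *
       (\<Prod>j\<in>idx v. 1 / (1 - e1 (y \<bullet> \<alpha> v j) * exp (e t (\<alpha> v j))))))" if v: "v \<in> verts" for v t
    proof -
      let ?P = "\<Prod>j\<in>idx v. - 1 / e t (\<alpha> v j)"
      have "?P * ?T v t = (\<Sum>y\<in>reps v. e1 (y \<bullet> v) * (?P * (\<Prod>i=1..d. todd_factor (e1 (chi v y i)) (b v i t))))"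
        by (simp only: sum_distrib_left mult_ac)
      also have "\<dots> = (\<Sum>y\<in>reps v. e1 (y \<bullet> v) * (\<Prod>j\<in>idx v. 1 / (1 - e1 (y \<bullet> \<alpha> v j) * exp (e t (\<alpha> v j)))))"
        unfolding b_def by (intro sum.cong refl arg_cong2[where f = "(*)"] prod_todd_factor_vertex ne v)
      finally show ?thesis unfolding W_def by (simp only: mult.assoc)
    qed
    have "(\<Sum>v\<in>verts. integral {0..1} (\<lambda>t. W v t * ?T v t)) = (\<Sum>x\<in>\<Delta> \<inter> L. of_real ((\<eta> \<bullet> x) ^ m) * exp (\<xi> x))"
    proof -
      \<comment> \<open>On the circle \<open>- e t (\<alpha> v j)\<close> is nonzero and lies within
        the radius, where the denominator can vanish only at the origin.\<close>
      have pole: "e1 (y \<bullet> \<alpha> v j) * exp (e t (\<alpha> v j)) \<noteq> 1" if "v \<in> verts" "j \<in> idx v" "y \<in> reps v" for v j y t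
      proof
        assume eq: "e1 (y \<bullet> \<alpha> v j) * exp (e t (\<alpha> v j)) = 1"
        have "norm (- e t (\<alpha> v j)) < radius (y \<bullet> \<alpha> v j)" using norm_e[of t v j] r2[OF that] by simp
        then have "- e t (\<alpha> v j) = 0"
          using todd_pole[of "y \<bullet> \<alpha> v j" "- e t (\<alpha> v j)"] eq that by (auto simp: reps_def)
        then show False using ne that by auto
      qed
      have "continuous_on {0..1} (\<lambda>t. W v t * ?T v t)" if v: "v \<in> verts" for v
        unfolding WT[OF v] using pole[OF v] card_reps_pos[OF v] by (intro continuous_intros w_cont e_cont) auto
      then have "(\<Sum>v\<in>verts. integral {0..1} (\<lambda>t. W v t * ?T v t)) = integral {0..1} (\<lambda>t. \<Sum>v\<in>verts. W v t * ?T v t)"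
        by (intro integral_sum[symmetric] finite_verts integrable_continuous_interval)
      also have "\<dots> = integral {0..1} (\<lambda>t. \<Sum>x\<in>\<Delta> \<inter> L. w t * exp (e t x))"
      proof (rule integral_cong)
        fix t
        have ls: "(\<Sum>x\<in>\<Delta> \<inter> L. exp (e t x)) = (\<Sum>v\<in>verts. exp (e t v) / of_nat (card (reps v)) * (\<Sum>y\<in>reps v. e1 (y \<bullet> v) *
          (\<Prod>j\<in>idx v. 1 / (1 - e1 (y \<bullet> \<alpha> v j) * exp (e t (\<alpha> v j))))))"
          by (rule lattice_sum[OF lin_e]) (rule pole)
        have "(\<Sum>v\<in>verts. W v t * ?T v t) = w t * (\<Sum>x\<in>\<Delta> \<inter> L. exp (e t x))"
          unfolding ls sum_distrib_left[where r = "w t"] by (intro sum.cong refl WT)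
        then show "(\<Sum>v\<in>verts. W v t * ?T v t) = (\<Sum>x\<in>\<Delta> \<inter> L. w t * exp (e t x))" by (simp only: sum_distrib_left)
      qed
      also have "\<dots> = (\<Sum>x\<in>\<Delta> \<inter> L. integral {0..1} (\<lambda>t. w t * exp (e t x)))"
        by (intro integral_sum finite_\<Delta>_L integrable_continuous_interval continuous_intros w_cont e_cont)
      finally show ?thesis by (simp only: repr)
    qed
    ultimately show "(\<lambda>k. \<Sum>v\<in>verts. integral {0..1} (\<lambda>t. W v t * homog k (\<lambda>l. b v l t))) sums
      (\<Sum>x\<in>\<Delta> \<inter> L. of_real ((\<eta> \<bullet> x) ^ m) * exp (\<xi> x))" by simp
  qed
  then show ?thesis by (auto simp: good_def)
qed

lemma good_powers_span_exp:
  assumes "p \<in> powers_span" and "linear \<xi>" "admissible_exponent L \<Delta> d u c \<xi>"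
  shows "good (\<lambda>x. p x * exp (\<xi> x))"
  using assms(1)
proof (induction rule: powers_span.induct)
  case zero
  then show ?case using good_zero by simp
next
  case (step f \<eta> a m)
  have "good (\<lambda>x. a * (of_real ((\<eta> \<bullet> x) ^ m) * exp (\<xi> x)) + f x * exp (\<xi> x))"
    by (intro good_add good_cmult good_power_exp step assms)
  then show ?case by (simp add: distrib_right mult.assoc)
qed

lemma good_quasi_polynomial:
  assumes "quasi_polynomial (admissible_exponent L \<Delta> d u c) f"
  shows "good f"
proof -
  obtain N :: nat and a p \<xi> where *: "\<And>k. k < N \<Longrightarrow> polynomial_function (p k) \<and> linear (\<xi> k) \<and> admissible_exponent L \<Delta> d u c (\<xi> k)"
    and f: "f = (\<lambda>x. \<Sum>k<N. a k * (p k x * exp (\<xi> k x)))"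
    using assms unfolding quasi_polynomial_def by blast
  show ?thesis unfolding f
    by (intro good_sum good_cmult good_powers_span_exp polynomial_powers_span) (use * in auto)
qed

text \<open>At h = 0 the derivative with multi-index m puts the monomial in b under the integral;
  summed against the Taylor coefficients these monomials give \<open>homog k\<close>, and the
  resulting series is the one controlled by \<open>represents\<close>.\<close>

lemma diff_op_term_sums:
  assumes "good f"
  shows "diff_op_term d (Todd L \<Delta> d u c) (\<lambda>h. LINT x:\<Delta>h h|lattice_lborel L. f x) sums (\<Sum>x\<in>\<Delta> \<inter> L. f x)"
proof -
  obtain ws where "represents ws f" using assms by (auto simp: good_def)
  note f = representsD[OF this]
  obtain \<epsilon> where \<epsilon>: "\<epsilon> > 0" "\<And>h. (\<forall>i\<in>{1..d}. \<bar>h i\<bar> < \<epsilon>) \<Longrightarrow> small h"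
    using small_exists by blast
  let ?Q = "{..<length ws}"
  let ?W = "\<lambda>q. fst (ws ! q)" and ?b = "\<lambda>q. snd (ws ! q)"
  have list: "(\<Sum>(W, b)\<leftarrow>ws. G W b) = (\<Sum>q\<in>?Q. G (?W q) (?b q))" for G :: "(real \<Rightarrow> complex) \<Rightarrow> (nat \<Rightarrow> real \<Rightarrow> complex) \<Rightarrow> complex"
    by (simp add: sum_list_sum_nth case_prod_beta atLeast0LessThan)
  have cont: "continuous_on {0..1} (?W q)" "continuous_on {0..1} (?b q l)" if "q \<in> ?Q" for q l
    using f(2) that nth_mem[of q ws] by (auto simp: case_prod_beta)
  let ?g = "\<lambda>h. LINT x:\<Delta>h h|lattice_lborel L. f x"
  have multi: "multi_deriv (\<lambda>q t. vector_derivative q (at t)) d m ?g (\<lambda>_. 0) =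
    (\<Sum>q\<in>?Q. integral {0..1} (\<lambda>t. ?W q t * (\<Prod>l=1..d. ?b q l t ^ m l)))" for m
  proof -
    have "multi_deriv (\<lambda>q t. vector_derivative q (at t)) d m ?g (\<lambda>_. 0) =
      (\<Sum>q\<in>?Q. integral {0..1} (\<lambda>t. ?W q t * (\<Prod>l=1..d. ?b q l t ^ m l) * exp (\<Sum>l=1..d. ?b q l t * of_real ((\<lambda>_. 0) l))))"
    proof (rule multi_deriv_exp_integral[OF \<epsilon>(1)])
      fix h :: "nat \<Rightarrow> real" assume "h \<in> polydisc d \<epsilon>"
      then have "small h" by (intro \<epsilon>(2)) (auto simp: polydisc_def)
      then show "?g h = (\<Sum>q\<in>?Q. integral {0..1} (\<lambda>t. ?W q t * exp (\<Sum>l=1..d. ?b q l t * of_real (h l))))"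
        using f(3) list[of "\<lambda>W b. integral {0..1} (\<lambda>t. W t * exp (\<Sum>l=1..d. b l t * of_real (h l)))"] by simp
    qed (use cont \<epsilon> in \<open>auto simp: polydisc_def\<close>)
    then show ?thesis by simp
  qed
  have "diff_op_term d (Todd L \<Delta> d u c) ?g k = (\<Sum>(W, b)\<leftarrow>ws. integral {0..1} (\<lambda>t. W t * homog k (\<lambda>l. b l t)))" for k
  proof -
    let ?\<tau> = "taylor_coeff d (Todd L \<Delta> d u c)"
    have "diff_op_term d (Todd L \<Delta> d u c) ?g k =
      (\<Sum>m\<in>multi_indices d k. \<Sum>q\<in>?Q. ?\<tau> m * integral {0..1} (\<lambda>t. ?W q t * (\<Prod>l=1..d. ?b q l t ^ m l)))"
      by (simp only: diff_op_term_def multi sum_distrib_left)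
    also have "\<dots> = (\<Sum>q\<in>?Q. \<Sum>m\<in>multi_indices d k. integral {0..1} (\<lambda>t. ?\<tau> m * (?W q t * (\<Prod>l=1..d. ?b q l t ^ m l))))"
      by (subst sum.swap) (simp only: integral_mult_right)
    also have "\<dots> = (\<Sum>q\<in>?Q. integral {0..1} (\<lambda>t. \<Sum>m\<in>multi_indices d k. ?\<tau> m * (?W q t * (\<Prod>l=1..d. ?b q l t ^ m l))))"
      by (intro sum.cong refl integral_sum[symmetric] finite_multi_indices integrable_continuous_interval continuous_intros cont)
    also have "\<dots> = (\<Sum>q\<in>?Q. integral {0..1} (\<lambda>t. ?W q t * homog k (\<lambda>l. ?b q l t)))"
      unfolding homog_def sum_distrib_left by (simp only: mult.left_commute)
    finally show ?thesis unfolding list .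
  qed
  then have "diff_op_term d (Todd L \<Delta> d u c) ?g = (\<lambda>k. \<Sum>(W, b)\<leftarrow>ws. integral {0..1} (\<lambda>t. W t * homog k (\<lambda>l. b l t)))"
    by (rule ext)
  then show ?thesis using f(4) by (simp only:)
qed

end

theorem theorem1:
  fixes L \<Delta> :: "'a::euclidean_space set"
    and d :: nat
    and facet :: "nat \<Rightarrow> 'a set"
    and u :: "nat \<Rightarrow> 'a"
    and c :: "nat \<Rightarrow> real"
    and f :: "'a \<Rightarrow> complex"
  assumes "is_lattice L"
    and "polytope \<Delta>" and "interior \<Delta> \<noteq> {}"
    and "simple_polytope \<Delta>" and "rational_polytope L \<Delta>"
    and "bij_betw facet {1..d} {F. F facet_of \<Delta>}"
    and "\<And>i. i \<in> {1..d} \<Longrightarrow> primitive_covector L (u i) \<and> inward_normal \<Delta> (facet i) (u i)"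
    and "\<Delta> = halfspaces d u c"
    and "\<And>i. i \<in> {1..d} \<Longrightarrow> c i \<in> \<int>"
    and "quasi_polynomial (admissible_exponent L \<Delta> d u c) f"
  shows "diff_op_term d (Todd L \<Delta> d u c)
           (\<lambda>h. LINT x:halfspaces d u (\<lambda>i. c i + h i)|lattice_lborel L. f x)
         sums (\<Sum>x\<in>\<Delta> \<inter> L. f x)"
proof -
  interpret simple_rational_polytope L \<Delta> d facet u c
    by unfold_locales (use assms in auto)
  show ?thesis
    using diff_op_term_sums[OF good_quasi_polynomial[OF assms(10)]] by (simp only: \<Delta>h_def)
qed

end
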